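(* Let $\varphi$ be the refinable function, i.e. the compactly supported distribution with $\varphi=\boldsymbol{T}\varphi$ and $\int\varphi=1$. Then $\varphi\in C^1(\mathbb{R}^s)$ if and only if for every Jordan block of $M$, with eigenvalue $\lambda$ and Jordan basis $E_\lambda=\{e_1,\ldots,e_\ell\}$, there exist continuous functions $\varphi_i\in\mathcal{S}'_{e_i}(\mathbb{R}^s)$, $i=1,\ldots,\ell$, not all identically zero, which satisfy the system $$\varphi_1=\lambda\,\boldsymbol{T}\varphi_1,\qquad \varphi_i=\lambda\,\boldsymbol{T}\varphi_i+\sum_{j=1}^{i-1}(-1)^{j-1}\lambda^{-j}\varphi_{i-j},\quad i=2,\ldots,\ell.$$ In this case, after multiplying the solution of the system of each Jordan block by a suitable nonzero constant, one has $\frac{\partial\varphi}{\partial e_i}=\varphi_i$ for all $e_i$ in the Jordan basis $E$ of $M$.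
   Context: Setting. $M\in\mathbb{Z}^{s\times s}$ is an expansive integer matrix (all its eigenvalues are larger than $1$ in absolute value), $m=|\det M|$. $c=(c_k)_{k\in\mathbb{Z}^s}$ is a finitely supported real sequence satisfying the sum rules $\sum_{k\in\mathbb{Z}^s}c_{Mk-d}=1$ for every $d$ in a complete set of representatives $D(M)$ of $\mathbb{Z}^s/M\mathbb{Z}^s$ (so $\sum_kc_k=m$). The transition operator on distributions is $(\boldsymbol{T}f)(x)=\sum_{k\in\mathbb{Z}^s}c_kf(Mx-k)$. $E=\{e_1,\ldots,e_s\}\subset\mathbb{R}^s$ is a Jordan basis of $M$ in $\mathbb{R}^s$, consisting of eigenvectors and generalized eigenvectors. For each $\ell\times\ell$ Jordan block with eigenvalue $\lambda$, the corresponding part of the basis is denoted (with local numbering) $E_\lambda=\{e_1,\ldots,e_\ell\}$, where $Me_1=\lambda e_1$ and $Me_i=\lambda e_i+e_{i-1}$ for $i=2,\ldots,\ell$. For $a\in\mathbb{R}^s$, $\mathcal{S}'_a(\mathbb{R}^s)$ is the space of compactly supported distributions whose mean along every straight line parallel to $a$ is zero; for a continuous compactly supported $f$ this means $\int_{\mathbb{R}}f(at+b)\,dt=0$ for all $b\in\mathbb{R}^s$. $\frac{\partial\varphi}{\partial a}=(a,\nabla\varphi)$ is the directional derivative along $a$. *)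

theory Defs
  imports "HOL-Analysis.Analysis"
begin

section \<open>Integer dilation matrices and masks\<close>

definition rvec :: "int^'n \<Rightarrow> real^'n" where
  "rvec k = (\<chi> i. real_of_int (k $ i))"

definition rmat :: "int^'n^'n \<Rightarrow> real^'n^'n" where
  "rmat M = map_matrix real_of_int M"

definition expansive :: "int^'n^'n \<Rightarrow> bool" where
  "expansive M \<longleftrightarrow>
     (\<forall>(\<mu>::complex) v. v \<noteq> 0 \<and> map_matrix of_int M *v v = \<mu> *s v \<longrightarrow> norm \<mu> > 1)"

definition complete_representatives :: "int^'n^'n \<Rightarrow> (int^'n) set \<Rightarrow> bool" where
  "complete_representatives M D \<longleftrightarrow> (\<forall>k. \<exists>!d. d \<in> D \<and> (\<exists>j. k = d + M *v j))"

text \<open>For an expansive \<open>M\<close> the map \<open>k \<mapsto> M k - d\<close> is injective, so for a finitely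
  supported \<open>c\<close> the index set below is finite.\<close>

definition sum_rules :: "int^'n^'n \<Rightarrow> (int^'n) set \<Rightarrow> (int^'n \<Rightarrow> real) \<Rightarrow> bool" where
  "sum_rules M D c \<longleftrightarrow>
     (\<forall>d\<in>D. (\<Sum>k | c (M *v k - d) \<noteq> 0. c (M *v k - d)) = 1)"

text \<open>The basis vector number \<open>i\<close> of block number \<open>b\<close> is \<open>e b i\<close>; blocks are numbered
  \<open>b < n\<close>, and block \<open>b\<close> has eigenvalue \<open>ev b\<close> and size \<open>len b\<close>, with vectors numbered from 1.\<close>

definition jordan_basis ::
  "real^'n^'n \<Rightarrow> nat \<Rightarrow> (nat \<Rightarrow> real) \<Rightarrow> (nat \<Rightarrow> nat) \<Rightarrow> (nat \<Rightarrow> nat \<Rightarrow> real^'n) \<Rightarrow> bool" where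
  "jordan_basis A n ev len e \<longleftrightarrow>
     (\<forall>b<n. len b \<ge> 1 \<and>
            A *v e b 1 = ev b *\<^sub>R e b 1 \<and>
            (\<forall>i\<in>{2..len b}. A *v e b i = ev b *\<^sub>R e b i + e b (i - 1))) \<and>
     inj_on (\<lambda>(b, i). e b i) (SIGMA b:{..<n}. {1..len b}) \<and>
     independent ((\<lambda>(b, i). e b i) ` (SIGMA b:{..<n}. {1..len b})) \<and>
     span ((\<lambda>(b, i). e b i) ` (SIGMA b:{..<n}. {1..len b})) = UNIV"


section \<open>Derivatives\<close>

definition gradient :: "(real^'n \<Rightarrow> real) \<Rightarrow> real^'n \<Rightarrow> real^'n" where
  "gradient f x = (\<chi> i. frechet_derivative f (at x) (axis i 1))"

definition directional_deriv :: "real^'n \<Rightarrow> (real^'n \<Rightarrow> real) \<Rightarrow> real^'n \<Rightarrow> real" where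
  "directional_deriv a f x = a \<bullet> gradient f x"

definition C1 :: "(real^'n \<Rightarrow> real) \<Rightarrow> bool" where
  "C1 f \<longleftrightarrow> (\<forall>x. f differentiable (at x)) \<and> continuous_on UNIV (gradient f)"

primrec iter_partial :: "'n list \<Rightarrow> (real^'n \<Rightarrow> real) \<Rightarrow> real^'n \<Rightarrow> real" where
  "iter_partial [] g = g"
| "iter_partial (i # is) g = iter_partial is (\<lambda>x. gradient g x $ i)"

definition smooth :: "(real^'n \<Rightarrow> real) \<Rightarrow> bool" where
  "smooth g \<longleftrightarrow> (\<forall>is x. iter_partial is g differentiable (at x))"


section \<open>Compactly supported distributions\<close>

text \<open>The space of compactly supported distributions is the dual of the space of all smooth
  functions with its usual Frechet topology. The values of a functional outside the smooth
  functions are irrelevant. The last condition is continuity: \<open>\<bar>\<phi> g\<bar>\<close> is at most \<open>C\<close> times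
  the maximum over \<open>K\<close> of the partial derivatives of \<open>g\<close> of order up to \<open>N\<close>.\<close>

definition compact_distribution :: "((real^'n \<Rightarrow> real) \<Rightarrow> real) \<Rightarrow> bool" where
  "compact_distribution \<phi> \<longleftrightarrow>
     (\<forall>g h. smooth g \<and> smooth h \<longrightarrow> \<phi> (\<lambda>x. g x + h x) = \<phi> g + \<phi> h) \<and>
     (\<forall>a g. smooth g \<longrightarrow> \<phi> (\<lambda>x. a * g x) = a * \<phi> g) \<and>
     (\<exists>K C N. compact K \<and>
        (\<forall>g B. smooth g \<and> (\<forall>is x. length is \<le> N \<and> x \<in> K \<longrightarrow> \<bar>iter_partial is g x\<bar> \<le> B)
               \<longrightarrow> \<bar>\<phi> g\<bar> \<le> C * B))"

text \<open>The integral of a compactly supported distribution is its value on the constant 1.\<close>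

definition dist_integral :: "((real^'n \<Rightarrow> real) \<Rightarrow> real) \<Rightarrow> real" where
  "dist_integral \<phi> = \<phi> (\<lambda>_. 1)"

definition compactly_supported :: "(real^'n \<Rightarrow> real) \<Rightarrow> bool" where
  "compactly_supported f \<longleftrightarrow> compact (closure {x. f x \<noteq> 0})"

text \<open>A continuous function that represents a compactly supported distribution necessarily has
  compact support; requiring it here makes every integral below a genuine one.\<close>

definition represents :: "(real^'n \<Rightarrow> real) \<Rightarrow> ((real^'n \<Rightarrow> real) \<Rightarrow> real) \<Rightarrow> bool" where
  "represents f \<phi> \<longleftrightarrow> continuous_on UNIV f \<and> compactly_supported f \<and>
     (\<forall>g. smooth g \<longrightarrow> \<phi> g = (\<integral>x. f x * g x \<partial>lborel))"

definition dist_C1 :: "((real^'n \<Rightarrow> real) \<Rightarrow> real) \<Rightarrow> bool" where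
  "dist_C1 \<phi> \<longleftrightarrow> (\<exists>f. C1 f \<and> represents f \<phi>)"

text \<open>The continuous elements of the space of compactly supported distributions with zero mean
  along every line parallel to \<open>a\<close>.\<close>

definition cont_mean_zero :: "real^'n \<Rightarrow> (real^'n \<Rightarrow> real) set" where
  "cont_mean_zero a = {f. continuous_on UNIV f \<and> compactly_supported f \<and>
     (\<forall>b. (\<integral>t. f (t *\<^sub>R a + b) \<partial>lborel) = 0)}"


section \<open>The transition operator\<close>

definition transition ::
  "int^'n^'n \<Rightarrow> (int^'n \<Rightarrow> real) \<Rightarrow> (real^'n \<Rightarrow> real) \<Rightarrow> real^'n \<Rightarrow> real" where
  "transition M c f x = (\<Sum>k | c k \<noteq> 0. c k * f (rmat M *v x - rvec k))"

text \<open>On distributions, \<open>\<phi>(M x - k)\<close> is defined by the change of variables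
  \<open>y = M x - k\<close>, that is \<open>x = M\<^sup>-\<^sup>1 (y + k)\<close> and \<open>dx = dy / \<bar>det M\<bar>\<close>.\<close>

definition dist_transition ::
  "int^'n^'n \<Rightarrow> (int^'n \<Rightarrow> real) \<Rightarrow> ((real^'n \<Rightarrow> real) \<Rightarrow> real) \<Rightarrow> (real^'n \<Rightarrow> real) \<Rightarrow> real" where
  "dist_transition M c \<phi> g =
     (\<Sum>k | c k \<noteq> 0. c k * (\<phi> (\<lambda>y. g (matrix_inv (rmat M) *v (y + rvec k))) / \<bar>det (rmat M)\<bar>))"

definition refinable ::
  "int^'n^'n \<Rightarrow> (int^'n \<Rightarrow> real) \<Rightarrow> ((real^'n \<Rightarrow> real) \<Rightarrow> real) \<Rightarrow> bool" where
  "refinable M c \<phi> \<longleftrightarrow> compact_distribution \<phi> \<and>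
     (\<forall>g. smooth g \<longrightarrow> \<phi> g = dist_transition M c \<phi> g) \<and> dist_integral \<phi> = 1"

definition block_solution ::
  "int^'n^'n \<Rightarrow> (int^'n \<Rightarrow> real) \<Rightarrow> real \<Rightarrow> nat \<Rightarrow> (nat \<Rightarrow> real^'n)
     \<Rightarrow> (nat \<Rightarrow> real^'n \<Rightarrow> real) \<Rightarrow> bool" where
  "block_solution M c ev l e \<psi> \<longleftrightarrow>
     (\<forall>i\<in>{1..l}. \<psi> i \<in> cont_mean_zero (e i)) \<and>
     (\<exists>i\<in>{1..l}. \<exists>x. \<psi> i x \<noteq> 0) \<and>
     (\<forall>x. \<psi> 1 x = ev * transition M c (\<psi> 1) x) \<and>
     (\<forall>i\<in>{2..l}. \<forall>x. \<psi> i x = ev * transition M c (\<psi> i) x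
        + (\<Sum>j=1..i-1. (-1)^(j-1) * ev powi (- int j) * \<psi> (i-j) x))"

end

theory Submission
  imports Defs
begin

text \<open>Write \<open>T\<close> for the transition operator and let \<open>e\<^sub>1, \<dots>, e\<^sub>l\<close> be a Jordan chain of \<open>M\<close>
with eigenvalue \<open>\<lambda>\<close>. Differentiating \<open>\<phi> = T \<phi>\<close> along \<open>e\<^sub>i\<close> and using
\<open>M e\<^sub>i = \<lambda> e\<^sub>i + e\<^sub>i\<^sub>-\<^sub>1\<close> gives \<open>\<partial>\<^sub>i \<phi> = \<lambda> T \<partial>\<^sub>i \<phi> + T \<partial>\<^sub>i\<^sub>-\<^sub>1 \<phi>\<close>. Eliminating
the terms \<open>T \<partial>\<^sub>i\<^sub>-\<^sub>1 \<phi>\<close> one after the other turns this into the system of the block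
(\<open>block_system_iff\<close>), so the derivatives of a continuously differentiable \<open>\<phi>\<close> solve it.

Conversely, let \<open>\<psi>\<^sub>1, \<dots>, \<psi>\<^sub>l\<close> be a solution. Because its line integrals vanish, \<open>\<psi>\<^sub>1\<close> is the
derivative along \<open>e\<^sub>1\<close> of a continuous function \<open>h\<close> of compact support. The first equation says
that \<open>T h - h\<close> is constant along \<open>e\<^sub>1\<close>, hence \<open>T h = h\<close>. Two facts now finish the proof.

Uniqueness (\<open>compact_distribution_refinement_eq_0\<close>): a compactly supported distribution that is
fixed by \<open>T\<close> and kills the constant 1 is zero. Since powers of the inverse of \<open>M\<close> tend to zero,
the equation determines all moments by induction on the degree, so the distribution kills every
polynomial. The adjoint of \<open>T\<close> composes test functions with contractions; it shrinks derivatives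
of high order faster than its coefficients can grow, so its iterates turn any test function into a
polynomial (the Taylor polynomial) up to an error that tends to zero. Hence all fixed points of \<open>T\<close>
are multiples of \<open>\<phi>\<close>, and this is also what makes the solutions of all blocks fit together.

Rigidity (\<open>chain_derivatives\<close>): if \<open>h = T h\<close> and \<open>\<partial>\<^sub>1 h = \<psi>\<^sub>1\<close>, then \<open>\<partial>\<^sub>i h = \<psi>\<^sub>i\<close> for all
\<open>i\<close>. In the induction step let \<open>u\<close> be the difference between the antiderivative of \<open>\<psi>\<^sub>i\<close> along
\<open>e\<^sub>i\<close> and \<open>h\<close>. The system says that, weakly, the derivative of \<open>u\<close> along \<open>e\<^sub>i\<close> is \<open>\<lambda>\<close> times the
derivative of \<open>T u\<close> along \<open>M\<^sup>-\<^sup>1 e\<^sub>i\<close>. Iterating, the integrals of \<open>u\<close> over all lines parallel to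
\<open>M\<^sup>-\<^sup>k e\<^sub>i\<close> vanish, for every \<open>k \<ge> 1\<close>. For \<open>i \<ge> 2\<close> these directions are pairwise different, and a
function of compact support whose ray transform vanishes in infinitely many directions of this
kind is zero (\<open>ray_transform_injective\<close>). So \<open>\<psi>\<^sub>i\<close> is the derivative of \<open>h\<close>.

Consequently \<open>h \<noteq> 0\<close> unless the whole solution vanishes, \<open>\<phi>\<close> is a nonzero multiple of \<open>h\<close>, and the
continuous functions \<open>\<psi>\<^sub>i\<close> are, up to that multiple, its derivatives along the basis vectors.
With all blocks at hand \<open>\<phi>\<close> is continuously differentiable (\<open>C1_if_directional\<close>).\<close>

section \<open>Linear changes of variables in Lebesgue integrals\<close>

lemma nn_integral_lborel_translate:
  fixes f :: "'a::euclidean_space \<Rightarrow> ennreal"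
  assumes [measurable]: "f \<in> borel_measurable borel"
  shows "(\<integral>\<^sup>+x. f (x + a) \<partial>lborel) = (\<integral>\<^sup>+x. f x \<partial>lborel)"
proof -
  have "(\<integral>\<^sup>+x. f x \<partial>lborel) = (\<integral>\<^sup>+x. f x \<partial>distr lborel borel ((+) a))"
    by (simp add: lborel_distr_plus)
  also have "\<dots> = (\<integral>\<^sup>+x. f (a + x) \<partial>lborel)"
    by (subst nn_integral_distr) auto
  finally show ?thesis by (simp add: add.commute)
qed

text \<open>A shear translates along a coordinate axis by an amount that depends on another coordinate. After
averaging over an additional translation along the axis, with a weight of integral one, the
amount of the shear can be moved by Fubini from the integrand into the argument of the weight,
where it no longer matters.\<close>
lemma nn_integral_lborel_shear:
  fixes f :: "real^'n \<Rightarrow> ennreal"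
  assumes [measurable]: "f \<in> borel_measurable borel" and mn: "m \<noteq> n"
  shows "(\<integral>\<^sup>+x. f (x + (c * x$n) *\<^sub>R axis m 1) \<partial>lborel) = (\<integral>\<^sup>+x. f x \<partial>lborel)"
proof -
  define w :: "real \<Rightarrow> ennreal" where "w = indicator {0..1}"
  have [measurable]: "w \<in> borel_measurable borel" by (simp add: w_def)
  have w1: "(\<integral>\<^sup>+t. w (t + a) \<partial>lborel) = 1" for a
    by (subst nn_integral_lborel_translate) (simp_all add: w_def)
  have [measurable]: "(\<lambda>x::real^'n. x $ n) \<in> borel_measurable borel"
    by (intro borel_measurable_continuous_onI continuous_intros)
  have [simp]: "axis m (1::real) $ n = 0" using mn by (simp add: axis_def)
  let ?e = "axis m (1::real) :: real^'n"
  have "(\<integral>\<^sup>+x. f (x + (c * x$n) *\<^sub>R ?e) \<partial>lborel)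
      = (\<integral>\<^sup>+t. w (t + 0) * (\<integral>\<^sup>+x. f (x + (c * x$n) *\<^sub>R ?e) \<partial>lborel) \<partial>lborel)"
    by (subst nn_integral_multc, measurable, subst w1, simp)
  also have "\<dots> = (\<integral>\<^sup>+t. w t * (\<integral>\<^sup>+x. f (x + (c * x$n + t) *\<^sub>R ?e) \<partial>lborel) \<partial>lborel)"
  proof (rule nn_integral_cong)
    fix t :: real
    have "(\<integral>\<^sup>+x. f (x + (c * x$n) *\<^sub>R ?e) \<partial>lborel)
        = (\<integral>\<^sup>+x. f ((x + t *\<^sub>R ?e) + (c * (x + t *\<^sub>R ?e)$n) *\<^sub>R ?e) \<partial>lborel)"
      by (subst nn_integral_lborel_translate[where a = "t *\<^sub>R ?e" and f = "\<lambda>x. f (x + (c * x$n) *\<^sub>R ?e)"]) auto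
    then show "w (t + 0) * (\<integral>\<^sup>+x. f (x + (c * x$n) *\<^sub>R ?e) \<partial>lborel)
       = w t * (\<integral>\<^sup>+x. f (x + (c * x$n + t) *\<^sub>R ?e) \<partial>lborel)"
      by (simp add: algebra_simps)
  qed
  also have "\<dots> = (\<integral>\<^sup>+t. (\<integral>\<^sup>+x. w t * f (x + (c * x$n + t) *\<^sub>R ?e) \<partial>lborel) \<partial>lborel)"
    by (intro nn_integral_cong nn_integral_cmult[symmetric]) measurable
  also have "\<dots> = (\<integral>\<^sup>+x. (\<integral>\<^sup>+t. w t * f (x + (c * x$n + t) *\<^sub>R ?e) \<partial>lborel) \<partial>lborel)"
    by (rule lborel_pair.Fubini') measurable
  also have "\<dots> = (\<integral>\<^sup>+x. (\<integral>\<^sup>+t. w (t + - (c * x$n)) * f (x + t *\<^sub>R ?e) \<partial>lborel) \<partial>lborel)"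
  proof (rule nn_integral_cong)
    fix x :: "real^'n"
    show "(\<integral>\<^sup>+t. w t * f (x + (c * x$n + t) *\<^sub>R ?e) \<partial>lborel) = (\<integral>\<^sup>+t. w (t + - (c * x$n)) * f (x + t *\<^sub>R ?e) \<partial>lborel)"
      using nn_integral_lborel_translate[where a = "- (c * x$n)" and f = "\<lambda>t. w t * f (x + (c * x$n + t) *\<^sub>R ?e)"]
      by simp
  qed
  also have "\<dots> = (\<integral>\<^sup>+t. (\<integral>\<^sup>+x. w (t + - (c * x$n)) * f (x + t *\<^sub>R ?e) \<partial>lborel) \<partial>lborel)"
    by (rule lborel_pair.Fubini'[symmetric]) measurable
  also have "\<dots> = (\<integral>\<^sup>+t. (\<integral>\<^sup>+x. w (t + - (c * x$n)) * f x \<partial>lborel) \<partial>lborel)"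
  proof (rule nn_integral_cong)
    fix t :: real
    show "(\<integral>\<^sup>+x. w (t + - (c * x$n)) * f (x + t *\<^sub>R ?e) \<partial>lborel) = (\<integral>\<^sup>+x. w (t + - (c * x$n)) * f x \<partial>lborel)"
      using nn_integral_lborel_translate[where a = "t *\<^sub>R ?e" and f = "\<lambda>x. w (t + - (c * x$n)) * f x"]
      by simp
  qed
  also have "\<dots> = (\<integral>\<^sup>+x. (\<integral>\<^sup>+t. w (t + - (c * x$n)) * f x \<partial>lborel) \<partial>lborel)"
    by (rule lborel_pair.Fubini') measurable
  also have "\<dots> = (\<integral>\<^sup>+x. f x \<partial>lborel)"
    by (subst nn_integral_multc, measurable, subst w1, simp)
  finally show ?thesis .
qed

lemma borel_measurable_matrix_vector_mult [measurable]:
  "(\<lambda>x. (A::real^'n^'m) *v x) \<in> borel_measurable borel"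
  by (intro borel_measurable_continuous_onI linear_continuous_on) auto

lemma nn_integral_lborel_swap:
  fixes f :: "real^'n \<Rightarrow> ennreal"
  assumes [measurable]: "f \<in> borel_measurable borel"
  shows "(\<integral>\<^sup>+x. f (\<chi> i. x $ Transposition.transpose m n i) \<partial>lborel) = (\<integral>\<^sup>+x. f x \<partial>lborel)"
proof -
  let ?p = "Transposition.transpose m n"
  let ?h = "\<lambda>x::real^'n. (\<chi> i. x $ ?p i)"
  have [measurable]: "?h \<in> borel_measurable borel"
    by (intro borel_measurable_continuous_onI continuous_intros)
  have "lborel = distr lborel borel ?h"
  proof (rule lborel_eqI)
    fix l u :: "real^'n"
    assume le: "\<And>b. b \<in> Basis \<Longrightarrow> l \<bullet> b \<le> u \<bullet> b"
    have le': "l $ i \<le> u $ i" for i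
      using le[of "axis i 1"] by (simp add: inner_axis)
    have "?h -` box l u = box (?h l) (?h u)"
      by (auto simp: mem_box_cart) (metis transpose_involutory)+
    then have "emeasure (distr lborel borel ?h) (box l u) = emeasure lborel (box (?h l) (?h u))"
      by (subst emeasure_distr) auto
    also have "\<dots> = ennreal (\<Prod>b\<in>Basis. (?h u - ?h l) \<bullet> b)"
      by (rule emeasure_lborel_box) (auto simp: Basis_vec_def inner_axis le')
    also have "(\<Prod>b\<in>Basis. (?h u - ?h l) \<bullet> b) = (\<Prod>i\<in>UNIV. (?h u - ?h l) $ i)"
      by (rule prod.reindex_bij_witness[of _ "\<lambda>i. axis i 1" "\<lambda>b. THE i. b = axis i 1"])
         (auto simp: Basis_vec_def inner_axis axis_eq_axis)
    also have "\<dots> = (\<Prod>i\<in>UNIV. (u - l) $ i)"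
      by (simp, rule prod.reindex_bij_witness[of _ ?p ?p]) auto
    also have "\<dots> = (\<Prod>b\<in>Basis. (u - l) \<bullet> b)"
      by (rule prod.reindex_bij_witness[of _ "\<lambda>b. THE i. b = axis i 1" "\<lambda>i. axis i 1"])
         (auto simp: Basis_vec_def inner_axis axis_eq_axis)
    finally show "emeasure (distr lborel borel ?h) (box l u) = ennreal (\<Prod>b\<in>Basis. (u - l) \<bullet> b)" .
  qed simp
  then have "(\<integral>\<^sup>+x. f x \<partial>lborel) = (\<integral>\<^sup>+x. f x \<partial>distr lborel borel ?h)" by simp
  also have "\<dots> = (\<integral>\<^sup>+x. f (?h x) \<partial>lborel)" by (rule nn_integral_distr) auto
  finally show ?thesis by simp
qed

lemma nn_integral_lborel_diagonal:
  fixes f :: "real^'n \<Rightarrow> ennreal" and A :: "real^'n^'n"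
  assumes [measurable]: "f \<in> borel_measurable borel"
    and d: "\<And>i j. i \<noteq> j \<Longrightarrow> A$i$j = 0" and det: "det A \<noteq> 0"
  shows "ennreal \<bar>det A\<bar> * (\<integral>\<^sup>+x. f (A *v x) \<partial>lborel) = (\<integral>\<^sup>+x. f x \<partial>lborel)"
proof -
  define c :: "real^'n \<Rightarrow> real" where "c b = (A *v b) \<bullet> b" for b
  have cax: "c (axis i 1) = A $ i $ i" for i
    by (simp add: c_def inner_axis matrix_vector_mult_basis column_def)
  have ax: "axis i (1::real) $ k = (if i = k then 1 else 0)" for i k :: 'n
    by (simp add: axis_def)
  have dA: "det A = (\<Prod>i\<in>UNIV. A$i$i)" by (rule det_diagonal[OF d])
  then have nz: "A$i$i \<noteq> 0" for i using det by auto
  have T: "0 + (\<Sum>j\<in>Basis. (c j * (x \<bullet> j)) *\<^sub>R j) = A *v x" for x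
  proof -
    have "(\<Sum>j\<in>Basis. (c j * (x \<bullet> j)) *\<^sub>R j) = (\<Sum>i\<in>UNIV. (c (axis i 1) * (x \<bullet> axis i 1)) *\<^sub>R axis i 1)"
      by (rule sum.reindex_bij_witness[of _ "\<lambda>i. axis i 1" "\<lambda>b. THE i. b = axis i 1"])
         (auto simp: Basis_vec_def inner_axis axis_eq_axis)
    also have "\<dots> $ k = (A *v x) $ k" for k
    proof -
      have "(\<Sum>j\<in>UNIV. A $ k $ j * x $ j) = (\<Sum>j\<in>UNIV. if j = k then A $ k $ k * x $ k else 0)"
        by (rule sum.cong) (auto simp: d)
      then show ?thesis
        by (simp add: cax inner_axis matrix_vector_mult_def ax if_distrib cong: if_cong)
    qed
    ultimately show ?thesis by (simp add: vec_eq_iff)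
  qed
  have det': "(\<Prod>j\<in>Basis. \<bar>c j\<bar>) = \<bar>det A\<bar>"
  proof -
    have "(\<Prod>j\<in>Basis. \<bar>c j\<bar>) = (\<Prod>i\<in>UNIV. \<bar>c (axis i 1)\<bar>)"
      by (rule prod.reindex_bij_witness[of _ "\<lambda>i. axis i 1" "\<lambda>b. THE i. b = axis i 1"])
         (auto simp: Basis_vec_def inner_axis axis_eq_axis)
    then show ?thesis by (simp add: cax dA abs_prod)
  qed
  have "lborel = density (distr lborel borel (\<lambda>x. A *v x)) (\<lambda>_. (\<Prod>j\<in>Basis. \<bar>c j\<bar>))"
    using lborel_affine_euclidean[of c 0, unfolded T] cax nz by (force simp: Basis_vec_def)
  then have "lborel = density (distr lborel borel (\<lambda>x. A *v x)) (\<lambda>_. ennreal \<bar>det A\<bar>)"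
    by (simp add: det')
  then have "(\<integral>\<^sup>+x. f x \<partial>lborel) = (\<integral>\<^sup>+x. f x \<partial>density (distr lborel borel (\<lambda>x. A *v x)) (\<lambda>_. ennreal \<bar>det A\<bar>))"
    by simp
  also have "\<dots> = (\<integral>\<^sup>+x. ennreal \<bar>det A\<bar> * f (A *v x) \<partial>lborel)"
    by (simp add: nn_integral_density nn_integral_distr)
  also have "\<dots> = ennreal \<bar>det A\<bar> * (\<integral>\<^sup>+x. f (A *v x) \<partial>lborel)"
    by (rule nn_integral_cmult) measurable
  finally show ?thesis by simp
qed

text \<open>The formula is inherited by products of matrices, so it suffices to treat elementary matrices.\<close>
lemma nn_integral_lborel_linear:
  fixes f :: "real^'n \<Rightarrow> ennreal" and A :: "real^'n^'n"
  assumes "f \<in> borel_measurable borel" and "det A \<noteq> 0"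
  shows "ennreal \<bar>det A\<bar> * (\<integral>\<^sup>+x. f (A *v x) \<partial>lborel) = (\<integral>\<^sup>+x. f x \<partial>lborel)"
proof -
  define P where "P A \<longleftrightarrow> (\<forall>f. f \<in> borel_measurable borel \<longrightarrow> det A \<noteq> 0 \<longrightarrow>
     ennreal \<bar>det A\<bar> * (\<integral>\<^sup>+x. f (A *v x) \<partial>lborel) = (\<integral>\<^sup>+x. f x \<partial>lborel))" for A :: "real^'n^'n"
  have "P A"
  proof (rule induct_matrix_elementary)
    fix A B assume A: "P A" and B: "P B"
    show "P (A ** B)" unfolding P_def
    proof (intro allI impI)
      fix f :: "real^'n \<Rightarrow> ennreal" assume f[measurable]: "f \<in> borel_measurable borel" and "det (A ** B) \<noteq> 0"
      then have "det A \<noteq> 0" "det B \<noteq> 0" by (auto simp: det_mul)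
      then show "ennreal \<bar>det (A ** B)\<bar> * (\<integral>\<^sup>+x. f ((A ** B) *v x) \<partial>lborel) = (\<integral>\<^sup>+x. f x \<partial>lborel)"
        using A[unfolded P_def, rule_format, of f] B[unfolded P_def, rule_format, of "\<lambda>x. f (A *v x)"]
        by (simp add: det_mul abs_mult ennreal_mult matrix_vector_mul_assoc[symmetric] mult.assoc)
    qed
  next
    fix A :: "real^'n^'n" and i assume "row i A = 0"
    then show "P A" by (simp add: P_def det_zero_row)
  next
    fix A :: "real^'n^'n" assume "\<And>i j. i \<noteq> j \<Longrightarrow> A $ i $ j = 0"
    then show "P A" unfolding P_def using nn_integral_lborel_diagonal by blast
  next
    fix m n :: 'n assume "m \<noteq> n"
    let ?A = "(\<chi> i j. mat 1 $ i $ Transposition.transpose m n j) :: real^'n^'n"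
    have "?A *v x = (\<chi> i. x $ Transposition.transpose m n i)" for x
    proof -
      have "(?A *v x) $ i = x $ Transposition.transpose m n i" for i
      proof -
        have "(?A *v x) $ i = (\<Sum>j\<in>UNIV. if j = Transposition.transpose m n i then x $ j else 0)"
          unfolding matrix_vector_mult_def mat_def vec_lambda_beta
          by (rule sum.cong) (auto simp: transpose_involutory)
        then show ?thesis by simp
      qed
      then show ?thesis by (simp add: vec_eq_iff)
    qed
    moreover have "\<bar>det ?A\<bar> = 1"
      using \<open>m \<noteq> n\<close> by (simp add: det_permute_columns permutes_swap_id sign_swap_id abs_mult)
    ultimately show "P ?A" unfolding P_def by (simp add: nn_integral_lborel_swap)
  next
    fix m n :: 'n and c :: real assume mn: "m \<noteq> n"
    let ?A = "(\<chi> i j. if i = m \<and> j = n then c else of_bool (i = j)) :: real^'n^'n"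
    have "?A *v x = x + (c * x$n) *\<^sub>R axis m 1" for x
    proof -
      have "(?A *v x) $ i = (x + (c * x$n) *\<^sub>R axis m 1) $ i" for i
      proof -
        have "(?A *v x) $ i = (\<Sum>j\<in>UNIV. (if j = i then x $ i else 0) + (if j = n then (if i = m then c * x $ n else 0) else 0))"
          unfolding matrix_vector_mult_def vec_lambda_beta using mn by (intro sum.cong) auto
        then show ?thesis by (auto simp: sum.distrib axis_def)
      qed
      then show ?thesis by (simp add: vec_eq_iff)
    qed
    moreover have "det ?A = 1"
    proof -
      have "?A = (\<chi> k. if k = m then row m (mat 1) + c *s row n (mat 1) else row k (mat 1))"
        using mn by (auto simp: vec_eq_iff row_def mat_def)
      then show ?thesis using det_row_operation[OF mn, of "mat 1" c] by (simp only: det_I)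
    qed
    ultimately show "P ?A" unfolding P_def using mn by (simp add: nn_integral_lborel_shear)
  qed
  then show ?thesis using assms by (auto simp: P_def)
qed

lemma lebesgue_integral_linear_image:
  fixes h :: "real^'n \<Rightarrow> real" and A :: "real^'n^'n"
  assumes [measurable]: "h \<in> borel_measurable borel" and d: "det A \<noteq> 0"
  shows "(LBINT x. h (A *v x)) = (LBINT x. h x) / \<bar>det A\<bar>"
proof -
  have eq: "lborel = density (distr lborel borel (\<lambda>x. A *v x)) (\<lambda>_. ennreal \<bar>det A\<bar>)" (is "_ = ?R")
  proof (rule measure_eqI)
    fix S assume "S \<in> sets (lborel :: (real^'n) measure)"
    then have [measurable]: "S \<in> sets borel" by simp
    have "emeasure lborel S = (\<integral>\<^sup>+x. indicator S x \<partial>lborel)" by simp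
    also have "\<dots> = ennreal \<bar>det A\<bar> * (\<integral>\<^sup>+x. indicator S (A *v x) \<partial>lborel)"
      by (rule nn_integral_lborel_linear[symmetric]) (auto simp: d)
    also have "\<dots> = (\<integral>\<^sup>+x. ennreal \<bar>det A\<bar> * indicator S (A *v x) \<partial>lborel)"
      by (rule nn_integral_cmult[symmetric]) measurable
    also have "\<dots> = (\<integral>\<^sup>+x. ennreal \<bar>det A\<bar> * indicator S x \<partial>distr lborel borel (\<lambda>x. A *v x))"
      by (rule nn_integral_distr[symmetric]) auto
    also have "\<dots> = emeasure ?R S"
      by (rule emeasure_density[symmetric]) auto
    finally show "emeasure lborel S = emeasure ?R S" .
  qed simp
  have "(LBINT x. h x) = (\<integral>x. \<bar>det A\<bar> * h x \<partial>distr lborel borel (\<lambda>x. A *v x))"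
    by (subst eq, subst integral_density) auto
  also have "\<dots> = \<bar>det A\<bar> * (LBINT x. h (A *v x))"
    by (simp add: integral_distr)
  finally show ?thesis using d by simp
qed

section \<open>Smooth functions and their iterated partial derivatives\<close>
lemma gradient_nth: "gradient f x $ i = frechet_derivative f (at x) (axis i 1)"
  by (simp add: gradient_def)

lemma gradient_nth_eqI:
  assumes "(f has_derivative f') (at x)"
  shows "gradient f x $ i = f' (axis i 1)"
  using frechet_derivative_at[OF assms] by (simp add: gradient_nth)

lemma frechet_derivative_eq_gradient:
  assumes "f differentiable (at x)"
  shows "frechet_derivative f (at x) h = gradient f x \<bullet> h"
proof -
  have lin: "linear (frechet_derivative f (at x))"
    using assms by (rule linear_frechet_derivative)
  have "frechet_derivative f (at x) h = frechet_derivative f (at x) (\<Sum>i\<in>UNIV. h $ i *\<^sub>R axis i 1)"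
    using basis_expansion[of h] by (simp add: scalar_mult_eq_scaleR)
  also have "\<dots> = (\<Sum>i\<in>UNIV. h $ i * gradient f x $ i)"
    by (simp add: linear_sum[OF lin] linear_cmul[OF lin] gradient_nth)
  finally show ?thesis by (simp add: inner_vec_def mult.commute)
qed

lemma has_derivative_gradient:
  assumes "f differentiable (at x)"
  shows "(f has_derivative (\<lambda>h. gradient f x \<bullet> h)) (at x)"
  using assms frechet_derivative_works[of f "at x"] frechet_derivative_eq_gradient[OF assms]
  by (metis (no_types, lifting) ext)

lemma gradient_add:
  assumes "f differentiable (at x)" "g differentiable (at x)"
  shows "gradient (\<lambda>x. f x + g x) x = gradient f x + gradient g x"
  using gradient_nth_eqI[OF has_derivative_add[OF assms[THEN has_derivative_gradient]]]
  by (simp add: vec_eq_iff inner_axis)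

lemma gradient_cmult:
  assumes "f differentiable (at x)"
  shows "gradient (\<lambda>x. a * f x) x = a *\<^sub>R gradient f x"
  using gradient_nth_eqI[OF has_derivative_mult_right[OF assms[THEN has_derivative_gradient]]]
  by (simp add: vec_eq_iff inner_axis)

lemma gradient_mult:
  assumes "f differentiable (at x)" "g differentiable (at x)"
  shows "gradient (\<lambda>x. f x * g x) x = f x *\<^sub>R gradient g x + g x *\<^sub>R gradient f x"
  using gradient_nth_eqI[OF has_derivative_mult[OF assms[THEN has_derivative_gradient]]]
  by (simp add: vec_eq_iff inner_axis)

lemma gradient_affine:
  fixes B :: "real^'n^'m"
  assumes "f differentiable (at (B *v x + t))"
  shows "gradient (\<lambda>x. f (B *v x + t)) x $ i = (\<Sum>j\<in>UNIV. B$j$i * gradient f (B *v x + t) $ j)"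
    and "(\<lambda>x. f (B *v x + t)) differentiable (at x)"
proof -
  have "((\<lambda>x. B *v x + t) has_derivative (\<lambda>h. B *v h)) (at x)"
    by (auto intro!: derivative_eq_intros bounded_linear.has_derivative[of "(*v) B"])
  from diff_chain_at[OF this has_derivative_gradient[OF assms]]
  have d: "((\<lambda>x. f (B *v x + t)) has_derivative (\<lambda>h. gradient f (B *v x + t) \<bullet> (B *v h))) (at x)"
    by (simp add: o_def)
  then show "(\<lambda>x. f (B *v x + t)) differentiable (at x)" by (auto simp: differentiable_def)
  show "gradient (\<lambda>x. f (B *v x + t)) x $ i = (\<Sum>j\<in>UNIV. B$j$i * gradient f (B *v x + t) $ j)"
    using gradient_nth_eqI[OF d, of i]
    by (simp add: matrix_vector_mult_basis column_def inner_vec_def mult.commute)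
qed

lemma smooth_differentiable: "smooth g \<Longrightarrow> g differentiable (at x)"
  unfolding smooth_def by (metis iter_partial.simps(1))

lemma smooth_partial: "smooth g \<Longrightarrow> smooth (\<lambda>x. gradient g x $ i)"
  unfolding smooth_def by (metis iter_partial.simps(2))

lemma smooth_iter_partial: "smooth g \<Longrightarrow> smooth (iter_partial is g)"
  by (induction "is" arbitrary: g) (auto simp: smooth_partial)

text \<open>Smoothness is the greatest class of everywhere differentiable functions that is closed under
partial derivatives. This gives the closure properties without computing iterated derivatives.\<close>
lemma smooth_coinduct:
  assumes "S g"
    and step: "\<And>g. S g \<Longrightarrow> (\<forall>x. g differentiable (at x)) \<and> (\<forall>i. S (\<lambda>x. gradient g x $ i))"
  shows "smooth g"
proof -
  have "iter_partial is g differentiable (at x)" for "is" x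
    using \<open>S g\<close> by (induction "is" arbitrary: g) (auto simp: step)
  then show ?thesis by (simp add: smooth_def)
qed

lemma smooth_continuous_on: "smooth g \<Longrightarrow> continuous_on A g"
  by (meson continuous_at_imp_continuous_on differentiable_imp_continuous_within smooth_differentiable)

lemma smooth_add:
  assumes "smooth f" "smooth g"
  shows "smooth (\<lambda>x. f x + g x)"
proof (rule smooth_coinduct[where S = "\<lambda>h. \<exists>f g. smooth f \<and> smooth g \<and> h = (\<lambda>x. f x + g x)"])
  fix h :: "real^'n \<Rightarrow> real"
  assume "\<exists>f g. smooth f \<and> smooth g \<and> h = (\<lambda>x. f x + g x)"
  then obtain f g where fg: "smooth f" "smooth g" "h = (\<lambda>x. f x + g x)" by blast
  have "\<exists>f g. smooth f \<and> smooth g \<and> (\<lambda>x. gradient h x $ i) = (\<lambda>x. f x + g x)" for i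
    by (rule exI[of _ "\<lambda>x. gradient f x $ i"], rule exI[of _ "\<lambda>x. gradient g x $ i"])
       (use fg in \<open>simp add: gradient_add smooth_differentiable smooth_partial\<close>)
  then show "(\<forall>x. h differentiable (at x)) \<and>
      (\<forall>i. \<exists>f g. smooth f \<and> smooth g \<and> (\<lambda>x. gradient h x $ i) = (\<lambda>x. f x + g x))"
    using fg by (auto simp: smooth_differentiable)
qed (use assms in blast)

lemma smooth_cmult:
  assumes "smooth f"
  shows "smooth (\<lambda>x. a * f x)"
  by (rule smooth_coinduct[where S = "\<lambda>h. \<exists>f. smooth f \<and> h = (\<lambda>x. a * f x)"])
     (use assms in \<open>auto simp: gradient_cmult smooth_differentiable intro: smooth_partial\<close>)

lemma smooth_const: "smooth (\<lambda>x. a)"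
  by (rule smooth_coinduct[where S = "\<lambda>h. \<exists>a. h = (\<lambda>x. a)"])
     (auto simp: gradient_nth frechet_derivative_const)

lemma smooth_sum:
  assumes "\<And>k. k \<in> F \<Longrightarrow> smooth (f k)"
  shows "smooth (\<lambda>x. \<Sum>k\<in>F. f k x)"
  using assms by (induction F rule: infinite_finite_induct) (auto intro: smooth_add smooth_const)

lemma iter_partial_add:
  assumes "smooth f" "smooth g"
  shows "iter_partial is (\<lambda>x. f x + g x) = (\<lambda>x. iter_partial is f x + iter_partial is g x)"
  using assms
  by (induction "is" arbitrary: f g) (auto simp: gradient_add smooth_differentiable smooth_partial)

lemma iter_partial_cmult:
  assumes "smooth f"
  shows "iter_partial is (\<lambda>x. a * f x) = (\<lambda>x. a * iter_partial is f x)"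
  using assms
  by (induction "is" arbitrary: f) (auto simp: gradient_cmult smooth_differentiable smooth_partial)

lemma iter_partial_zero: "iter_partial is (\<lambda>x. 0) = (\<lambda>x. 0)"
  by (induction "is") (auto simp: gradient_nth frechet_derivative_const)

lemma iter_partial_sum:
  assumes "\<And>k. k \<in> F \<Longrightarrow> smooth (f k)"
  shows "iter_partial is (\<lambda>x. \<Sum>k\<in>F. f k x) = (\<lambda>x. \<Sum>k\<in>F. iter_partial is (f k) x)"
  using assms
  by (induction F rule: infinite_finite_induct)
     (auto simp: iter_partial_zero iter_partial_add smooth_sum)

lemma iter_partial_append: "iter_partial (is @ js) g = iter_partial js (iter_partial is g)"
  by (induction "is" arbitrary: g) auto

text \<open>By the chain rule a partial derivative of a pullback \<open>g (B x + t)\<close> is a linear combination of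
pullbacks of partial derivatives of \<open>g\<close>; the closure under linear combinations makes the class
below stable under differentiation.\<close>
inductive affine_pullback :: "real^'n^'m \<Rightarrow> real^'m \<Rightarrow> (real^'n \<Rightarrow> real) \<Rightarrow> bool" for B t where
  base: "smooth g \<Longrightarrow> affine_pullback B t (\<lambda>x. g (B *v x + t))"
| cmult: "affine_pullback B t f \<Longrightarrow> affine_pullback B t (\<lambda>x. a * f x)"
| add: "affine_pullback B t f \<Longrightarrow> affine_pullback B t g \<Longrightarrow> affine_pullback B t (\<lambda>x. f x + g x)"

lemma affine_pullback_sum:
  assumes "\<And>k. k \<in> F \<Longrightarrow> affine_pullback B t (f k)"
  shows "affine_pullback B t (\<lambda>x. \<Sum>k\<in>F. f k x)"
  using assms
proof (induction F rule: infinite_finite_induct)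
  case (infinite A)
  then show ?case using affine_pullback.base[OF smooth_const[of 0]] by simp
next
  case empty
  then show ?case using affine_pullback.base[OF smooth_const[of 0]] by simp
next
  case (insert k F)
  then show ?case by (simp add: affine_pullback.add)
qed

lemma affine_pullback_smooth:
  fixes B :: "real^'n^'m"
  assumes "affine_pullback B t f"
  shows "smooth f"
proof (rule smooth_coinduct[where S = "affine_pullback B t"])
  fix g :: "real^'n \<Rightarrow> real" assume "affine_pullback B t g"
  then show "(\<forall>x. g differentiable (at x)) \<and> (\<forall>i. affine_pullback B t (\<lambda>x. gradient g x $ i))"
  proof induction
    case (base g)
    then have "affine_pullback B t (\<lambda>x. \<Sum>j\<in>UNIV. B$j$i * gradient g (B *v x + t) $ j)" for i
      by (intro affine_pullback_sum affine_pullback.cmult affine_pullback.base smooth_partial)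
    then show ?case
      using base by (simp add: gradient_affine smooth_differentiable)
  next
    case (cmult f a)
    then show ?case by (auto simp: gradient_cmult intro: affine_pullback.cmult)
  next
    case (add f g)
    then show ?case by (auto simp: gradient_add intro: affine_pullback.add)
  qed
qed (rule assms)

lemma smooth_affine: "smooth g \<Longrightarrow> smooth (\<lambda>x. g (B *v x + t))"
  by (rule affine_pullback_smooth[OF affine_pullback.base])

text \<open>This is the contraction estimate: composing with a map whose matrix has column sums at most \<open>\<beta>\<close>
multiplies the bound for the derivatives of order \<open>L\<close> by \<open>\<beta>\<^sup>L\<close>.\<close>
lemma iter_partial_affine_bound:
  fixes B :: "real^'n^'m"
  assumes "smooth g" and B: "\<And>i. (\<Sum>j\<in>UNIV. \<bar>B$j$i\<bar>) \<le> \<beta>" and "\<beta> \<ge> 0"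
    and "\<And>js. length js = length is \<Longrightarrow> \<bar>iter_partial js g (B *v x + t)\<bar> \<le> \<epsilon>"
  shows "\<bar>iter_partial is (\<lambda>x. g (B *v x + t)) x\<bar> \<le> \<beta> ^ length is * \<epsilon>"
  using assms(1,4)
proof (induction "is" arbitrary: g)
  case Nil
  then show ?case by simp
next
  case (Cons i "is")
  let ?g = "\<lambda>j x. gradient g x $ j"
  have sm: "smooth (?g j)" for j by (rule smooth_partial) fact
  have IH: "\<bar>iter_partial is (\<lambda>x. ?g j (B *v x + t)) x\<bar> \<le> \<beta> ^ length is * \<epsilon>" for j
  proof (rule Cons.IH[OF sm])
    fix js :: "'m list" assume "length js = length is"
    then show "\<bar>iter_partial js (?g j) (B *v x + t)\<bar> \<le> \<epsilon>"
      using Cons.prems(2)[of "j # js"] by simp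
  qed
  have sma: "smooth (\<lambda>x. ?g j (B *v x + t))" for j by (rule smooth_affine[OF sm])
  have "iter_partial (i # is) (\<lambda>x. g (B *v x + t)) x
      = iter_partial is (\<lambda>x. \<Sum>j\<in>UNIV. B$j$i * ?g j (B *v x + t)) x"
    using Cons.prems(1) by (simp add: gradient_affine smooth_differentiable)
  also have "\<dots> = (\<Sum>j\<in>UNIV. B$j$i * iter_partial is (\<lambda>x. ?g j (B *v x + t)) x)"
    by (subst iter_partial_sum) (simp_all add: iter_partial_cmult sma smooth_cmult)
  also have "\<bar>\<dots>\<bar> \<le> (\<Sum>j\<in>UNIV. \<bar>B$j$i\<bar> * (\<beta> ^ length is * \<epsilon>))"
    by (rule order_trans[OF sum_abs], intro sum_mono) (simp add: abs_mult mult_left_mono IH)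
  also have "\<dots> \<le> \<beta> * (\<beta> ^ length is * \<epsilon>)"
    unfolding sum_distrib_right[symmetric]
    by (intro mult_right_mono B order_trans[OF abs_ge_zero IH])
  finally show ?case by (simp add: mult.assoc)
qed

lemma real_polynomial_function_partial:
  fixes p :: "real^'n \<Rightarrow> real"
  assumes "real_polynomial_function p"
  shows "(\<forall>x. p differentiable (at x)) \<and> (\<forall>i. real_polynomial_function (\<lambda>x. gradient p x $ i))"
  using assms
proof induction
  case (linear f)
  then have d: "(f has_derivative f) (at x)" for x
    by (rule bounded_linear_imp_has_derivative)
  show ?case
    using d by (auto simp: differentiable_def gradient_nth_eqI[OF d] intro: real_polynomial_function.intros)
next
  case (const c)
  then show ?case by (auto simp: gradient_nth)
next
  case (add f g)
  then show ?case by (auto simp: gradient_add)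
next
  case (mult f g)
  then show ?case
    by (auto simp: gradient_mult intro!: real_polynomial_function.intros(3,4))
qed

lemma smooth_real_polynomial_function:
  fixes p :: "real^'n \<Rightarrow> real"
  shows "real_polynomial_function p \<Longrightarrow> smooth p"
  by (rule smooth_coinduct[where S = real_polynomial_function]) (auto dest: real_polynomial_function_partial)

section \<open>Symmetry of mixed partial derivatives\<close>

lemma DERIV_along_axis:
  assumes "smooth g"
  shows "((\<lambda>s. g (x + s *\<^sub>R a)) has_real_derivative gradient g (x + s *\<^sub>R a) \<bullet> a) (at s)"
proof -
  have "((\<lambda>s. x + s *\<^sub>R a) has_derivative (\<lambda>h. h *\<^sub>R a)) (at s)"
    by (auto intro!: derivative_eq_intros)
  from diff_chain_at[OF this has_derivative_gradient[OF smooth_differentiable[OF assms]]]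
  show ?thesis by (simp add: o_def has_field_derivative_def mult.commute[of _ "gradient g _ \<bullet> _"])
qed

text \<open>The second difference is symmetric in the two axes, whereas the mean value theorem, applied first
to one axis and then to the other, expresses it by one of the two mixed derivatives.\<close>
lemma second_difference_mean_value:
  fixes g :: "real^'n \<Rightarrow> real"
  assumes g: "smooth g" and h: "h > 0"
  shows "\<exists>s t. 0 < s \<and> s < h \<and> 0 < t \<and> t < h \<and>
    g (x + h *\<^sub>R axis i 1 + h *\<^sub>R axis j 1) - g (x + h *\<^sub>R axis i 1) - g (x + h *\<^sub>R axis j 1) + g x
    = h^2 * gradient (\<lambda>x. gradient g x $ i) (x + s *\<^sub>R axis i 1 + t *\<^sub>R axis j 1) $ j"
proof -
  let ?a = "axis i (1::real) :: real^'n" and ?b = "axis j (1::real) :: real^'n"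
  let ?u = "\<lambda>s. g ((x + h *\<^sub>R ?b) + s *\<^sub>R ?a) - g (x + s *\<^sub>R ?a)"
  have "(?u has_real_derivative (gradient g ((x + h *\<^sub>R ?b) + s *\<^sub>R ?a) $ i - gradient g (x + s *\<^sub>R ?a) $ i)) (at s)" for s
    using DERIV_diff[OF DERIV_along_axis[OF g, of "x + h *\<^sub>R ?b" ?a s] DERIV_along_axis[OF g, of x ?a s]]
    by (simp add: inner_axis)
  from MVT2[of 0 h ?u, OF h this] obtain s where s: "0 < s" "s < h"
    "?u h - ?u 0 = (h - 0) * (gradient g ((x + h *\<^sub>R ?b) + s *\<^sub>R ?a) $ i - gradient g (x + s *\<^sub>R ?a) $ i)"
    by blast
  let ?v = "\<lambda>t. gradient g ((x + s *\<^sub>R ?a) + t *\<^sub>R ?b) $ i"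
  have "(?v has_real_derivative gradient (\<lambda>x. gradient g x $ i) ((x + s *\<^sub>R ?a) + t *\<^sub>R ?b) $ j) (at t)" for t
    using DERIV_along_axis[OF smooth_partial[OF g, of i], of "x + s *\<^sub>R ?a" ?b t] by (simp add: inner_axis)
  from MVT2[of 0 h ?v, OF h this] obtain t where t: "0 < t" "t < h"
    "?v h - ?v 0 = (h - 0) * gradient (\<lambda>x. gradient g x $ i) ((x + s *\<^sub>R ?a) + t *\<^sub>R ?b) $ j"
    by blast
  have "g (x + h *\<^sub>R ?a + h *\<^sub>R ?b) - g (x + h *\<^sub>R ?a) - g (x + h *\<^sub>R ?b) + g x = ?u h - ?u 0"
    by (simp add: algebra_simps)
  also have "\<dots> = h * (?v h - ?v 0)"
    using s(3) by (simp add: algebra_simps)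
  also have "\<dots> = h^2 * gradient (\<lambda>x. gradient g x $ i) ((x + s *\<^sub>R ?a) + t *\<^sub>R ?b) $ j"
    using t(3) by (simp add: power2_eq_square)
  finally show ?thesis using s(1,2) t(1,2) by blast
qed

lemma partial_commute:
  fixes g :: "real^'n \<Rightarrow> real"
  assumes g: "smooth g"
  shows "gradient (\<lambda>x. gradient g x $ i) x $ j = gradient (\<lambda>x. gradient g x $ j) x $ i"
proof (rule ccontr)
  let ?G = "\<lambda>i j x. gradient (\<lambda>x. gradient g x $ i) x $ j"
  assume ne: "?G i j x \<noteq> ?G j i x"
  define \<epsilon> where "\<epsilon> = \<bar>?G i j x - ?G j i x\<bar> / 2"
  have eps: "\<epsilon> > 0" using ne by (simp add: \<epsilon>_def)
  have cont: "isCont (?G i j) x" for i j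
    using smooth_partial[OF smooth_partial[OF g]] smooth_continuous_on[of _ UNIV]
    by (auto simp: continuous_on_eq_continuous_at)
  obtain d1 where d1: "d1 > 0" "\<And>y. dist y x < d1 \<Longrightarrow> dist (?G i j y) (?G i j x) < \<epsilon>"
    using cont[of i j] eps unfolding continuous_at_eps_delta by blast
  obtain d2 where d2: "d2 > 0" "\<And>y. dist y x < d2 \<Longrightarrow> dist (?G j i y) (?G j i x) < \<epsilon>"
    using cont[of j i] eps unfolding continuous_at_eps_delta by blast
  define h where "h = min d1 d2 / 2"
  have h: "h > 0" using d1 d2 by (simp add: h_def)
  have near: "dist (x + s *\<^sub>R axis k 1 + t *\<^sub>R axis l 1) x < min d1 d2"
    if "0 < s" "s < h" "0 < t" "t < h" for s t and k l :: 'n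
  proof -
    have "norm (s *\<^sub>R axis k 1 + t *\<^sub>R axis l (1::real) :: real^'n) \<le> s + t"
      using that by (intro order_trans[OF norm_triangle_ineq]) simp
    also have "\<dots> < min d1 d2" using that by (simp add: h_def)
    finally show ?thesis by (simp add: dist_norm add.assoc)
  qed
  obtain s t where st: "0 < s" "s < h" "0 < t" "t < h"
    "g (x + h *\<^sub>R axis i 1 + h *\<^sub>R axis j 1) - g (x + h *\<^sub>R axis i 1) - g (x + h *\<^sub>R axis j 1) + g x
    = h^2 * ?G i j (x + s *\<^sub>R axis i 1 + t *\<^sub>R axis j 1)"
    using second_difference_mean_value[OF g h, of x i j] by blast
  obtain s' t' where st': "0 < s'" "s' < h" "0 < t'" "t' < h"
    "g (x + h *\<^sub>R axis j 1 + h *\<^sub>R axis i 1) - g (x + h *\<^sub>R axis j 1) - g (x + h *\<^sub>R axis i 1) + g x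
    = h^2 * ?G j i (x + s' *\<^sub>R axis j 1 + t' *\<^sub>R axis i 1)"
    using second_difference_mean_value[OF g h, of x j i] by blast
  have "h^2 * ?G i j (x + s *\<^sub>R axis i 1 + t *\<^sub>R axis j 1) = h^2 * ?G j i (x + s' *\<^sub>R axis j 1 + t' *\<^sub>R axis i 1)"
    using st(5) st'(5) by (simp add: algebra_simps)
  then have "?G i j (x + s *\<^sub>R axis i 1 + t *\<^sub>R axis j 1) = ?G j i (x + s' *\<^sub>R axis j 1 + t' *\<^sub>R axis i 1)"
    using h by simp
  moreover have "dist (?G i j (x + s *\<^sub>R axis i 1 + t *\<^sub>R axis j 1)) (?G i j x) < \<epsilon>"
    using near[OF st(1-4)] by (intro d1) auto
  moreover have "dist (?G j i (x + s' *\<^sub>R axis j 1 + t' *\<^sub>R axis i 1)) (?G j i x) < \<epsilon>"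
    using near[OF st'(1-4)] by (intro d2) auto
  ultimately have "dist (?G i j x) (?G j i x) < \<epsilon> + \<epsilon>"
    using dist_triangle3[of "?G i j x" "?G j i x" "?G i j (x + s *\<^sub>R axis i 1 + t *\<^sub>R axis j 1)"]
    by simp
  then show False by (simp add: dist_real_def \<epsilon>_def)
qed

section \<open>Taylor polynomials at the origin\<close>

text \<open>The homogeneous polynomial of degree \<open>j\<close> that sums \<open>s is\<close> times the monomial \<open>y\<^sub>i\<^sub>1 \<dots> y\<^sub>i\<^sub>j\<close> over
all lists \<open>is\<close> of length \<open>j\<close>. With the iterated partial derivatives of \<open>g\<close> at the origin as
coefficients it is \<open>j!\<close> times the \<open>j\<close>-th term of the Taylor series of \<open>g\<close>.\<close>
primrec hform :: "nat \<Rightarrow> ('n list \<Rightarrow> real) \<Rightarrow> real^'n \<Rightarrow> real" where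
  "hform 0 s y = s []"
| "hform (Suc j) s y = (\<Sum>i\<in>UNIV. y $ i * hform j (\<lambda>is. s (i # is)) y)"

lemma real_polynomial_function_hform: "real_polynomial_function (hform j s)"
proof (induction j arbitrary: s)
  case 0
  then show ?case by (auto simp: real_polynomial_function.intros(2) fun_eq_iff)
next
  case (Suc j)
  have "hform (Suc j) s = (\<lambda>y. \<Sum>i\<in>UNIV. y $ i * hform j (\<lambda>is. s (i # is)) y)" by (rule ext) simp
  moreover have "real_polynomial_function (\<lambda>y. \<Sum>i\<in>UNIV. y $ i * hform j (\<lambda>is. s (i # is)) y)"
    by (intro real_polynomial_function_sum real_polynomial_function.intros(4) real_polynomial_function.intros(1) Suc)
       (auto simp: bounded_linear_vec_nth)
  ultimately show ?case by simp
qed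

definition swap_invariant :: "('n list \<Rightarrow> real) \<Rightarrow> bool" where
  "swap_invariant s \<longleftrightarrow> (\<forall>pre i j post. s (pre @ i # j # post) = s (pre @ j # i # post))"

lemma swap_invariant_Cons: "swap_invariant s \<Longrightarrow> swap_invariant (\<lambda>is. s (i # is))"
  unfolding swap_invariant_def by (metis append_Cons)

lemma swap_invariant_iter_partial:
  "smooth g \<Longrightarrow> swap_invariant (\<lambda>is. iter_partial is g x)"
  unfolding swap_invariant_def
  by (auto simp: iter_partial_append partial_commute[OF smooth_iter_partial] ) 

text \<open>The coefficient of a list does not change if neighbours are swapped, so the \<open>Suc j\<close> positions at
which the variable \<open>y\<^sub>a\<close> can be differentiated all contribute the same form.\<close>
lemma gradient_hform:
  assumes "swap_invariant s"
  shows "gradient (hform (Suc j) s) y $ a = Suc j * hform j (\<lambda>is. s (a # is)) y"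
  using assms
proof (induction j arbitrary: s)
  case 0
  have e: "hform (Suc 0) s = (\<lambda>y. \<Sum>i\<in>UNIV. y $ i * s [i])" by (rule ext) simp
  have "((\<lambda>y::real^'a. \<Sum>i\<in>UNIV. y $ i * s [i]) has_derivative (\<lambda>h. \<Sum>i\<in>UNIV. h $ i * s [i])) (at y)"
    by (intro has_derivative_sum has_derivative_mult_left bounded_linear_imp_has_derivative bounded_linear_vec_nth)
  from gradient_nth_eqI[OF this, of a] show ?case
    unfolding e by (simp add: axis_def if_distrib[of "\<lambda>x. x * _"] cong: if_cong)
next
  case (Suc j)
  let ?s = "\<lambda>i is. s (i # is)"
  let ?h = "\<lambda>i. hform (Suc j) (?s i)"
  have dh: "(?h i has_derivative (\<lambda>h. gradient (?h i) y \<bullet> h)) (at y)" for i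
    by (intro has_derivative_gradient smooth_differentiable smooth_real_polynomial_function real_polynomial_function_hform)
  have e: "hform (Suc (Suc j)) s = (\<lambda>y. \<Sum>i\<in>UNIV. y $ i * ?h i y)" by (rule ext) simp
  have "((\<lambda>y::real^'a. \<Sum>i\<in>UNIV. y $ i * ?h i y) has_derivative
      (\<lambda>h. \<Sum>i\<in>UNIV. y $ i * (gradient (?h i) y \<bullet> h) + h $ i * ?h i y)) (at y)"
    by (intro has_derivative_sum has_derivative_mult dh bounded_linear_imp_has_derivative bounded_linear_vec_nth)
  from gradient_nth_eqI[OF this, of a]
  have "gradient (hform (Suc (Suc j)) s) y $ a
      = (\<Sum>i\<in>UNIV. y $ i * gradient (?h i) y $ a) + (\<Sum>i\<in>UNIV. axis a 1 $ i * ?h i y)"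
    unfolding e by (simp add: inner_axis sum.distrib)
  also have "(\<Sum>i\<in>UNIV. axis a 1 $ i * ?h i y) = ?h a y"
    by (simp add: axis_def if_distrib[of "\<lambda>x. x * _"] cong: if_cong)
  also have "(\<Sum>i\<in>UNIV. y $ i * gradient (?h i) y $ a)
      = (\<Sum>i\<in>UNIV. Suc j * (y $ i * hform j (\<lambda>is. s (a # i # is)) y))"
  proof (rule sum.cong)
    fix i
    have "(\<lambda>is. s (i # a # is)) = (\<lambda>is. s (a # i # is))"
      using Suc.prems unfolding swap_invariant_def by (metis append_Nil)
    then show "y $ i * gradient (?h i) y $ a = Suc j * (y $ i * hform j (\<lambda>is. s (a # i # is)) y)"
      using Suc.IH[OF swap_invariant_Cons[OF Suc.prems], of i] by (simp del: hform.simps)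
  qed simp
  also have "\<dots> = Suc j * ?h a y" by (simp add: sum_distrib_left)
  finally show ?case by (simp add: algebra_simps)
qed

definition taylor :: "nat \<Rightarrow> (real^'n \<Rightarrow> real) \<Rightarrow> real^'n \<Rightarrow> real" where
  "taylor L g y = (\<Sum>j<L. hform j (\<lambda>is. iter_partial is g 0) y / fact j)"

lemma real_polynomial_function_taylor: "real_polynomial_function (taylor L g)"
proof -
  have "taylor L g = (\<lambda>y. \<Sum>j<L. hform j (\<lambda>is. iter_partial is g 0) y / fact j)"
    by (rule ext) (simp add: taylor_def)
  then show ?thesis
    by (simp add: real_polynomial_function_sum real_polynomial_function_divide real_polynomial_function_hform)
qed

lemma taylor_at_0: "taylor (Suc L) g 0 = g 0"
proof -
  have "hform (Suc j) s 0 = 0" for j and s :: "'a list \<Rightarrow> real" by simp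
  then show ?thesis
    unfolding taylor_def by (subst sum.lessThan_Suc_shift) (simp del: hform.simps(2))
qed

text \<open>Taylor polynomials commute with partial derivatives. Therefore the remainder can be estimated by
induction on the order, with the mean value theorem as the only analytic input.\<close>
lemma gradient_taylor:
  assumes g: "smooth g"
  shows "gradient (taylor (Suc L) g) y $ a = taylor L (\<lambda>x. gradient g x $ a) y"
proof -
  let ?s = "\<lambda>is. iter_partial is g 0"
  have d: "(hform j ?s has_derivative (\<lambda>h. gradient (hform j ?s) y \<bullet> h)) (at y)" for j
    by (intro has_derivative_gradient smooth_differentiable smooth_real_polynomial_function real_polynomial_function_hform)
  have e: "taylor (Suc L) g = (\<lambda>y. \<Sum>j<Suc L. hform j ?s y / fact j)"
    by (rule ext) (simp only: taylor_def)
  have "((\<lambda>y. \<Sum>j<Suc L. hform j ?s y / fact j) has_derivative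
      (\<lambda>h. \<Sum>j<Suc L. (gradient (hform j ?s) y \<bullet> h) / fact j)) (at y)"
    by (intro has_derivative_sum d bounded_linear.has_derivative[OF bounded_linear_divide])
  from gradient_nth_eqI[OF this, of a]
  have "gradient (taylor (Suc L) g) y $ a = (\<Sum>j<Suc L. gradient (hform j ?s) y $ a / fact j)"
    unfolding e by (simp add: inner_axis)
  also have "\<dots> = (\<Sum>j<L. gradient (hform (Suc j) ?s) y $ a / fact (Suc j))"
  proof -
    have "hform 0 ?s = (\<lambda>x. g 0)" by (rule ext) simp
    then have "gradient (hform 0 ?s) y $ a = 0" by (simp add: gradient_nth)
    then show ?thesis by (subst sum.lessThan_Suc_shift) (simp del: hform.simps)
  qed
  also have "\<dots> = (\<Sum>j<L. hform j (\<lambda>is. ?s (a # is)) y / fact j)"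
  proof (rule sum.cong)
    fix j
    have "gradient (hform (Suc j) ?s) y $ a = Suc j * hform j (\<lambda>is. ?s (a # is)) y"
      by (rule gradient_hform[OF swap_invariant_iter_partial[OF g]])
    then show "gradient (hform (Suc j) ?s) y $ a / fact (Suc j) = hform j (\<lambda>is. ?s (a # is)) y / fact j"
      by (simp add: divide_simps)
  qed simp
  finally show ?thesis by (simp add: taylor_def)
qed

lemma smooth_taylor: "smooth (taylor L g)"
  by (rule smooth_real_polynomial_function[OF real_polynomial_function_taylor])

lemma smooth_diff: "smooth f \<Longrightarrow> smooth g \<Longrightarrow> smooth (\<lambda>x. f x - g x)"
  using smooth_add[of f "\<lambda>x. (-1) * g x"] smooth_cmult[of g "-1"] by simp

lemma gradient_diff:
  assumes "f differentiable (at x)" "g differentiable (at x)"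
  shows "gradient (\<lambda>x. f x - g x) x = gradient f x - gradient g x"
  using gradient_nth_eqI[OF has_derivative_diff[OF assms[THEN has_derivative_gradient]]]
  by (simp add: vec_eq_iff inner_axis)

lemma iter_partial_diff_taylor:
  assumes "smooth g" "length is \<le> L"
  shows "iter_partial is (\<lambda>x. g x - taylor L g x)
       = (\<lambda>x. iter_partial is g x - taylor (L - length is) (iter_partial is g) x)"
  using assms
proof (induction "is" arbitrary: g L)
  case Nil
  then show ?case by simp
next
  case (Cons i "is")
  then obtain L' where L: "L = Suc L'" by (cases L) auto
  have "iter_partial (i # is) (\<lambda>x. g x - taylor L g x)
     = iter_partial is (\<lambda>x. gradient g x $ i - taylor L' (\<lambda>x. gradient g x $ i) x)"
    using Cons.prems(1)
    by (simp add: L gradient_diff gradient_taylor smooth_differentiable smooth_taylor)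
  also have "\<dots> = (\<lambda>x. iter_partial (i # is) g x - taylor (L - length (i # is)) (iter_partial (i # is) g) x)"
    using Cons by (simp add: L smooth_partial)
  finally show ?case .
qed

lemma taylor_remainder_bound:
  fixes g :: "real^'n \<Rightarrow> real" and R \<epsilon> :: real
  assumes "smooth g" and R: "R \<ge> 0"
    and "\<And>is x. length is = L \<Longrightarrow> norm x \<le> R \<Longrightarrow> \<bar>iter_partial is g x\<bar> \<le> \<epsilon>"
    and "norm x \<le> R"
  shows "\<bar>g x - taylor L g x\<bar> \<le> (CARD('n) * R) ^ L * \<epsilon>"
  using assms(1,3,4)
proof (induction L arbitrary: g x)
  case 0
  then show ?case using "0.prems"(2)[of "[]" x] by (simp add: taylor_def)
next
  case (Suc L)
  let ?r = "\<lambda>x. g x - taylor (Suc L) g x"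
  have sm: "smooth ?r" by (rule smooth_diff[OF Suc.prems(1) smooth_taylor])
  have part: "\<bar>gradient ?r y $ a\<bar> \<le> (CARD('n) * R) ^ L * \<epsilon>" if "norm y \<le> R" for y a
  proof -
    have "gradient ?r y $ a = gradient g y $ a - taylor L (\<lambda>x. gradient g x $ a) y"
      using Suc.prems(1) by (simp add: gradient_diff gradient_taylor smooth_differentiable smooth_taylor)
    also have "\<bar>\<dots>\<bar> \<le> (CARD('n) * R) ^ L * \<epsilon>"
    proof (rule Suc.IH[OF smooth_partial[OF Suc.prems(1)] _ that])
      fix "is" :: "'n list" and x :: "real^'n" assume "length is = L" "norm x \<le> R"
      then show "\<bar>iter_partial is (\<lambda>x. gradient g x $ a) x\<bar> \<le> \<epsilon>"
        using Suc.prems(2)[of "a # is" x] by simp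
    qed
    finally show ?thesis .
  qed
  have "((\<lambda>s. ?r (0 + s *\<^sub>R x)) has_real_derivative gradient ?r (0 + s *\<^sub>R x) \<bullet> x) (at s)" for s
    by (rule DERIV_along_axis[OF sm])
  from MVT2[of 0 1 "\<lambda>s. ?r (0 + s *\<^sub>R x)", OF _ this] obtain s where s: "0 < s" "s < 1"
    "?r (0 + 1 *\<^sub>R x) - ?r (0 + 0 *\<^sub>R x) = (1 - 0) * (gradient ?r (0 + s *\<^sub>R x) \<bullet> x)"
    by auto
  have nsx: "norm (s *\<^sub>R x) \<le> R"
    using s Suc.prems(3) R by (simp add: mult_le_one) (metis mult_left_le_one_le norm_ge_zero order_trans less_eq_real_def)
  have "\<bar>?r x\<bar> = \<bar>gradient ?r (s *\<^sub>R x) \<bullet> x\<bar>"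
    using s(3) by (simp add: taylor_at_0)
  also have "\<dots> \<le> (\<Sum>i\<in>UNIV. \<bar>gradient ?r (s *\<^sub>R x) $ i\<bar> * \<bar>x $ i\<bar>)"
    unfolding inner_vec_def by (rule order_trans[OF sum_abs]) (simp add: abs_mult)
  also have "\<dots> \<le> (\<Sum>i\<in>(UNIV::'n set). ((CARD('n) * R) ^ L * \<epsilon>) * R)"
    using component_le_norm_cart[of x] Suc.prems(3)
    by (intro sum_mono mult_mono part nsx order_trans[OF abs_ge_zero part[OF nsx]]) (auto intro: order_trans)
  also have "\<dots> = (CARD('n) * R) ^ Suc L * \<epsilon>" by (simp add: algebra_simps)
  finally show ?case .
qed

lemma iter_partial_taylor_remainder_bound:
  fixes g :: "real^'n \<Rightarrow> real" and R \<epsilon> :: real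
  assumes g: "smooth g" and R: "R \<ge> 1" and l: "length is \<le> L"
    and b: "\<And>is x. length is = L \<Longrightarrow> norm x \<le> R \<Longrightarrow> \<bar>iter_partial is g x\<bar> \<le> \<epsilon>"
    and x: "norm x \<le> R"
  shows "\<bar>iter_partial is (\<lambda>x. g x - taylor L g x) x\<bar> \<le> (CARD('n) * R) ^ L * \<epsilon>"
proof -
  have eps: "\<epsilon> \<ge> 0" using b[of "replicate L undefined" x] x by fastforce
  have "\<bar>iter_partial is g x - taylor (L - length is) (iter_partial is g) x\<bar>
      \<le> (CARD('n) * R) ^ (L - length is) * \<epsilon>"
  proof (rule taylor_remainder_bound[OF smooth_iter_partial[OF g] _ _ x])
    fix js :: "'n list" and y :: "real^'n" assume "length js = L - length is" "norm y \<le> R"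
    then show "\<bar>iter_partial js (iter_partial is g) y\<bar> \<le> \<epsilon>"
      using b[of "is @ js" y] l by (simp add: iter_partial_append)
  qed (use R in auto)
  also have "\<dots> \<le> (CARD('n) * R) ^ L * \<epsilon>"
  proof (intro mult_right_mono power_increasing eps)
    have "1 \<le> real CARD('n)" by (simp add: Suc_le_eq)
    then show "1 \<le> CARD('n) * R" using R by (metis mult_mono mult_1 zero_le_one order_trans)
  qed auto
  finally show ?thesis using iter_partial_diff_taylor[OF g l] by simp
qed

section \<open>Functionals on smooth functions\<close>
lemma smooth_sum_list:
  "(\<And>k. k \<in> set ks \<Longrightarrow> smooth (f k)) \<Longrightarrow> smooth (\<lambda>x. \<Sum>k\<leftarrow>ks. f k x)"
  by (induction ks) (auto intro: smooth_add smooth_const)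

lemma iter_partial_sum_list:
  "(\<And>k. k \<in> set ks \<Longrightarrow> smooth (f k)) \<Longrightarrow>
    iter_partial is (\<lambda>x. \<Sum>k\<leftarrow>ks. f k x) = (\<lambda>x. \<Sum>k\<leftarrow>ks. iter_partial is (f k) x)"
  by (induction ks) (auto simp: iter_partial_zero iter_partial_add smooth_sum_list)

text \<open>The algebraic part of being a compactly supported distribution.\<close>
definition smooth_linear :: "((real^'n \<Rightarrow> real) \<Rightarrow> real) \<Rightarrow> bool" where
  "smooth_linear d \<longleftrightarrow>
    (\<forall>g h. smooth g \<and> smooth h \<longrightarrow> d (\<lambda>x. g x + h x) = d g + d h) \<and>
    (\<forall>a g. smooth g \<longrightarrow> d (\<lambda>x. a * g x) = a * d g)"

lemma smooth_linearD:
  assumes "smooth_linear d"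
  shows "\<And>g h. smooth g \<Longrightarrow> smooth h \<Longrightarrow> d (\<lambda>x. g x + h x) = d g + d h"
    and "\<And>a g. smooth g \<Longrightarrow> d (\<lambda>x. a * g x) = a * d g"
  using assms by (auto simp: smooth_linear_def)

lemma smooth_linear_zero: "smooth_linear d \<Longrightarrow> d (\<lambda>x. 0) = 0"
  using smooth_linearD(2)[of d "\<lambda>x. 0" 0] smooth_const by auto

lemma smooth_linear_sum_list:
  assumes "smooth_linear d" "\<And>k. k \<in> set ks \<Longrightarrow> smooth (f k)"
  shows "d (\<lambda>x. \<Sum>k\<leftarrow>ks. f k x) = (\<Sum>k\<leftarrow>ks. d (f k))"
  using assms(2)
  by (induction ks) (auto simp: smooth_linear_zero[OF assms(1)] smooth_linearD(1)[OF assms(1)] smooth_sum_list)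

lemma smooth_linear_sum:
  assumes "smooth_linear d" "\<And>k. k \<in> F \<Longrightarrow> smooth (f k)"
  shows "d (\<lambda>x. \<Sum>k\<in>F. f k x) = (\<Sum>k\<in>F. d (f k))"
  using assms(2)
  by (induction F rule: infinite_finite_induct)
     (auto simp: smooth_linear_zero[OF assms(1)] smooth_linearD(1)[OF assms(1)] smooth_sum)

lemma smooth_linear_diff:
  assumes "smooth_linear d" "smooth g" "smooth h"
  shows "d (\<lambda>x. g x - h x) = d g - d h"
  using smooth_linearD(1)[OF assms(1,2) smooth_cmult[OF assms(3), of "-1"]]
    smooth_linearD(2)[OF assms(1,3), of "-1"] by simp

section \<open>Polynomials as sums of products of linear forms\<close>

primrec lprod :: "(real^'n) list \<Rightarrow> real^'n \<Rightarrow> real" where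
  "lprod [] x = 1"
| "lprod (w # ws) x = (w \<bullet> x) * lprod ws x"

lemma real_polynomial_function_lprod: "real_polynomial_function (lprod ws)"
proof (induction ws)
  case Nil
  have "lprod [] = (\<lambda>x. 1)" by (rule ext) simp
  then show ?case by (simp add: real_polynomial_function.intros(2))
next
  case (Cons w ws)
  have "lprod (w # ws) = (\<lambda>x. (w \<bullet> x) * lprod ws x)" by (rule ext) simp
  then show ?case
    by (simp add: Cons real_polynomial_function.intros(1,4) bounded_linear_inner_right)
qed

lemma smooth_lprod: "smooth (lprod ws)"
  by (rule smooth_real_polynomial_function[OF real_polynomial_function_lprod])

lemma lprod_append: "lprod (us @ vs) x = lprod us x * lprod vs x"
  by (induction us) auto

lemma real_polynomial_function_lprod_sum:
  fixes p :: "real^'n \<Rightarrow> real"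
  assumes "real_polynomial_function p"
  shows "\<exists>ps. \<forall>x. p x = (\<Sum>(a, ws)\<leftarrow>ps. a * lprod ws x)"
  using assms
proof induction
  case (linear f)
  then have d: "(f has_derivative f) (at x)" for x by (rule bounded_linear_imp_has_derivative)
  have f: "f = frechet_derivative f (at 0)" by (rule frechet_derivative_at[OF d])
  have "f differentiable (at 0)" using d by (auto simp: differentiable_def)
  then have "f x = gradient f 0 \<bullet> x" for x
    using frechet_derivative_eq_gradient[of f 0 x] f by simp
  then show ?case by (intro exI[of _ "[(1, [gradient f 0])]"]) simp
next
  case (const c)
  show ?case by (intro exI[of _ "[(c, [])]"]) simp
next
  case (add f g)
  then obtain ps qs where "\<forall>x. f x = (\<Sum>(a, ws)\<leftarrow>ps. a * lprod ws x)" "\<forall>x. g x = (\<Sum>(a, ws)\<leftarrow>qs. a * lprod ws x)"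
    by blast
  then show ?case by (intro exI[of _ "ps @ qs"]) simp
next
  case (mult f g)
  then obtain ps qs where f: "\<forall>x. f x = (\<Sum>(a, ws)\<leftarrow>ps. a * lprod ws x)"
    and g: "\<forall>x. g x = (\<Sum>(a, ws)\<leftarrow>qs. a * lprod ws x)"
    by blast
  have 1: "(\<Sum>(c, us)\<leftarrow>map (\<lambda>(b, vs). (a * b, ws @ vs)) qs. c * lprod us x)
       = (a * lprod ws x) * (\<Sum>(b, vs)\<leftarrow>qs. b * lprod vs x)" for a ws x
    by (induction qs) (auto simp: lprod_append algebra_simps)
  have "(\<Sum>(c, us)\<leftarrow>concat (map (\<lambda>(a, ws). map (\<lambda>(b, vs). (a * b, ws @ vs)) qs) ps). c * lprod us x)
       = (\<Sum>(a, ws)\<leftarrow>ps. a * lprod ws x) * (\<Sum>(b, vs)\<leftarrow>qs. b * lprod vs x)" for x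
    by (induction ps) (auto simp: 1 distrib_right simp del: map_map)
  then show ?case
    using f g by (intro exI[of _ "concat (map (\<lambda>(a, ws). map (\<lambda>(b, vs). (a * b, ws @ vs)) qs) ps)"]) simp
qed

text \<open>Expanding a product of affine forms: the leading term is the product of the linear parts, all
other terms are products of fewer forms and hence are covered by induction on the degree.\<close>
lemma lprod_affine_expand:
  fixes T :: "real^'n \<Rightarrow> real^'n" and \<beta> :: "real^'n \<Rightarrow> real"
  shows "\<exists>qs. (\<forall>(a, vs) \<in> set qs. length vs < length ws) \<and>
    (\<forall>y. (\<Prod>w\<leftarrow>ws. T w \<bullet> y + \<beta> w) = lprod (map T ws) y + (\<Sum>(a, vs)\<leftarrow>qs. a * lprod vs y))"
proof (induction ws)
  case Nil
  show ?case by (intro exI[of _ "[]"]) simp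
next
  case (Cons w ws)
  then obtain qs where qs: "\<forall>(a, vs) \<in> set qs. length vs < length ws"
    "\<And>y. (\<Prod>w\<leftarrow>ws. T w \<bullet> y + \<beta> w) = lprod (map T ws) y + (\<Sum>(a, vs)\<leftarrow>qs. a * lprod vs y)"
    by blast
  have 1: "(\<Sum>(a, vs)\<leftarrow>map (\<lambda>(a, vs). (\<beta> w * a, vs)) qs. a * lprod vs y) = \<beta> w * (\<Sum>(a, vs)\<leftarrow>qs. a * lprod vs y)" for y
    by (induction qs) (auto simp: algebra_simps)
  have 2: "(\<Sum>(a, vs)\<leftarrow>map (\<lambda>(a, vs). (a, T w # vs)) qs. a * lprod vs y) = (T w \<bullet> y) * (\<Sum>(a, vs)\<leftarrow>qs. a * lprod vs y)" for y
    by (induction qs) (auto simp: algebra_simps)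
  let ?qs = "(\<beta> w, map T ws) # map (\<lambda>(a, vs). (\<beta> w * a, vs)) qs @ map (\<lambda>(a, vs). (a, T w # vs)) qs"
  have "(\<Prod>w\<leftarrow>w # ws. T w \<bullet> y + \<beta> w) = lprod (map T (w # ws)) y + (\<Sum>(a, vs)\<leftarrow>?qs. a * lprod vs y)" for y
  proof -
    have "(\<Prod>w\<leftarrow>w # ws. T w \<bullet> y + \<beta> w)
        = (T w \<bullet> y + \<beta> w) * (lprod (map T ws) y + (\<Sum>(a, vs)\<leftarrow>qs. a * lprod vs y))"
      by (simp add: qs(2))
    also have "\<dots> = lprod (map T (w # ws)) y + (\<Sum>(a, vs)\<leftarrow>?qs. a * lprod vs y)"
      by (simp add: 1 2 distrib_left distrib_right del: map_map)
    finally show ?thesis .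
  qed
  moreover have "\<forall>(a, vs) \<in> set ?qs. length vs < length (w # ws)"
    using qs(1) by (auto simp: less_Suc_eq)
  ultimately show ?case by blast
qed

lemma lprod_scaled_tendsto:
  fixes X :: "nat \<Rightarrow> real^'n \<Rightarrow> real^'n"
  assumes d: "smooth_linear d" and X: "\<And>w. (\<lambda>n. X n w) \<longlonglongrightarrow> 0"
  shows "(\<lambda>n. d (lprod (us @ map (X n) ws))) \<longlonglongrightarrow> (if ws = [] then d (lprod us) else 0)"
proof (induction ws arbitrary: us)
  case Nil
  then show ?case by simp
next
  case (Cons w ws)
  have "d (lprod (us @ map (X n) (w # ws)))
      = (\<Sum>i\<in>UNIV. X n w $ i * d (lprod ((us @ [axis i 1]) @ map (X n) ws)))" for n
  proof -
    have "lprod (us @ map (X n) (w # ws))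
        = (\<lambda>x. \<Sum>i\<in>UNIV. X n w $ i * lprod ((us @ [axis i 1]) @ map (X n) ws) x)"
      by (rule ext) (simp add: lprod_append inner_vec_def[of "X n w"] inner_axis' sum_distrib_left
          sum_distrib_right algebra_simps)
    then show ?thesis
      by (simp only: smooth_linear_sum[OF d] smooth_cmult smooth_lprod smooth_linearD(2)[OF d])
  qed
  moreover have "(\<lambda>n. \<Sum>i\<in>UNIV. X n w $ i * d (lprod ((us @ [axis i 1]) @ map (X n) ws)))
      \<longlonglongrightarrow> (\<Sum>i\<in>(UNIV::'n set). 0 $ i * (if ws = [] then d (lprod (us @ [axis i 1])) else 0))"
    by (intro tendsto_sum tendsto_mult tendsto_vec_nth X Cons)
  ultimately show ?case by simp
qed

section \<open>Uniqueness of compactly supported solutions of refinement equations\<close>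

text \<open>The transposed matrix is iterated below, so it is kept as a matrix that acts from the left.\<close>
declare transpose_matrix_vector [simp del]

lemma transpose_power_inner:
  fixes B :: "real^'n^'n"
  shows "(((*v) (transpose B)) ^^ n) w \<bullet> x = w \<bullet> (((*v) B) ^^ n) x"
  by (induction n arbitrary: x w) (simp_all add: transpose_matrix_vector dot_lmul_matrix funpow_swap1)

lemma transpose_power_tendsto_0:
  fixes B :: "real^'n^'n"
  assumes "\<And>x. (\<lambda>n. (((*v) B) ^^ n) x) \<longlonglongrightarrow> 0"
  shows "(\<lambda>n. (((*v) (transpose B)) ^^ n) w) \<longlonglongrightarrow> 0"
proof (rule vec_tendstoI)
  fix i
  have "(\<lambda>n. w \<bullet> (((*v) B) ^^ n) (axis i 1)) \<longlonglongrightarrow> w \<bullet> 0"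
    by (intro tendsto_inner tendsto_const assms)
  then show "(\<lambda>n. (((*v) (transpose B)) ^^ n) w $ i) \<longlonglongrightarrow> 0 $ i"
    by (simp add: transpose_power_inner[symmetric] inner_axis)
qed

text \<open>By induction on the degree the lower order terms of the refinement equation vanish, so the moment
of \<open>ws\<close> equals the moment of the transformed forms \<open>B\<^sup>T ws\<close>, and then of \<open>(B\<^sup>T)\<^sup>n ws\<close> for all
\<open>n\<close>. A moment is multilinear in the forms, and the forms tend to zero.\<close>
lemma refinement_moments_zero:
  fixes B :: "real^'n^'n"
  assumes d: "smooth_linear d"
    and ref: "\<And>g. smooth g \<Longrightarrow> d g = (\<Sum>(a, t)\<leftarrow>ps. a * d (\<lambda>y. g (B *v y + t)))"
    and one: "(\<Sum>(a, t)\<leftarrow>ps. a) = 1"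
    and B: "\<And>x. (\<lambda>n. (((*v) B) ^^ n) x) \<longlonglongrightarrow> 0"
    and d1: "d (\<lambda>_. 1) = 0"
  shows "d (lprod ws) = 0"
proof (induction "length ws" arbitrary: ws rule: less_induct)
  case less
  show ?case
  proof (cases "ws = []")
    case True
    have "lprod [] = (\<lambda>x::real^'n. 1)" by (rule ext) simp
    then show ?thesis using True d1 by simp
  next
    case False
    let ?T = "(*v) (transpose B)"
    have step: "d (lprod vs) = d (lprod (map ?T vs))" if len: "length vs = length ws" for vs
    proof -
      have aff: "d (\<lambda>y. lprod vs (B *v y + t)) = d (lprod (map ?T vs))" for t
      proof -
        obtain qs where qs: "\<And>a us. (a, us) \<in> set qs \<Longrightarrow> length us < length vs"
          "\<And>y. (\<Prod>w\<leftarrow>vs. ?T w \<bullet> y + w \<bullet> t) = lprod (map ?T vs) y + (\<Sum>(a, us)\<leftarrow>qs. a * lprod us y)"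
          using lprod_affine_expand[of vs ?T "\<lambda>w. w \<bullet> t"] by blast
        have "lprod vs (B *v y + t) = (\<Prod>w\<leftarrow>vs. ?T w \<bullet> y + w \<bullet> t)" for y
          by (induction vs) (auto simp: inner_add_right transpose_matrix_vector dot_lmul_matrix)
        then have "(\<lambda>y. lprod vs (B *v y + t)) = (\<lambda>y. lprod (map ?T vs) y + (\<Sum>(a, us)\<leftarrow>qs. a * lprod us y))"
          by (simp only: qs(2))
        then have "d (\<lambda>y. lprod vs (B *v y + t)) = d (\<lambda>y. lprod (map ?T vs) y + (\<Sum>(a, us)\<leftarrow>qs. a * lprod us y))"
          by (rule arg_cong)
        also have "\<dots> = d (lprod (map ?T vs)) + d (\<lambda>y. \<Sum>q\<leftarrow>qs. fst q * lprod (snd q) y)"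
          by (subst smooth_linearD(1)[OF d])
             (auto simp: case_prod_unfold intro!: smooth_lprod smooth_sum_list smooth_cmult)
        also have "d (\<lambda>y. \<Sum>q\<leftarrow>qs. fst q * lprod (snd q) y) = (\<Sum>q\<leftarrow>qs. fst q * d (lprod (snd q)))"
          by (subst smooth_linear_sum_list[OF d]) (auto simp: smooth_linearD(2)[OF d] smooth_lprod smooth_cmult)
        also have "\<dots> = (\<Sum>q\<leftarrow>qs. 0)"
          by (intro arg_cong[where f = sum_list] map_cong refl) (use qs(1) len less in force)
        finally show ?thesis by (simp del: transpose_matrix_vector)
      qed
      have "d (lprod vs) = (\<Sum>(a, t)\<leftarrow>ps. a * d (lprod (map ?T vs)))"
        using ref[OF smooth_lprod, of vs] aff by simp
      also have "\<dots> = (\<Sum>(a, t)\<leftarrow>ps. a) * d (lprod (map ?T vs))"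
        by (induction ps) (auto simp: distrib_right)
      finally show ?thesis by (simp add: one)
    qed
    have "d (lprod ws) = d (lprod (map (?T ^^ n) ws))" for n
      by (induction n) (use step[of "map (?T ^^ _) ws"] in \<open>simp_all add: o_def\<close>)
    moreover have "(\<lambda>n. d (lprod ([] @ map (?T ^^ n) ws))) \<longlonglongrightarrow> (if ws = [] then d (lprod []) else 0)"
      by (rule lprod_scaled_tendsto[OF d]) (rule transpose_power_tendsto_0[OF B])
    ultimately have "(\<lambda>n. d (lprod ws)) \<longlonglongrightarrow> 0" using False by simp
    then show ?thesis by (simp add: LIMSEQ_const_iff)
  qed
qed

lemma refinement_polynomials_zero:
  fixes B :: "real^'n^'n"
  assumes d: "smooth_linear d"
    and ref: "\<And>g. smooth g \<Longrightarrow> d g = (\<Sum>(a, t)\<leftarrow>ps. a * d (\<lambda>y. g (B *v y + t)))"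
    and one: "(\<Sum>(a, t)\<leftarrow>ps. a) = 1"
    and B: "\<And>x. (\<lambda>n. (((*v) B) ^^ n) x) \<longlonglongrightarrow> 0"
    and d1: "d (\<lambda>_. 1) = 0"
    and p: "real_polynomial_function p"
  shows "d p = 0"
proof -
  obtain qs where qs: "\<forall>x. p x = (\<Sum>(a, ws)\<leftarrow>qs. a * lprod ws x)"
    using real_polynomial_function_lprod_sum[OF p] by blast
  then have "d p = d (\<lambda>x. \<Sum>q\<leftarrow>qs. fst q * lprod (snd q) x)"
    by (intro arg_cong[where f = d]) (auto simp: case_prod_unfold)
  also have "\<dots> = (\<Sum>q\<leftarrow>qs. fst q * d (lprod (snd q)))"
    by (subst smooth_linear_sum_list[OF d]) (auto simp: smooth_linearD(2)[OF d] smooth_lprod smooth_cmult)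
  finally show ?thesis by (simp add: refinement_moments_zero[OF d ref one B d1])
qed

text \<open>Iterating the equation replaces \<open>B\<close> by a power, which is used to make \<open>B\<close> a strong contraction.\<close>
lemma refinement_iterate:
  fixes B :: "real^'n^'n" and d :: "(real^'n \<Rightarrow> real) \<Rightarrow> real"
  assumes ref: "\<And>g. smooth g \<Longrightarrow> d g = (\<Sum>(a, t)\<leftarrow>ps. a * d (\<lambda>y. g (B *v y + t)))"
  shows "\<exists>B' ps'. (\<forall>x. B' *v x = (((*v) B) ^^ n) x) \<and>
    (\<forall>g. smooth g \<longrightarrow> d g = (\<Sum>(a, t)\<leftarrow>ps'. a * d (\<lambda>y. g (B' *v y + t))))"
proof (induction n)
  case 0
  show ?case by (rule exI[of _ "mat 1"], rule exI[of _ "[(1, 0)]"]) simp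
next
  case (Suc n)
  then obtain B' ps' where B': "\<And>x. B' *v x = (((*v) B) ^^ n) x"
    and ref': "\<And>g. smooth g \<Longrightarrow> d g = (\<Sum>(a, t)\<leftarrow>ps'. a * d (\<lambda>y. g (B' *v y + t)))"
    by blast
  let ?ps = "concat (map (\<lambda>(a, t). map (\<lambda>(b, s). (a * b, B' *v s + t)) ps) ps')"
  have "d g = (\<Sum>(a, t)\<leftarrow>?ps. a * d (\<lambda>y. g ((B' ** B) *v y + t)))" if g: "smooth g" for g
  proof -
    have 1: "(\<Sum>(a, t)\<leftarrow>map (\<lambda>(b, s). (a * b, B' *v s + t)) ps. a * d (\<lambda>y. g ((B' ** B) *v y + t)))
        = a * d (\<lambda>y. g (B' *v y + t))" for a t
    proof -
      have "d (\<lambda>y. g (B' *v y + t)) = (\<Sum>(b, s)\<leftarrow>ps. b * d (\<lambda>y. g (B' *v (B *v y + s) + t)))"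
        by (rule ref[OF smooth_affine[OF g]])
      also have "a * \<dots> = (\<Sum>(a, t)\<leftarrow>map (\<lambda>(b, s). (a * b, B' *v s + t)) ps. a * d (\<lambda>y. g ((B' ** B) *v y + t)))"
        by (induction ps)
           (auto simp: algebra_simps matrix_vector_mul_assoc matrix_vector_right_distrib)
      finally show ?thesis by simp
    qed
    have "(\<Sum>(a, t)\<leftarrow>?ps. a * d (\<lambda>y. g ((B' ** B) *v y + t))) = (\<Sum>(a, t)\<leftarrow>ps'. a * d (\<lambda>y. g (B' *v y + t)))"
      by (induction ps') (auto simp: 1 simp del: map_map)
    then show ?thesis using ref'[OF g] by simp
  qed
  moreover have "(B' ** B) *v x = (((*v) B) ^^ Suc n) x" for x
    by (simp add: B' matrix_vector_mul_assoc[symmetric] funpow_swap1)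
  ultimately show ?case by blast
qed

lemma compact_distribution_smooth_linear: "compact_distribution d \<Longrightarrow> smooth_linear d"
  by (simp add: compact_distribution_def smooth_linear_def)

lemma smooth_bounded_partials:
  fixes g :: "real^'n \<Rightarrow> real"
  assumes "smooth g"
  shows "\<exists>E. \<forall>is x. length is = L \<and> norm x \<le> R \<longrightarrow> \<bar>iter_partial is g x\<bar> \<le> E"
proof -
  let ?I = "{is :: 'n list. length is = L}"
  have fin: "finite ?I" using finite_lists_length_eq[of "UNIV :: 'n set" L] by simp
  have "\<exists>e. \<forall>x\<in>cball 0 R. \<bar>iter_partial is g x\<bar> \<le> e" for "is"
    using compact_imp_bounded[OF compact_continuous_image[OF smooth_continuous_on[OF smooth_iter_partial[OF assms], of _ "is"] compact_cball]]
    by (force simp: bounded_iff)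
  then obtain e where e: "\<And>is x. x \<in> cball 0 R \<Longrightarrow> \<bar>iter_partial is g x\<bar> \<le> e is" by metis
  have "\<bar>iter_partial is g x\<bar> \<le> Max (e ` ?I)" if "length is = L" "norm x \<le> R" for "is" x
    using e[of x "is"] that fin by (intro order_trans[OF e Max_ge]) auto
  then show ?thesis by blast
qed

text \<open>Let \<open>T\<close> denote the operator on test functions in the refinement equation, so that
\<open>d (T g) = d g\<close>. One application of \<open>T\<close> multiplies the derivatives of order \<open>L\<close> by at most
\<open>\<Gamma> / 2\<^sup>L\<close>, where \<open>\<Gamma>\<close> is the sum of the absolute values of the coefficients. If \<open>L\<close> is so large that this factor is at most
\<open>1/2\<close> and that \<open>L\<close> is at least the order of \<open>d\<close>, then the Taylor remainder of order \<open>L\<close> of \<open>T\<^sup>q g\<close>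
tends to zero in the seminorm of \<open>d\<close>, while \<open>d\<close> kills the Taylor polynomials.\<close>
lemma compact_distribution_eq_0_if_contractive:
  fixes B :: "real^'n^'n"
  assumes dist: "compact_distribution d"
    and ref: "\<And>g. smooth g \<Longrightarrow> d g = (\<Sum>(a, t)\<leftarrow>ps. a * d (\<lambda>y. g (B *v y + t)))"
    and poly: "\<And>p. real_polynomial_function p \<Longrightarrow> d p = 0"
    and B: "(\<Sum>i\<in>UNIV. \<Sum>j\<in>UNIV. \<bar>B$j$i\<bar>) \<le> 1/2"
    and g: "smooth g"
  shows "d g = 0"
proof -
  have lin: "smooth_linear d" using dist by (rule compact_distribution_smooth_linear)
  from dist[unfolded compact_distribution_def, THEN conjunct2, THEN conjunct2]
  obtain K C N where K: "compact K" and bd': "\<forall>g b. smooth g \<and>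
      (\<forall>is x. length is \<le> N \<and> x \<in> K \<longrightarrow> \<bar>iter_partial is g x\<bar> \<le> b) \<longrightarrow> \<bar>d g\<bar> \<le> C * b"
    by (elim exE conjE) (rule that)
  have bd: "\<bar>d g\<bar> \<le> C * b" if "smooth g"
    "\<And>is x. length is \<le> N \<Longrightarrow> x \<in> K \<Longrightarrow> \<bar>iter_partial is g x\<bar> \<le> b" for g b
    by (rule bd'[rule_format]) (use that in simp)
  have col: "(\<Sum>j\<in>UNIV. \<bar>B$j$i\<bar>) \<le> 1/2" for i
    using member_le_sum[of i UNIV "\<lambda>i. \<Sum>j\<in>UNIV. \<bar>B$j$i\<bar>"] B by (simp add: sum_nonneg)
  have nB: "norm (B *v x) \<le> norm x / 2" for x
  proof -
    have "norm (B *v x) \<le> (\<Sum>j\<in>UNIV. \<bar>(B *v x) $ j\<bar>)" by (rule norm_le_l1_cart)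
    also have "\<dots> \<le> (\<Sum>j\<in>UNIV. \<Sum>i\<in>UNIV. \<bar>B$j$i\<bar> * norm x)"
      unfolding matrix_vector_mult_def vec_lambda_beta
      by (intro sum_mono order_trans[OF sum_abs]) (simp add: abs_mult component_le_norm_cart mult_left_mono)
    also have "\<dots> = (\<Sum>i\<in>UNIV. \<Sum>j\<in>UNIV. \<bar>B$j$i\<bar>) * norm x"
      by (subst sum.swap) (simp add: sum_distrib_right)
    also have "\<dots> \<le> 1/2 * norm x" by (intro mult_right_mono B) auto
    finally show ?thesis by simp
  qed
  define \<Gamma> where "\<Gamma> = (\<Sum>(a, t)\<leftarrow>ps. \<bar>a\<bar>)"
  obtain L where L: "N \<le> L" "\<Gamma> * (1/2)^L \<le> 1/2"
  proof -
    have "(\<lambda>L. \<Gamma> * (1/2)^L) \<longlonglongrightarrow> \<Gamma> * 0"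
      by (intro tendsto_mult tendsto_const LIMSEQ_power_zero) simp
    then have "eventually (\<lambda>L. \<Gamma> * (1/2)^L < 1/2) sequentially"
      by (rule order_tendstoD) simp
    then have "eventually (\<lambda>L. N \<le> L \<and> \<Gamma> * (1/2)^L < 1/2) sequentially"
      using eventually_ge_at_top by (rule eventually_conj[rotated])
    then obtain L where "N \<le> L \<and> \<Gamma> * (1/2)^L < 1/2"
      using eventually_happens'[OF sequentially_bot] by blast
    then show ?thesis using that[of L] by simp
  qed
  \<comment> \<open>a ball that contains the support and is mapped into itself by all maps \<open>B y + t\<close>\<close>
  obtain R where R: "R \<ge> 1" "K \<subseteq> cball 0 R" "\<And>a t. (a, t) \<in> set ps \<Longrightarrow> 2 * norm t \<le> R"
  proof -
    obtain r where r: "\<And>x. x \<in> K \<Longrightarrow> norm x \<le> r" using compact_imp_bounded[OF K] by (auto simp: bounded_iff)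
    let ?R = "1 + \<bar>r\<bar> + (\<Sum>(a, t)\<leftarrow>ps. 2 * norm t)"
    have "2 * norm t \<le> (\<Sum>(a, t)\<leftarrow>ps. 2 * norm t)" if "(a, t) \<in> set ps" for a t
      using that by (intro member_le_sum_list) (auto intro: rev_image_eqI)
    moreover have nn: "(\<Sum>(a, t)\<leftarrow>ps. 2 * norm t) \<ge> 0" by (rule sum_list_nonneg) auto
    ultimately have t: "2 * norm t \<le> ?R" if "(a, t) \<in> set ps" for a t
      using that nn by (metis add_increasing abs_ge_zero zero_le_one)
    have "norm x \<le> ?R" if "x \<in> K" for x
      using r[OF that] nn abs_ge_self[of r] by linarith
    then have "K \<subseteq> cball 0 ?R" by (auto simp: subset_iff)
    moreover have "?R \<ge> 1" using nn by simp
    ultimately show ?thesis using t by (intro that[of ?R])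
  qed
  define T where "T h = (\<lambda>y. \<Sum>(a, t)\<leftarrow>ps. a * h (B *v y + t))" for h :: "real^'n \<Rightarrow> real"
  have T_eq: "T h = (\<lambda>y. \<Sum>p\<leftarrow>ps. fst p * h (B *v y + snd p))" for h
    by (simp add: T_def case_prod_unfold)
  have smT: "smooth (T h)" if "smooth h" for h
    unfolding T_eq by (intro smooth_sum_list smooth_cmult smooth_affine that)
  have dT: "d (T h) = d h" if "smooth h" for h
  proof -
    have "d (T h) = (\<Sum>p\<leftarrow>ps. fst p * d (\<lambda>y. h (B *v y + snd p)))"
      unfolding T_eq using that
      by (subst smooth_linear_sum_list[OF lin])
         (auto simp: smooth_linearD(2)[OF lin] smooth_affine intro!: smooth_cmult)
    then show ?thesis using ref[OF that] by (simp add: case_prod_unfold)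
  qed
  have contr: "\<bar>iter_partial is (T h) x\<bar> \<le> \<epsilon> / 2"
    if h: "smooth h" and eps: "\<And>is x. length is = L \<Longrightarrow> norm x \<le> R \<Longrightarrow> \<bar>iter_partial is h x\<bar> \<le> \<epsilon>"
      and "length is = L" "norm x \<le> R" for h \<epsilon> "is" x
  proof -
    have e0: "\<epsilon> \<ge> 0" using eps[OF that(3,4)] by simp
    have "iter_partial is (T h) x = (\<Sum>p\<leftarrow>ps. fst p * iter_partial is (\<lambda>y. h (B *v y + snd p)) x)"
      unfolding T_eq by (subst iter_partial_sum_list) (auto simp: iter_partial_cmult smooth_affine[OF h] intro!: smooth_cmult)
    also have "\<bar>\<dots>\<bar> \<le> (\<Sum>p\<leftarrow>ps. \<bar>fst p * iter_partial is (\<lambda>y. h (B *v y + snd p)) x\<bar>)"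
      using sum_list_abs[of "map (\<lambda>p. fst p * iter_partial is (\<lambda>y. h (B *v y + snd p)) x) ps"]
      by (simp add: o_def)
    also have "\<dots> \<le> (\<Sum>p\<leftarrow>ps. \<bar>fst p\<bar> * ((1/2)^L * \<epsilon>))"
    proof (rule sum_list_mono)
      fix p assume p: "p \<in> set ps"
      have "norm (B *v x + snd p) \<le> R"
        using norm_triangle_ineq[of "B *v x" "snd p"] nB[of x] that(4) R(3)[of "fst p" "snd p"] p by simp
      then have "\<bar>iter_partial is (\<lambda>y. h (B *v y + snd p)) x\<bar> \<le> (1/2)^length is * \<epsilon>"
        by (intro iter_partial_affine_bound[OF h col] eps) (auto simp: that)
      then show "\<bar>fst p * iter_partial is (\<lambda>y. h (B *v y + snd p)) x\<bar> \<le> \<bar>fst p\<bar> * ((1/2)^L * \<epsilon>)"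
        by (simp add: abs_mult mult_left_mono that)
    qed
    also have "\<dots> = \<Gamma> * (1/2)^L * \<epsilon>"
      by (simp add: \<Gamma>_def case_prod_unfold sum_list_mult_const mult.assoc)
    also have "\<dots> \<le> 1/2 * \<epsilon>" by (intro mult_right_mono L e0)
    finally show ?thesis by simp
  qed
  obtain E where E: "\<And>is x. length is = L \<Longrightarrow> norm x \<le> R \<Longrightarrow> \<bar>iter_partial is g x\<bar> \<le> E"
    using smooth_bounded_partials[OF g, of L R] by blast
  have it: "smooth ((T ^^ q) g) \<and> d ((T ^^ q) g) = d g \<and>
     (\<forall>is x. length is = L \<longrightarrow> norm x \<le> R \<longrightarrow> \<bar>iter_partial is ((T ^^ q) g) x\<bar> \<le> E / 2^q)" for q
  proof (induction q)
    case 0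
    then show ?case using g E by simp
  next
    case (Suc q)
    then show ?case using smT dT contr[of "(T ^^ q) g" "E / 2^q"] by (simp add: field_simps)
  qed
  have "\<bar>d g\<bar> \<le> C * ((CARD('n) * R) ^ L * (E / 2^q))" for q
  proof -
    let ?h = "(T ^^ q) g"
    have sm: "smooth ?h" using it by blast
    have "d g = d (\<lambda>x. ?h x - taylor L ?h x)"
      using it[of q] smooth_linear_diff[OF lin sm smooth_taylor] poly[OF real_polynomial_function_taylor] by simp
    also have "\<bar>\<dots>\<bar> \<le> C * ((CARD('n) * R) ^ L * (E / 2^q))"
    proof (rule bd)
      fix "is" :: "'n list" and x assume *: "length is \<le> N" "x \<in> K"
      show "\<bar>iter_partial is (\<lambda>x. ?h x - taylor L ?h x) x\<bar> \<le> (CARD('n) * R) ^ L * (E / 2^q)"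
        by (rule iter_partial_taylor_remainder_bound[OF sm R(1)]) (use * L R it in auto)
    qed (intro smooth_diff sm smooth_taylor)
    finally show ?thesis .
  qed
  moreover have "(\<lambda>q. C * ((CARD('n) * R) ^ L * (E / 2^q))) \<longlonglongrightarrow> C * ((CARD('n) * R) ^ L * 0)"
  proof (intro tendsto_mult tendsto_const)
    have "(\<lambda>q. E * (1/2)^q) \<longlonglongrightarrow> E * 0" by (intro tendsto_mult tendsto_const LIMSEQ_power_zero) simp
    then show "(\<lambda>q. E / 2^q) \<longlonglongrightarrow> 0" by (simp add: power_one_over)
  qed
  ultimately have "\<bar>d g\<bar> \<le> 0" by (intro LIMSEQ_le_const) auto
  then show ?thesis by simp
qed

theorem compact_distribution_refinement_eq_0:
  fixes B :: "real^'n^'n"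
  assumes dist: "compact_distribution d"
    and ref: "\<And>g. smooth g \<Longrightarrow> d g = (\<Sum>(a, t)\<leftarrow>ps. a * d (\<lambda>y. g (B *v y + t)))"
    and one: "(\<Sum>(a, t)\<leftarrow>ps. a) = 1"
    and B: "\<And>x. (\<lambda>n. (((*v) B) ^^ n) x) \<longlonglongrightarrow> 0"
    and d1: "d (\<lambda>_. 1) = 0"
    and g: "smooth g"
  shows "d g = 0"
proof -
  have "(\<lambda>n. \<Sum>i\<in>UNIV. \<Sum>j\<in>UNIV. \<bar>(((*v) B) ^^ n) (axis i 1) $ j\<bar>) \<longlonglongrightarrow> (\<Sum>i\<in>(UNIV::'n set). \<Sum>j\<in>(UNIV::'n set). \<bar>(0::real^'n) $ j\<bar>)"
    by (intro tendsto_sum tendsto_rabs tendsto_vec_nth B)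
  then have "eventually (\<lambda>n. (\<Sum>i\<in>UNIV. \<Sum>j\<in>UNIV. \<bar>(((*v) B) ^^ n) (axis i 1) $ j\<bar>) < 1/2) sequentially"
    by (rule order_tendstoD) simp
  then obtain n where n: "(\<Sum>i\<in>UNIV. \<Sum>j\<in>UNIV. \<bar>(((*v) B) ^^ n) (axis i 1) $ j\<bar>) < 1/2"
    using eventually_happens'[OF sequentially_bot] by blast
  obtain B' ps' where B': "\<And>x. B' *v x = (((*v) B) ^^ n) x"
    and ref': "\<And>g. smooth g \<Longrightarrow> d g = (\<Sum>(a, t)\<leftarrow>ps'. a * d (\<lambda>y. g (B' *v y + t)))"
    using refinement_iterate[where B = B and d = d and ps = ps and n = n, OF ref] by blast
  have "B' $ j $ i = (((*v) B) ^^ n) (axis i 1) $ j" for i j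
    unfolding B'[symmetric] by (simp add: matrix_vector_mult_basis column_def)
  then have "(\<Sum>i\<in>UNIV. \<Sum>j\<in>UNIV. \<bar>B'$j$i\<bar>) \<le> 1/2" using n by simp
  from compact_distribution_eq_0_if_contractive[OF dist ref' _ this g]
    refinement_polynomials_zero[OF compact_distribution_smooth_linear[OF dist] ref one B d1]
  show ?thesis by blast
qed

section \<open>Continuous functions of compact support\<close>

text \<open>Bounded support is the same as compact support, but is easier to verify and makes sense uniformly
for functions on the line and in space.\<close>
definition Cc :: "('a::euclidean_space \<Rightarrow> real) \<Rightarrow> bool" where
  "Cc f \<longleftrightarrow> continuous_on UNIV f \<and> (\<exists>R. \<forall>x. f x \<noteq> 0 \<longrightarrow> norm x \<le> R)"

lemma Cc_iff: "Cc f \<longleftrightarrow> continuous_on UNIV f \<and> compactly_supported f"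
  by (auto simp: Cc_def compactly_supported_def bounded_iff)

lemma Cc_continuous: "Cc f \<Longrightarrow> continuous_on A f"
  using continuous_on_subset unfolding Cc_def by blast

lemma Cc_support:
  assumes "Cc f"
  obtains R where "R > 0" "\<And>x. norm x > R \<Longrightarrow> f x = 0"
proof -
  obtain R where "\<And>x. f x \<noteq> 0 \<Longrightarrow> norm x \<le> R" using assms by (auto simp: Cc_def)
  then have "norm x > \<bar>R\<bar> + 1 \<Longrightarrow> f x = 0" for x
    by (metis abs_ge_self add_increasing2 leD order_trans zero_le_one)
  then show ?thesis by (intro that[of "\<bar>R\<bar> + 1"]) auto
qed

lemma CcI:
  assumes "continuous_on UNIV f" "\<And>x. norm x > R \<Longrightarrow> f x = 0"
  shows "Cc f"
  using assms unfolding Cc_def by (meson not_le_imp_less)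

lemma Cc_bounded:
  assumes "Cc f"
  obtains B where "\<And>x. \<bar>f x\<bar> \<le> B"
proof -
  obtain R where R: "\<And>x. norm x > R \<Longrightarrow> f x = 0" using Cc_support[OF assms] by metis
  have "bounded (f ` cball 0 R)"
    by (intro compact_imp_bounded compact_continuous_image Cc_continuous assms compact_cball)
  then obtain B where "\<forall>y\<in>f ` cball 0 R. norm y \<le> B" unfolding bounded_iff by blast
  then have B: "\<bar>f x\<bar> \<le> B" if "norm x \<le> R" for x using that by simp
  have "\<bar>f x\<bar> \<le> max B 0" for x using R[of x] B[of x] by (cases "norm x \<le> R") auto
  then show ?thesis using that by blast
qed

lemma Cc_mult_right:
  assumes "Cc f" "continuous_on UNIV g"
  shows "Cc (\<lambda>x. f x * g x)"
  using assms unfolding Cc_def by (auto intro!: continuous_intros)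

lemma Cc_zero: "Cc (\<lambda>x. 0)"
  by (simp add: Cc_def)

lemma Cc_cmult: "Cc f \<Longrightarrow> Cc (\<lambda>x. a * f x)"
  using Cc_mult_right[of f "\<lambda>x. a"] by (simp add: mult.commute)

lemma Cc_add:
  fixes f g :: "'a::euclidean_space \<Rightarrow> real"
  assumes "Cc f" "Cc g"
  shows "Cc (\<lambda>x. f x + g x)"
proof -
  obtain R where R: "\<And>x. norm x > R \<Longrightarrow> f x = 0" using Cc_support[OF assms(1)] by metis
  obtain S where S: "\<And>x. norm x > S \<Longrightarrow> g x = 0" using Cc_support[OF assms(2)] by metis
  show ?thesis
  proof (rule CcI)
    show "continuous_on UNIV (\<lambda>x. f x + g x)" by (intro continuous_on_add Cc_continuous assms)
    show "f x + g x = 0" if "norm x > max R S" for x using that R[of x] S[of x] by simp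
  qed
qed

lemma Cc_diff: "Cc f \<Longrightarrow> Cc g \<Longrightarrow> Cc (\<lambda>x. f x - g x)"
  using Cc_add[OF _ Cc_cmult[of g "-1"]] by fastforce

lemma Cc_sum: "(\<And>k. k \<in> F \<Longrightarrow> Cc (f k)) \<Longrightarrow> Cc (\<lambda>x. \<Sum>k\<in>F. f k x)"
  by (induction F rule: infinite_finite_induct) (auto simp: Cc_zero Cc_add)

lemma Cc_integrable: "Cc f \<Longrightarrow> integrable lborel f"
proof -
  assume f: "Cc f"
  then obtain R where "\<And>x. norm x > R \<Longrightarrow> f x = 0" using Cc_support by metis
  then have "(\<lambda>x. indicator (cball 0 R) x *\<^sub>R f x) = f" by (auto simp: fun_eq_iff indicator_def not_le)
  moreover have "integrable lborel (\<lambda>x. indicator (cball 0 R) x *\<^sub>R f x)"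
    by (intro borel_integrable_compact compact_cball Cc_continuous f)
  ultimately show ?thesis by simp
qed

lemma Cc_measurable: "Cc f \<Longrightarrow> f \<in> borel_measurable borel"
  by (intro borel_measurable_continuous_onI Cc_continuous)

lemma Cc_translate:
  fixes f :: "'a::euclidean_space \<Rightarrow> real"
  assumes "Cc f"
  shows "Cc (\<lambda>x. f (x + a))"
proof -
  obtain R where R: "\<And>x. norm x > R \<Longrightarrow> f x = 0" using Cc_support[OF assms] by metis
  show ?thesis
  proof (rule CcI[where R = "R + norm a"])
    show "continuous_on UNIV (\<lambda>x. f (x + a))"
      by (rule continuous_on_compose2[OF Cc_continuous[OF assms, of UNIV]]) (auto intro!: continuous_intros)
    fix x :: 'a assume "norm x > R + norm a"
    then have "norm (x + a) > R" using norm_diff_ineq[of x a] by linarith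
    then show "f (x + a) = 0" by (rule R)
  qed
qed

lemma matrix_inv_mult:
  assumes "invertible A"
  shows "A ** matrix_inv A = mat 1" "matrix_inv A ** A = mat 1"
  using assms someI_ex[of "\<lambda>A'. A ** A' = mat 1 \<and> A' ** A = mat 1"]
  unfolding matrix_inv_def invertible_def by auto

lemma Cc_matrix:
  fixes A :: "real^'n^'n"
  assumes f: "Cc f" and A: "invertible A"
  shows "Cc (\<lambda>x. f (A *v x))"
proof -
  obtain R where R: "R > 0" "\<And>x. norm x > R \<Longrightarrow> f x = 0" using Cc_support[OF f] by metis
  have inv: "matrix_inv A *v (A *v x) = x" for x
    using A by (simp add: matrix_vector_mul_assoc matrix_inv_mult)
  obtain C where C: "C > 0" "\<And>x. norm (matrix_inv A *v x) \<le> norm x * C"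
    using bounded_linear.pos_bounded[OF matrix_vector_mul_bounded_linear] by metis
  show ?thesis
  proof (rule CcI[where R = "R * C"])
    show "continuous_on UNIV (\<lambda>x. f (A *v x))"
      by (rule continuous_on_compose2[OF Cc_continuous[OF f, of UNIV]]) (auto intro!: linear_continuous_on)
    fix x :: "real^'n" assume *: "norm x > R * C"
    have "norm x \<le> norm (A *v x) * C" using C(2)[of "A *v x"] by (simp add: inv)
    then have "R * C < norm (A *v x) * C" using * by linarith
    then have "norm (A *v x) > R" using C(1) by simp
    then show "f (A *v x) = 0" by (rule R)
  qed
qed

lemma lebesgue_integral_translate:
  fixes f :: "'a::euclidean_space \<Rightarrow> real"
  assumes [measurable]: "f \<in> borel_measurable borel"
  shows "(LBINT x. f (x + a)) = (LBINT x. f x)"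
proof -
  have "(LBINT x. f x) = (\<integral>x. f x \<partial>distr lborel borel ((+) a))"
    by (simp add: lborel_distr_plus)
  also have "\<dots> = (LBINT x. f (a + x))" by (rule integral_distr) auto
  finally show ?thesis by (simp add: add.commute)
qed

text \<open>By the Weierstrass theorem \<open>u\<close> is uniformly close to a polynomial on its support, so the integral
of its square is arbitrarily small.\<close>
lemma Cc_eq_0_if_orthogonal_to_polynomials:
  fixes u :: "'a::euclidean_space \<Rightarrow> real"
  assumes u: "Cc u" and orth: "\<And>p. real_polynomial_function p \<Longrightarrow> (LBINT x. u x * p x) = 0"
  shows "u x = 0"
proof -
  obtain R where R: "R > 0" "\<And>x. norm x > R \<Longrightarrow> u x = 0" using Cc_support[OF u] by metis
  have uu: "Cc (\<lambda>x. u x * u x)" by (intro Cc_mult_right u Cc_continuous)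
  have "(LBINT x. u x * u x) \<le> e * (LBINT x. \<bar>u x\<bar>)" if e: "e > 0" for e
  proof -
    obtain p where p: "real_polynomial_function p" "\<And>x. x \<in> cball 0 R \<Longrightarrow> \<bar>u x - p x\<bar> < e"
      using Stone_Weierstrass_real_polynomial_function[OF compact_cball Cc_continuous[OF u] e] by metis
    have cp: "continuous_on UNIV p"
      using p(1) by (simp add: continuous_on_polymonial_function real_polynomial_function_eq)
    have up: "Cc (\<lambda>x. u x * p x)" by (intro Cc_mult_right u cp)
    have "(LBINT x. u x * u x) = (LBINT x. u x * u x - u x * p x)"
      by (subst Bochner_Integration.integral_diff) (auto simp: orth[OF p(1)] Cc_integrable uu up)
    also have "\<dots> \<le> (LBINT x. e * \<bar>u x\<bar>)"
    proof (rule integral_mono)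
      show "integrable lborel (\<lambda>x. u x * u x - u x * p x)"
        by (intro Bochner_Integration.integrable_diff Cc_integrable uu up)
      show "integrable lborel (\<lambda>x. e * \<bar>u x\<bar>)"
        by (intro integrable_mult_right integrable_abs Cc_integrable u)
      fix x
      show "u x * u x - u x * p x \<le> e * \<bar>u x\<bar>"
      proof (cases "norm x \<le> R")
        case True
        then have "\<bar>u x\<bar> * \<bar>u x - p x\<bar> \<le> \<bar>u x\<bar> * e" using p(2)[of x] by (intro mult_left_mono) auto
        then show ?thesis by (simp add: abs_mult[symmetric] right_diff_distrib mult.commute[of e])
      next
        case False
        then show ?thesis using R(2)[of x] by simp
      qed
    qed
    finally show ?thesis by simp
  qed
  from this[of "1 / real (Suc n)" for n]
  have le: "(LBINT x. u x * u x) \<le> 1 / real (Suc n) * (LBINT x. \<bar>u x\<bar>)" for n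
    by simp
  have "(\<lambda>n. 1 / real (Suc n) * (LBINT x. \<bar>u x\<bar>)) \<longlonglongrightarrow> 0 * (LBINT x. \<bar>u x\<bar>)"
    by (intro tendsto_mult tendsto_const LIMSEQ_Suc[OF lim_1_over_n])
  then have "(LBINT x. u x * u x) \<le> 0"
    using le by (intro LIMSEQ_le_const) auto
  then have 0: "(LBINT x. u x * u x) = 0"
    by (simp add: antisym Bochner_Integration.integral_nonneg)
  have "AE x in lborel. u x * u x = 0"
    using integral_nonneg_eq_0_iff_AE[OF Cc_integrable[OF uu]] 0 by simp
  then have ae: "AE x in lborel. u x = 0" by simp
  have [measurable]: "u \<in> borel_measurable borel" by (rule Cc_measurable[OF u])
  have "{x \<in> space lborel. u x \<noteq> 0} \<in> sets lborel" by measurable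
  then have "{x. u x \<noteq> 0} \<in> null_sets lborel"
    using ae AE_iff_null[of lborel "\<lambda>x. u x = 0"] by simp
  then have "negligible {x. u x \<noteq> 0}"
    by (simp add: negligible_iff_null_sets null_sets_completionI)
  moreover have "open {x. u x \<noteq> 0}"
    using Cc_continuous[OF u, of UNIV] by (intro open_Collect_neq continuous_on_const) auto
  ultimately have "{x. u x \<noteq> 0} = {}" using open_not_negligible by blast
  then show ?thesis by blast
qed

section \<open>Directional derivatives\<close>

text \<open>The function \<open>G\<close> is the classical derivative of \<open>F\<close> in direction \<open>a\<close> at every point; total
differentiability of \<open>F\<close> is not implied.\<close>
definition has_dd :: "('a::real_normed_vector \<Rightarrow> real) \<Rightarrow> 'a \<Rightarrow> ('a \<Rightarrow> real) \<Rightarrow> bool" where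
  "has_dd F a G \<longleftrightarrow> (\<forall>x. ((\<lambda>t. F (x + t *\<^sub>R a)) has_real_derivative G x) (at 0))"

lemma has_dd_at:
  assumes "has_dd F a G"
  shows "((\<lambda>t. F (x + t *\<^sub>R a)) has_real_derivative G (x + s *\<^sub>R a)) (at s)"
proof -
  have "((\<lambda>t. F ((x + s *\<^sub>R a) + t *\<^sub>R a)) has_real_derivative G (x + s *\<^sub>R a)) (at 0)"
    using assms by (simp add: has_dd_def)
  then have "((\<lambda>t. F (x + (t + s) *\<^sub>R a)) has_real_derivative G (x + s *\<^sub>R a)) (at 0)"
    by (simp add: algebra_simps)
  then show ?thesis
    using DERIV_shift[of "\<lambda>t. F (x + t *\<^sub>R a)" "G (x + s *\<^sub>R a)" 0 s] by simp
qed

lemma has_dd_diff: "has_dd F a G \<Longrightarrow> has_dd F' a G' \<Longrightarrow> has_dd (\<lambda>x. F x - F' x) a (\<lambda>x. G x - G' x)"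
  unfolding has_dd_def by (auto intro!: DERIV_diff)

lemma has_dd_cmult: "has_dd F a G \<Longrightarrow> has_dd (\<lambda>x. c * F x) a (\<lambda>x. c * G x)"
  unfolding has_dd_def by (auto intro!: DERIV_cmult)

lemma has_dd_sum:
  "(\<And>k. k \<in> S \<Longrightarrow> has_dd (F k) a (G k)) \<Longrightarrow> has_dd (\<lambda>x. \<Sum>k\<in>S. F k x) a (\<lambda>x. \<Sum>k\<in>S. G k x)"
  unfolding has_dd_def by (auto intro!: DERIV_sum)

lemma has_dd_mult:
  assumes "has_dd F a F'" "has_dd G a G'"
  shows "has_dd (\<lambda>x. F x * G x) a (\<lambda>x. F' x * G x + F x * G' x)"
  unfolding has_dd_def
proof
  fix x
  show "((\<lambda>t. F (x + t *\<^sub>R a) * G (x + t *\<^sub>R a)) has_real_derivative F' x * G x + F x * G' x) (at 0)"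
    using DERIV_mult[OF has_dd_at[OF assms(1), of x 0] has_dd_at[OF assms(2), of x 0]]
    by (simp add: mult.commute add.commute)
qed

lemma has_dd_unique: "has_dd F a G \<Longrightarrow> has_dd F a G' \<Longrightarrow> G = G'"
  unfolding has_dd_def using DERIV_unique by blast

lemma has_dd_MVT:
  assumes "has_dd F a G" "h > 0"
  obtains s where "0 < s" "s < h" "F (x + h *\<^sub>R a) - F x = h * G (x + s *\<^sub>R a)"
  using MVT2[of 0 h "\<lambda>t. F (x + t *\<^sub>R a)" "\<lambda>t. G (x + t *\<^sub>R a)"] has_dd_at[OF assms(1)] assms(2)
  by auto

lemma Cc_eq_0_if_constant_along:
  assumes F: "Cc F" and dd: "has_dd F a (\<lambda>_. 0)" and a: "a \<noteq> 0"
  shows "F x = 0"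
proof -
  obtain R where R: "R > 0" "\<And>x. norm x > R \<Longrightarrow> F x = 0" using Cc_support[OF F] by metis
  define h where "h = (R + norm x + 1) / norm a"
  have h: "h > 0" using R a by (simp add: h_def add_pos_nonneg)
  have "norm (h *\<^sub>R a) = R + norm x + 1" using a R by (simp add: h_def)
  then have "norm (x + h *\<^sub>R a) > R" using norm_diff_ineq[of "h *\<^sub>R a" x] by (simp add: add.commute)
  then have "F (x + h *\<^sub>R a) = 0" by (rule R)
  moreover obtain s where "F (x + h *\<^sub>R a) - F x = h * 0" using has_dd_MVT[OF dd h] by metis
  ultimately show ?thesis by simp
qed

text \<open>By translation invariance the difference quotients of \<open>F\<close> along \<open>a\<close> have integral zero, and they
converge to \<open>G\<close> boundedly on a fixed ball.\<close>
lemma integral_directional_derivative: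
  fixes F :: "'a::euclidean_space \<Rightarrow> real"
  assumes F: "Cc F" and G: "Cc G" and dd: "has_dd F a G"
  shows "(LBINT x. G x) = 0"
proof -
  define h where "h n = 1 / real (Suc n)" for n
  have h: "h n > 0" "h n \<le> 1" for n by (auto simp: h_def)
  define q where "q n x = (F (x + h n *\<^sub>R a) - F x) / h n" for n x
  obtain B where B: "\<And>x. \<bar>G x\<bar> \<le> B" using Cc_bounded[OF G] by metis
  obtain R where R: "R > 0" "\<And>x. norm x > R \<Longrightarrow> G x = 0" using Cc_support[OF G] by metis
  let ?w = "\<lambda>x. B * indicator (cball 0 (R + norm a)) x :: real"
  have Fint: "integrable lborel (\<lambda>x. F (x + b))" for b by (intro Cc_integrable Cc_translate F)
  have bound: "\<bar>q n x\<bar> \<le> ?w x" for n x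
  proof -
    obtain s where s: "0 < s" "s < h n" "F (x + h n *\<^sub>R a) - F x = h n * G (x + s *\<^sub>R a)"
      by (rule has_dd_MVT[OF dd h(1)[of n], of x])
    then have q: "q n x = G (x + s *\<^sub>R a)" using h(1)[of n] by (simp add: q_def)
    show ?thesis
    proof (cases "norm x \<le> R + norm a")
      case True
      then show ?thesis using B by (simp add: q)
    next
      case False
      have "norm (s *\<^sub>R a) \<le> norm a" using s h(2)[of n] by (simp add: mult_left_le_one_le)
      then have "norm (x + s *\<^sub>R a) > R" using False norm_diff_ineq[of x "s *\<^sub>R a"] by linarith
      then show ?thesis using False by (simp add: q R(2))
    qed
  qed
  have lim: "(\<lambda>n. q n x) \<longlonglongrightarrow> G x" for x
  proof -
    have "((\<lambda>t. (F (x + t *\<^sub>R a) - F x) / t) \<longlongrightarrow> G x) (at 0)"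
      using dd by (simp add: has_dd_def DERIV_def)
    moreover have "filterlim h (at 0) sequentially"
    proof (rule filterlim_atI)
      show "h \<longlonglongrightarrow> 0" unfolding h_def by (rule LIMSEQ_Suc[OF lim_1_over_n])
      show "\<forall>\<^sub>F n in sequentially. h n \<noteq> 0" using h(1) by (simp add: h_def)
    qed
    ultimately show ?thesis unfolding q_def by (rule filterlim_compose)
  qed
  have "(LBINT x. q n x) = 0" for n
  proof -
    have "(LBINT x. F (x + h n *\<^sub>R a) - F x) = 0"
      using Bochner_Integration.integral_diff[OF Fint[of "h n *\<^sub>R a"] Cc_integrable[OF F]]
        lebesgue_integral_translate[OF Cc_measurable[OF F], of "h n *\<^sub>R a"] by simp
    then show ?thesis by (simp add: q_def)
  qed
  moreover have "(\<lambda>n. LBINT x. q n x) \<longlonglongrightarrow> (LBINT x. G x)"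
  proof (rule integral_dominated_convergence[where w = ?w])
    show "G \<in> borel_measurable lborel" using Cc_measurable[OF G] by simp
    have "Cc (\<lambda>x. (1 / h n) * (F (x + h n *\<^sub>R a) - F x))" for n
      by (intro Cc_cmult Cc_diff Cc_translate F)
    moreover have "q n = (\<lambda>x. (1 / h n) * (F (x + h n *\<^sub>R a) - F x))" for n
      by (rule ext) (simp add: q_def)
    ultimately have "q n \<in> borel_measurable borel" for n
      using Cc_measurable[of "q n"] by simp
    then show "q n \<in> borel_measurable lborel" for n by simp
    show "integrable lborel ?w"
      by (intro integrable_mult_right integrable_real_indicator emeasure_bounded_finite bounded_cball) simp
  qed (use lim bound in auto)
  ultimately show ?thesis by (simp add: LIMSEQ_const_iff)
qed

lemma integration_by_parts_directional:
  fixes F :: "'a::euclidean_space \<Rightarrow> real"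
  assumes F: "Cc F" and F': "Cc F'" and dd: "has_dd F a F'"
    and g: "continuous_on UNIV g" and g': "continuous_on UNIV g'" and ddg: "has_dd g a g'"
  shows "(LBINT x. F' x * g x) = - (LBINT x. F x * g' x)"
proof -
  have 1: "Cc (\<lambda>x. F' x * g x)" and 2: "Cc (\<lambda>x. F x * g' x)"
    by (intro Cc_mult_right F F' g g')+
  have "(LBINT x. F' x * g x + F x * g' x) = 0"
    by (rule integral_directional_derivative[OF Cc_mult_right[OF F g] Cc_add[OF 1 2] has_dd_mult[OF dd ddg]])
  then show ?thesis
    using Bochner_Integration.integral_add[OF Cc_integrable[OF 1] Cc_integrable[OF 2]] by simp
qed

lemma Cc_line:
  fixes f :: "'a::euclidean_space \<Rightarrow> real"
  assumes f: "Cc f" and a: "a \<noteq> 0"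
  shows "Cc (\<lambda>t. f (x + t *\<^sub>R a))"
proof -
  obtain R where R: "R > 0" "\<And>x. norm x > R \<Longrightarrow> f x = 0" using Cc_support[OF f] by metis
  show ?thesis
  proof (rule CcI)
    show "continuous_on UNIV (\<lambda>t. f (x + t *\<^sub>R a))"
      by (rule continuous_on_compose2[OF Cc_continuous[OF f, of UNIV]]) (auto intro!: continuous_intros)
    fix t :: real assume "norm t > (R + norm x) / norm a"
    then have "norm (t *\<^sub>R a) > R + norm x" using a by (simp add: field_simps)
    then have "norm (x + t *\<^sub>R a) > R" using norm_diff_ineq[of "t *\<^sub>R a" x] by (simp add: add.commute)
    then show "f (x + t *\<^sub>R a) = 0" by (rule R)
  qed
qed

text \<open>The antiderivative is \<open>h x = \<integral>\<^sub>-\<^sub>\<infinity>\<^sup>0 f (x + t a) dt\<close>. If \<open>h x \<noteq> 0\<close>, then the line through \<open>x\<close>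
meets the support of \<open>f\<close> at some \<open>t \<le> 0\<close>, and also at some \<open>t \<ge> 0\<close> because the integral over
the whole line vanishes. So \<open>x\<close> lies between two points of a ball that contains the support.\<close>
lemma antiderivative_along:
  fixes f :: "'a::euclidean_space \<Rightarrow> real"
  assumes f: "Cc f" and a: "a \<noteq> 0" and mean: "\<And>b. (LBINT t. f (t *\<^sub>R a + b)) = 0"
  shows "\<exists>h. Cc h \<and> has_dd h a f"
proof -
  define \<phi> where "\<phi> x t = f (x + t *\<^sub>R a)" for x t
  define h where "h x = integral {..0} (\<phi> x)" for x
  have \<phi>: "Cc (\<phi> x)" for x unfolding \<phi>_def by (rule Cc_line[OF f a])
  have ic: "\<phi> x integrable_on {l..u}" for x l u
    by (rule integrable_continuous_interval[OF Cc_continuous[OF \<phi>]])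
  obtain R where R: "R > 0" "\<And>x. norm x > R \<Longrightarrow> f x = 0" using Cc_support[OF f] by metis
  define \<tau> where "\<tau> r = (R + r) / norm a" for r
  have out: "\<phi> x t = 0" if "norm x \<le> r" "\<bar>t\<bar> > \<tau> r" for x t r
  proof -
    have "norm (t *\<^sub>R a) > R + r" using a that(2) by (simp add: \<tau>_def field_simps)
    then have "norm (x + t *\<^sub>R a) > R" using that(1) norm_diff_ineq[of "t *\<^sub>R a" x] by (simp add: add.commute)
    then show ?thesis unfolding \<phi>_def by (rule R)
  qed
  have h_eq: "h x = integral {- T..0} (\<phi> x)" if x: "norm x \<le> r" and T: "T \<ge> \<tau> r" for x r T
  proof -
    have "((\<lambda>t. if t \<in> {- T..0} then \<phi> x t else 0) has_integral integral {- T..0} (\<phi> x)) {..0}"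
    proof (rule has_integral_on_superset[where S = "{-T..0}"])
      show "((\<lambda>t. if t \<in> {- T..0} then \<phi> x t else 0) has_integral integral {- T..0} (\<phi> x)) {- T..0}"
        by (rule has_integral_eq[OF _ integrable_integral[OF ic]]) simp
    qed auto
    moreover have "(if t \<in> {- T..0} then \<phi> x t else 0) = \<phi> x t" if "t \<in> {..0}" for t
      using out[OF x, of t] T that by auto
    ultimately have "(\<phi> x has_integral integral {- T..0} (\<phi> x)) {..0}"
      using has_integral_cong[of "{..0}" "\<lambda>t. if t \<in> {- T..0} then \<phi> x t else 0" "\<phi> x"] by simp
    then show ?thesis unfolding h_def by (rule integral_unique)
  qed
  have "continuous_on UNIV h"
  proof -
    have "isCont h x" for x
    proof -
      let ?r = "norm x + 1"
      have c: "continuous_on (ball 0 ?r \<times> cbox (- \<tau> ?r) 0) (\<lambda>(x, t). \<phi> x t)"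
        unfolding \<phi>_def case_prod_unfold
        by (rule continuous_on_compose2[OF Cc_continuous[OF f, of UNIV]]) (auto intro!: continuous_intros)
      have "continuous_on (ball 0 ?r) (\<lambda>x. integral (cbox (- \<tau> ?r) 0) (\<phi> x))"
        by (rule integral_continuous_on_param[OF c])
      then have "continuous_on (ball 0 ?r) h"
        by (rule continuous_on_eq) (simp add: h_eq[where r = ?r and T = "\<tau> ?r"])
      then show ?thesis by (simp add: continuous_on_eq_continuous_at)
    qed
    then show ?thesis by (simp add: continuous_at_imp_continuous_on)
  qed
  moreover have "h x = 0" if x: "norm x > R" for x
  proof (rule ccontr)
    assume hx: "h x \<noteq> 0"
    obtain t1 where t1: "t1 \<le> 0" "\<phi> x t1 \<noteq> 0"
    proof (rule ccontr)
      assume "\<not> thesis"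
      then have "\<phi> x t = 0" if "t \<in> {..0}" for t using that \<open>\<And>t1. t1 \<le> 0 \<Longrightarrow> \<phi> x t1 \<noteq> 0 \<Longrightarrow> thesis\<close> by auto
      then have "h x = integral {..0::real} (\<lambda>t. 0)" unfolding h_def by (intro Henstock_Kurzweil_Integration.integral_cong) auto
      then show False using hx by simp
    qed
    obtain t2 where t2: "t2 \<ge> 0" "\<phi> x t2 \<noteq> 0"
    proof (rule ccontr)
      assume "\<not> thesis"
      then have z: "\<phi> x t = 0" if "t \<ge> 0" for t using that \<open>\<And>t2. t2 \<ge> 0 \<Longrightarrow> \<phi> x t2 \<noteq> 0 \<Longrightarrow> thesis\<close> by auto
      have "h x = integral UNIV (\<lambda>t. if t \<in> {..0} then \<phi> x t else 0)"
        unfolding h_def by (rule integral_restrict_UNIV[symmetric])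
      also have "(\<lambda>t. if t \<in> {..0} then \<phi> x t else 0) = \<phi> x" using z by (auto simp: fun_eq_iff)
      also have "integral UNIV (\<phi> x) = (LBINT t. \<phi> x t)"
        by (rule integral_lborel[OF Cc_integrable[OF \<phi>]])
      also have "\<dots> = 0" using mean[of x] by (simp add: \<phi>_def add.commute)
      finally show False using hx by simp
    qed
    have n1: "norm (x + t1 *\<^sub>R a) \<le> R" and n2: "norm (x + t2 *\<^sub>R a) \<le> R"
      using t1 t2 R(2) unfolding \<phi>_def by (meson not_le)+
    have "t1 \<noteq> 0" using n1 x by auto
    then have d: "t2 - t1 > 0" using t1 t2 by simp
    define u where "u = t2 / (t2 - t1)"
    have u: "0 \<le> u" "u \<le> 1" "u * t1 + (1 - u) * t2 = 0"
      using d t1(1) t2(1) by (auto simp: u_def field_simps)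
    have "u *\<^sub>R (x + t1 *\<^sub>R a) + (1 - u) *\<^sub>R (x + t2 *\<^sub>R a) = x + (u * t1 + (1 - u) * t2) *\<^sub>R a"
      by (simp add: algebra_simps)
    then have "x = u *\<^sub>R (x + t1 *\<^sub>R a) + (1 - u) *\<^sub>R (x + t2 *\<^sub>R a)" by (simp add: u(3))
    then have "norm x \<le> u * norm (x + t1 *\<^sub>R a) + (1 - u) * norm (x + t2 *\<^sub>R a)"
      using norm_triangle_ineq[of "u *\<^sub>R (x + t1 *\<^sub>R a)" "(1 - u) *\<^sub>R (x + t2 *\<^sub>R a)"] u by simp
    also have "\<dots> \<le> u * R + (1 - u) * R" using u by (intro add_mono mult_left_mono n1 n2) auto
    finally show False using x by (simp add: algebra_simps)
  qed
  ultimately have "Cc h" by (rule CcI)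
  moreover have "has_dd h a f"
    unfolding has_dd_def
  proof
    fix x :: "'a"
    define r where "r = norm x + norm a"
    define T where "T = \<bar>\<tau> r\<bar> + 1"
    \<comment> \<open>\<open>T\<close> leaves room for shifting the interval of integration by less than 1\<close>
    have T: "T \<ge> \<tau> r + 1" "T > 0" by (auto simp: T_def)
    have sh: "h (x + s *\<^sub>R a) = integral {- T..s} (\<phi> x)" if s: "\<bar>s\<bar> < 1" for s
    proof -
      have "norm (s *\<^sub>R a) \<le> norm a" using s by (simp add: mult_left_le_one_le)
      then have "norm (x + s *\<^sub>R a) \<le> r" unfolding r_def by (meson add_left_mono norm_triangle_ineq order_trans)
      then have "h (x + s *\<^sub>R a) = integral {- (T + s)..0} (\<phi> (x + s *\<^sub>R a))"
        by (rule h_eq) (use T s in auto)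
      also have "\<phi> (x + s *\<^sub>R a) = (\<lambda>t. \<phi> x (t + s))"
        by (auto simp: \<phi>_def algebra_simps)
      also have "integral {- (T + s)..0} \<dots> = integral {- T..s} (\<phi> x)"
        using integral_shift_real_ivl[of "- T" s s "\<phi> x"] by (simp add: algebra_simps)
      finally show ?thesis .
    qed
    have "((\<lambda>s. integral {- T..s} (\<phi> x)) has_real_derivative \<phi> x 0) (at 0 within {- T..1})"
      by (rule integral_has_real_derivative[OF Cc_continuous[OF \<phi>]]) (use T in auto)
    moreover have "at 0 within {- T..1} = at (0::real)"
      by (rule at_within_interior) (use T in auto)
    ultimately have "((\<lambda>s. integral {- T..s} (\<phi> x)) has_real_derivative f x) (at 0)"
      by (simp add: \<phi>_def)
    then show "((\<lambda>s. h (x + s *\<^sub>R a)) has_real_derivative f x) (at 0)"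
      by (rule has_field_derivative_transform_within_open[where S = "{-1<..<1}"]) (auto simp: sh)
  qed
  ultimately show ?thesis by blast
qed

section \<open>The transition operator on functions\<close>

lemma transition_add: "transition M c (\<lambda>x. f x + g x) = (\<lambda>x. transition M c f x + transition M c g x)"
  by (simp add: transition_def algebra_simps sum.distrib fun_eq_iff)

lemma transition_cmult: "transition M c (\<lambda>x. a * f x) = (\<lambda>x. a * transition M c f x)"
  by (simp add: transition_def algebra_simps sum_distrib_left fun_eq_iff)

lemma transition_diff: "transition M c (\<lambda>x. f x - g x) = (\<lambda>x. transition M c f x - transition M c g x)"
  by (simp add: transition_def algebra_simps sum_subtractf fun_eq_iff)

lemma Cc_affine:
  fixes A :: "real^'n^'n"
  assumes "Cc f" "invertible A"
  shows "Cc (\<lambda>x. f (A *v x - t))"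
  using Cc_matrix[OF Cc_translate[OF assms(1), of "- t"] assms(2)] by simp

lemma Cc_transition: "invertible (rmat M) \<Longrightarrow> Cc f \<Longrightarrow> Cc (transition M c f)"
  unfolding transition_def[abs_def] by (intro Cc_sum Cc_cmult Cc_affine)

lemma has_dd_transition:
  assumes "has_dd f (rmat M *v a) g"
  shows "has_dd (transition M c f) a (transition M c g)"
proof -
  have "has_dd (\<lambda>x. f (rmat M *v x - t)) a (\<lambda>x. g (rmat M *v x - t))" for t
    unfolding has_dd_def
  proof
    fix x
    have "((\<lambda>s. f ((rmat M *v x - t) + s *\<^sub>R (rmat M *v a))) has_real_derivative g (rmat M *v x - t)) (at 0)"
      using assms by (simp add: has_dd_def)
    then show "((\<lambda>s. f (rmat M *v (x + s *\<^sub>R a) - t)) has_real_derivative g (rmat M *v x - t)) (at 0)"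
      by (simp add: matrix_vector_right_distrib matrix_vector_mult_scaleR algebra_simps)
  qed
  then show ?thesis
    unfolding transition_def[abs_def] by (intro has_dd_sum has_dd_cmult)
qed

lemma integral_transition:
  assumes inv: "invertible (rmat M)" and f: "Cc f" and g: "continuous_on UNIV g"
  shows "(LBINT x. transition M c f x * g x)
    = (\<Sum>k | c k \<noteq> 0. c k * (LBINT y. f y * g (matrix_inv (rmat M) *v (y + rvec k))) / \<bar>det (rmat M)\<bar>)"
proof -
  let ?A = "rmat M"
  have det: "det ?A \<noteq> 0" using inv invertible_det_nz by blast
  have one: "(LBINT x. f (?A *v x - t) * g x)
      = (LBINT y. f y * g (matrix_inv ?A *v (y + t))) / \<bar>det ?A\<bar>" for t
  proof -
    let ?h = "\<lambda>y. f y * g (matrix_inv ?A *v (y + t))"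
    have h: "Cc ?h"
      by (intro Cc_mult_right f continuous_on_compose2[OF g] continuous_intros
          linear_continuous_on_compose[OF _ matrix_vector_mul_linear]) auto
    have "(LBINT x. f (?A *v x - t) * g x) = (LBINT x. ?h (?A *v x + - t))"
      by (simp add: matrix_vector_mul_assoc matrix_inv_mult[OF inv])
    also have "\<dots> = (LBINT x. ?h (x + - t)) / \<bar>det ?A\<bar>"
      by (rule lebesgue_integral_linear_image[OF Cc_measurable[OF Cc_translate[OF h]] det])
    also have "(LBINT x. ?h (x + - t)) = (LBINT x. ?h x)"
      by (rule lebesgue_integral_translate[OF Cc_measurable[OF h]])
    finally show ?thesis .
  qed
  have "(LBINT x. transition M c f x * g x) = (LBINT x. (\<Sum>k | c k \<noteq> 0. c k * (f (?A *v x - rvec k) * g x)))"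
    by (simp add: transition_def sum_distrib_right mult.assoc)
  also have "\<dots> = (\<Sum>k | c k \<noteq> 0. (LBINT x. c k * (f (?A *v x - rvec k) * g x)))"
    by (intro Bochner_Integration.integral_sum Cc_integrable Cc_cmult Cc_mult_right Cc_affine f g inv)
  also have "\<dots> = (\<Sum>k | c k \<noteq> 0. c k * (LBINT y. f y * g (matrix_inv ?A *v (y + rvec k))) / \<bar>det ?A\<bar>)"
    by (simp add: one)
  finally show ?thesis .
qed

section \<open>Functions as compactly supported distributions\<close>

lemma compact_distribution_integral:
  assumes f: "Cc f"
  shows "compact_distribution (\<lambda>g. LBINT x. f x * g x)"
proof -
  have Cg: "Cc (\<lambda>x. f x * g x)" if "smooth g" for g
    by (intro Cc_mult_right f smooth_continuous_on that)
  obtain R where R: "R > 0" "\<And>x. norm x > R \<Longrightarrow> f x = 0" using Cc_support[OF f] by metis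
  have bd: "\<bar>LBINT x. f x * g x\<bar> \<le> (LBINT x. \<bar>f x\<bar>) * B"
    if g: "smooth g" and B: "\<And>is x. length is \<le> 0 \<and> x \<in> cball 0 R \<Longrightarrow> \<bar>iter_partial is g x\<bar> \<le> B" for g B
  proof -
    have gB: "\<bar>g x\<bar> \<le> B" if "norm x \<le> R" for x using B[of "[]" x] that by simp
    have "\<bar>LBINT x. f x * g x\<bar> \<le> (LBINT x. \<bar>f x * g x\<bar>)"
      by (rule integral_abs_bound)
    also have "\<dots> \<le> (LBINT x. \<bar>f x\<bar> * B)"
    proof (rule integral_mono)
      show "integrable lborel (\<lambda>x. \<bar>f x * g x\<bar>)" by (intro integrable_abs Cc_integrable Cg g)
      show "integrable lborel (\<lambda>x. \<bar>f x\<bar> * B)" by (intro integrable_mult_left integrable_abs Cc_integrable f)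
      show "\<bar>f x * g x\<bar> \<le> \<bar>f x\<bar> * B" for x
        using gB[of x] R(2)[of x] by (cases "norm x \<le> R") (auto simp: abs_mult mult_left_mono)
    qed
    finally show ?thesis by simp
  qed
  show ?thesis
    unfolding compact_distribution_def
  proof (intro conjI allI impI)
    show "(LBINT x. f x * (g x + h x)) = (LBINT x. f x * g x) + (LBINT x. f x * h x)"
      if "smooth g \<and> smooth h" for g h
      using that by (simp add: distrib_left Bochner_Integration.integral_add Cc_integrable Cg)
    show "(LBINT x. f x * (a * g x)) = a * (LBINT x. f x * g x)" for a g
      by (simp add: mult.left_commute)
    show "\<exists>K C N. compact K \<and> (\<forall>g B. smooth g \<and> (\<forall>is x. length is \<le> N \<and> x \<in> K \<longrightarrow> \<bar>iter_partial is g x\<bar> \<le> B)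
               \<longrightarrow> \<bar>LBINT x. f x * g x\<bar> \<le> C * B)"
      by (rule exI[of _ "cball 0 R"], rule exI[of _ "LBINT x. \<bar>f x\<bar>"], rule exI[of _ 0])
         (intro conjI allI impI bd compact_cball; simp)
  qed
qed

lemma compact_distribution_diff:
  assumes "compact_distribution d" "compact_distribution d'"
  shows "compact_distribution (\<lambda>g. d g - d' g)"
proof -
  note lin = assms[THEN compact_distribution_smooth_linear]
  from assms(1)[unfolded compact_distribution_def, THEN conjunct2, THEN conjunct2]
  obtain K C N where K: "compact K" and bd: "\<forall>g b. smooth g \<and>
      (\<forall>is x. length is \<le> N \<and> x \<in> K \<longrightarrow> \<bar>iter_partial is g x\<bar> \<le> b) \<longrightarrow> \<bar>d g\<bar> \<le> C * b"
    by (elim exE conjE) (rule that)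
  from assms(2)[unfolded compact_distribution_def, THEN conjunct2, THEN conjunct2]
  obtain K' C' N' where K': "compact K'" and bd': "\<forall>g b. smooth g \<and>
      (\<forall>is x. length is \<le> N' \<and> x \<in> K' \<longrightarrow> \<bar>iter_partial is g x\<bar> \<le> b) \<longrightarrow> \<bar>d' g\<bar> \<le> C' * b"
    by (elim exE conjE) (rule that)
  have bd'': "\<bar>d g - d' g\<bar> \<le> (C + C') * b" if "smooth g \<and>
      (\<forall>is x. length is \<le> max N N' \<and> x \<in> K \<union> K' \<longrightarrow> \<bar>iter_partial is g x\<bar> \<le> b)" for g b
  proof -
    have "\<bar>d g\<bar> \<le> C * b" by (rule bd[rule_format]) (use that in auto)
    moreover have "\<bar>d' g\<bar> \<le> C' * b" by (rule bd'[rule_format]) (use that in auto)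
    ultimately show ?thesis by (simp add: distrib_right)
  qed
  show ?thesis
    unfolding compact_distribution_def
  proof (intro conjI allI impI)
    show "d (\<lambda>x. g x + h x) - d' (\<lambda>x. g x + h x) = d g - d' g + (d h - d' h)" if "smooth g \<and> smooth h" for g h
      using that by (simp add: smooth_linearD(1)[OF lin(1)] smooth_linearD(1)[OF lin(2)])
    show "d (\<lambda>x. a * g x) - d' (\<lambda>x. a * g x) = a * (d g - d' g)" if "smooth g" for a g
      using that by (simp add: smooth_linearD(2)[OF lin(1)] smooth_linearD(2)[OF lin(2)] right_diff_distrib)
    show "\<exists>K C N. compact K \<and> (\<forall>g B. smooth g \<and> (\<forall>is x. length is \<le> N \<and> x \<in> K \<longrightarrow> \<bar>iter_partial is g x\<bar> \<le> B)
               \<longrightarrow> \<bar>d g - d' g\<bar> \<le> C * B)"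
      by (rule exI[of _ "K \<union> K'"], rule exI[of _ "C + C'"], rule exI[of _ "max N N'"])
         (intro conjI allI impI compact_Un K K', rule bd'', assumption)
  qed
qed

section \<open>Ridge moments and the ray transform\<close>

text \<open>The ridge moment of \<open>v + s w\<close> is a polynomial in \<open>s\<close>, and its coefficients are the mixed moments
of \<open>v\<close> and \<open>w\<close>. If it has infinitely many zeros, all coefficients vanish.\<close>
lemma ridge_moment_pencil:
  fixes u :: "'a::euclidean_space \<Rightarrow> real"
  assumes u: "Cc u" and S: "infinite S"
    and 0: "\<And>s. s \<in> S \<Longrightarrow> (LBINT x. u x * ((v + s *\<^sub>R w) \<bullet> x) ^ r) = 0"
    and i: "i \<le> r"
  shows "(LBINT x. u x * ((w \<bullet> x) ^ i * (v \<bullet> x) ^ (r - i))) = 0"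
proof -
  define c where "c i = real (r choose i) * (LBINT x. u x * ((w \<bullet> x) ^ i * (v \<bullet> x) ^ (r - i)))" for i
  have C: "Cc (\<lambda>x. u x * ((w \<bullet> x) ^ i * (v \<bullet> x) ^ (r - i)))" for i
    by (intro Cc_mult_right u continuous_intros)
  have exp: "(LBINT x. u x * ((v + s *\<^sub>R w) \<bullet> x) ^ r) = (\<Sum>i\<le>r. c i * s ^ i)" for s
  proof -
    have "u x * ((v + s *\<^sub>R w) \<bullet> x) ^ r
        = (\<Sum>i\<le>r. (real (r choose i) * s ^ i) * (u x * ((w \<bullet> x) ^ i * (v \<bullet> x) ^ (r - i))))" for x
    proof -
      have "((v + s *\<^sub>R w) \<bullet> x) ^ r = (s * (w \<bullet> x) + v \<bullet> x) ^ r" by (simp add: inner_add_left add.commute)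
      also have "\<dots> = (\<Sum>i\<le>r. of_nat (r choose i) * (s * (w \<bullet> x)) ^ i * (v \<bullet> x) ^ (r - i))"
        by (rule binomial_ring)
      finally show ?thesis by (simp add: sum_distrib_left power_mult_distrib mult_ac)
    qed
    then have "(LBINT x. u x * ((v + s *\<^sub>R w) \<bullet> x) ^ r)
        = (\<Sum>i\<le>r. (LBINT x. (real (r choose i) * s ^ i) * (u x * ((w \<bullet> x) ^ i * (v \<bullet> x) ^ (r - i)))))"
      by (simp only: ) (intro Bochner_Integration.integral_sum Cc_integrable Cc_cmult C)
    then show ?thesis by (simp only: integral_mult_right_zero) (simp add: c_def mult_ac)
  qed
  have "S \<subseteq> {s. (\<Sum>i\<le>r. c i * s ^ i) = 0}" using 0 exp by auto
  then have "infinite {s. (\<Sum>i\<le>r. c i * s ^ i) = 0}" using S infinite_super by blast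
  then have "c i = 0" using polyfun_finite_roots[of c r] i by blast
  then show ?thesis using i by (simp add: c_def binomial_eq_0_iff)
qed

text \<open>Polarisation: the linear coefficient in \<open>s\<close> of the ridge moment of \<open>v + s w\<close> splits off one linear
form \<open>w\<close>, so \<open>u\<close> is orthogonal to all products of linear forms.\<close>
lemma Cc_eq_0_if_ridge_moments:
  fixes u :: "real^'n \<Rightarrow> real"
  assumes "Cc u" and "\<And>v n. (LBINT x. u x * (v \<bullet> x) ^ n) = 0"
  shows "u x = 0"
proof (rule Cc_eq_0_if_orthogonal_to_polynomials[OF assms(1)])
  have l: "(LBINT x. u x * lprod ws x) = 0"
    if "Cc u" and "\<And>v n. (LBINT x. u x * (v \<bullet> x) ^ n) = 0" for u :: "real^'n \<Rightarrow> real" and ws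
    using that
  proof (induction ws arbitrary: u)
    case Nil
    then show ?case using Nil(2)[of 0 0] by simp
  next
    case (Cons w ws)
    have "(LBINT x. (u x * (w \<bullet> x)) * (v \<bullet> x) ^ n) = 0" for v n
    proof -
      have "(LBINT x. u x * ((w \<bullet> x) ^ 1 * (v \<bullet> x) ^ (Suc n - 1))) = 0"
        by (rule ridge_moment_pencil[where S = UNIV])
           (auto simp: Cons.prems infinite_UNIV_char_0 simp del: power_Suc)
      then show ?thesis by (simp add: mult.assoc)
    qed
    then have "(LBINT x. (u x * (w \<bullet> x)) * lprod ws x) = 0"
      by (intro Cons.IH Cc_mult_right Cons.prems continuous_intros)
    then show ?case by (simp add: mult.assoc)
  qed
  fix p :: "real^'n \<Rightarrow> real" assume "real_polynomial_function p"
  then obtain ps where ps: "\<forall>x. p x = (\<Sum>(a, ws)\<leftarrow>ps. a * lprod ws x)"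
    using real_polynomial_function_lprod_sum by blast
  have cl: "continuous_on UNIV (lprod ws)" for ws :: "(real^'n) list"
    by (rule smooth_continuous_on[OF smooth_lprod])
  have "Cc (\<lambda>x. u x * (\<Sum>(a, ws)\<leftarrow>ps. a * lprod ws x)) \<and> (LBINT x. u x * (\<Sum>(a, ws)\<leftarrow>ps. a * lprod ws x)) = 0"
  proof (induction ps)
    case Nil
    then show ?case by (simp add: Cc_zero)
  next
    case (Cons q ps)
    obtain a ws where q: "q = (a, ws)" by (cases q)
    have eq: "(\<lambda>x. u x * (\<Sum>(a, ws)\<leftarrow>q # ps. a * lprod ws x))
        = (\<lambda>x. a * (u x * lprod ws x) + u x * (\<Sum>(a, ws)\<leftarrow>ps. a * lprod ws x))"
      by (simp add: q algebra_simps fun_eq_iff)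
    have c: "Cc (\<lambda>x. a * (u x * lprod ws x))" by (intro Cc_cmult Cc_mult_right assms cl)
    show ?case
      unfolding eq
      using Cons.IH c l[OF assms, of ws] Cc_integrable[OF c] Cc_integrable[OF conjunct1[OF Cons.IH]]
      by (simp add: Cc_add)
  qed
  then show "(LBINT x. u x * p x) = 0" using ps by simp
qed

text \<open>If the ray transform of \<open>u\<close> in direction \<open>a\<^sub>k\<close> vanishes, then so do the ridge moments of all
\<open>v\<close> orthogonal to \<open>a\<^sub>k\<close>. A line \<open>v + s w\<close> of such vectors meets the orthogonal complement of
\<open>a\<^sub>k\<close> at \<open>s = - v \<bullet> a\<^sub>k\<close>. When these parameters are infinitely many, the ridge moments, which are
polynomials in \<open>s\<close>, vanish on the whole line. A second line, in direction \<open>b\<close>, passes from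
general \<open>v\<close> to all \<open>v\<close>. The side condition \<open>v \<bullet> a 0 \<noteq> 0\<close> removes a single parameter only.\<close>
lemma ray_transform_injective:
  fixes u :: "real^'n \<Rightarrow> real" and a :: "nat \<Rightarrow> real^'n"
  assumes u: "Cc u"
    and van: "\<And>k v r. v \<bullet> a k = 0 \<Longrightarrow> v \<bullet> a 0 \<noteq> 0 \<Longrightarrow> (LBINT x. u x * (v \<bullet> x) ^ r) = 0"
    and w: "\<And>k. w \<bullet> a k = 1"
    and b: "b \<noteq> 0" and inf: "\<And>v. v \<bullet> b \<noteq> 0 \<Longrightarrow> infinite (range (\<lambda>k. v \<bullet> a k))"
  shows "u x = 0"
proof (rule Cc_eq_0_if_ridge_moments[OF u])
  have gen: "(LBINT x. u x * (v \<bullet> x) ^ r) = 0" if vb: "v \<bullet> b \<noteq> 0" for v r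
  proof -
    let ?S = "uminus ` range (\<lambda>k. v \<bullet> a k) - {- (v \<bullet> a 0)}"
    have "infinite (uminus ` range (\<lambda>k. v \<bullet> a k))"
      using inf[OF vb] finite_imageD[of uminus "range (\<lambda>k. v \<bullet> a k)"] by (auto simp: inj_on_def)
    then have S: "infinite ?S" by simp
    have "(LBINT x. u x * ((v + s *\<^sub>R w) \<bullet> x) ^ r) = 0" if "s \<in> ?S" for s
    proof -
      obtain k where k: "s = - (v \<bullet> a k)" using \<open>s \<in> ?S\<close> by blast
      show ?thesis
        by (rule van[of _ k]) (use that k w in \<open>auto simp: inner_add_left inner_diff_left\<close>)
    qed
    from ridge_moment_pencil[OF u S this, of 0] show ?thesis by simp
  qed
  fix v :: "real^'n" and n
  have "infinite (UNIV - {- (v \<bullet> b) / (b \<bullet> b)})" using infinite_UNIV_char_0[where 'a = real] by simp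
  moreover have "(LBINT x. u x * ((v + s *\<^sub>R b) \<bullet> x) ^ n) = 0"
    if "s \<in> UNIV - {- (v \<bullet> b) / (b \<bullet> b)}" for s
  proof (rule gen)
    show "(v + s *\<^sub>R b) \<bullet> b \<noteq> 0" using that b by (auto simp: inner_add_left field_simps)
  qed
  ultimately show "(LBINT x. u x * (v \<bullet> x) ^ n) = 0"
    using ridge_moment_pencil[OF u, where S = "UNIV - {- (v \<bullet> b) / (b \<bullet> b)}" and i = 0 and r = n and v = v and w = b]
    by simp
qed

section \<open>Jordan chains\<close>

lemma filterlim_at_top_if_increments:
  fixes y :: "nat \<Rightarrow> real"
  assumes d: "\<delta> > 0" and inc: "\<And>k. k \<ge> K \<Longrightarrow> y (Suc k) - y k \<ge> \<delta>"
  shows "filterlim y at_top sequentially"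
proof -
  have "y (n + K) \<ge> y K + real n * \<delta>" for n
  proof (induction n)
    case (Suc n)
    then show ?case using inc[of "n + K"] by (simp add: algebra_simps)
  qed simp
  moreover have "filterlim (\<lambda>n. y K + real n * \<delta>) at_top sequentially"
    by (rule filterlim_tendsto_add_at_top[OF tendsto_const
        filterlim_at_top_mult_tendsto_pos[OF tendsto_const d filterlim_real_sequentially]])
  ultimately have "filterlim (\<lambda>n. y (n + K)) at_top sequentially"
    by (rule filterlim_at_top_mono[rotated, OF always_eventually[OF allI]])
  then show ?thesis
    unfolding filterlim_at_top using eventually_sequentially_seg[of "\<lambda>n. Z \<le> y n" K for Z] by simp
qed

lemma infinite_range_if_at_top:
  fixes y :: "nat \<Rightarrow> real"
  assumes "filterlim (\<lambda>k. \<sigma> * y k) at_top sequentially"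
  shows "infinite (range y)"
proof
  assume "finite (range y)"
  then have fin: "finite (range (\<lambda>k. \<sigma> * y k))"
    using finite_imageI[of "range y" "\<lambda>t. \<sigma> * t"] by (simp add: image_image)
  have "eventually (\<lambda>k. \<sigma> * y k \<ge> Max (range (\<lambda>k. \<sigma> * y k)) + 1) sequentially"
    using assms by (simp add: filterlim_at_top)
  then obtain k where "\<sigma> * y k \<ge> Max (range (\<lambda>k. \<sigma> * y k)) + 1"
    using eventually_happens'[OF sequentially_bot] by blast
  moreover have "\<sigma> * y k \<le> Max (range (\<lambda>k. \<sigma> * y k))" by (rule Max_ge[OF fin]) auto
  ultimately show False by simp
qed

definition jordan_chain :: "real^'n^'n \<Rightarrow> real \<Rightarrow> nat \<Rightarrow> (nat \<Rightarrow> real^'n) \<Rightarrow> bool" where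
  "jordan_chain A ev l e \<longleftrightarrow> A *v e 1 = ev *\<^sub>R e 1 \<and>
     (\<forall>i\<in>{2..l}. A *v e i = ev *\<^sub>R e i + e (i - 1)) \<and>
     inj_on e {1..l} \<and> independent (e ` {1..l})"

text \<open>On a Jordan chain for \<open>A\<close> and \<open>ev\<close> the operator \<open>ev A\<^sup>-\<^sup>1\<close> is unipotent: it fixes the first
vector and changes each other vector only by a combination of its predecessors.\<close>
definition scaled_inv :: "real^'n^'n \<Rightarrow> real \<Rightarrow> real^'n \<Rightarrow> real^'n" where
  "scaled_inv A ev y = ev *\<^sub>R (matrix_inv A *v y)"

lemma linear_scaled_inv_power: "linear (scaled_inv A ev ^^ k)"
proof (induction k)
  case (Suc k)
  have "linear (scaled_inv A ev)"
    unfolding scaled_inv_def[abs_def] by (intro linear_compose_scale_right) simp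
  from linear_compose[OF Suc this] show ?case by (simp add: o_def)
qed (simp add: linear_iff)

lemma scaled_inv_chain:
  assumes ch: "jordan_chain A ev l e" and inv: "invertible A" and ev: "ev \<noteq> 0"
  shows "scaled_inv A ev (e 1) = e 1"
    and "\<And>i. 2 \<le> i \<Longrightarrow> i \<le> l \<Longrightarrow>
      (scaled_inv A ev ^^ Suc k) (e i) = (scaled_inv A ev ^^ k) (e i) - inverse ev *\<^sub>R (scaled_inv A ev ^^ Suc k) (e (i - 1))"
proof -
  have mi: "matrix_inv A *v (A *v y) = y" for y
    by (simp add: matrix_vector_mul_assoc matrix_inv_mult[OF inv])
  show "scaled_inv A ev (e 1) = e 1"
    using mi[of "e 1"] ch by (simp add: jordan_chain_def scaled_inv_def matrix_vector_mult_scaleR)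
  fix i assume i: "2 \<le> i" "i \<le> l"
  have "scaled_inv A ev (e i) = e i - inverse ev *\<^sub>R scaled_inv A ev (e (i - 1))"
  proof -
    have "A *v e i = ev *\<^sub>R e i + e (i - 1)" using ch i by (simp add: jordan_chain_def)
    then have "e i = scaled_inv A ev (e i) + matrix_inv A *v e (i - 1)"
      using mi[of "e i"] by (simp add: scaled_inv_def matrix_vector_mult_scaleR matrix_vector_right_distrib)
    moreover have "inverse ev *\<^sub>R scaled_inv A ev (e (i - 1)) = matrix_inv A *v e (i - 1)"
      using ev by (simp add: scaled_inv_def)
    ultimately show ?thesis by (simp add: eq_diff_eq)
  qed
  then have "(scaled_inv A ev ^^ Suc k) (e i)
      = (scaled_inv A ev ^^ k) (e i - inverse ev *\<^sub>R scaled_inv A ev (e (i - 1)))"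
    by (simp add: funpow_swap1)
  also have "\<dots> = (scaled_inv A ev ^^ k) (e i) - inverse ev *\<^sub>R (scaled_inv A ev ^^ Suc k) (e (i - 1))"
    by (simp add: linear_diff[OF linear_scaled_inv_power] linear_cmul[OF linear_scaled_inv_power] funpow_swap1)
  finally show "(scaled_inv A ev ^^ Suc k) (e i) = (scaled_inv A ev ^^ k) (e i) - inverse ev *\<^sub>R (scaled_inv A ev ^^ Suc k) (e (i - 1))" .
qed

lemma scaled_inv_power_chain_start:
  assumes "jordan_chain A ev l e" "invertible A" "ev \<noteq> 0"
  shows "(scaled_inv A ev ^^ k) (e 1) = e 1"
proof (induction k)
  case (Suc k)
  then show ?case using scaled_inv_chain(1)[OF assms] by (simp only: funpow.simps o_apply)
qed (simp only: funpow_0)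

text \<open>The sequence \<open>v \<bullet> N\<^sup>k e\<^sub>1\<close> is a nonzero constant, where \<open>N = ev A\<^sup>-\<^sup>1\<close>. The increments of
\<open>v \<bullet> N\<^sup>k e\<^sub>i\<^sub>+\<^sub>1\<close> are a fixed multiple of \<open>v \<bullet> N\<^sup>k\<^sup>+\<^sup>1 e\<^sub>i\<close>, so up to sign they stay above a
positive bound, and the sequence diverges. Hence \<open>v\<close> has infinitely many different inner products
with the vectors \<open>N\<^sup>k e\<^sub>i\<close> if \<open>i \<ge> 2\<close>.\<close>
lemma scaled_inv_chain_eventually:
  assumes ch: "jordan_chain A ev l e" and inv: "invertible A" and ev: "ev \<noteq> 0"
    and v: "v \<bullet> e 1 \<noteq> 0" and i: "Suc 0 \<le> i" "i \<le> l"
  shows "\<exists>\<sigma> \<delta>. \<sigma> \<in> {1, -1::real} \<and> \<delta> > 0 \<and> (\<exists>K. \<forall>k\<ge>K. \<sigma> * (v \<bullet> (scaled_inv A ev ^^ k) (e i)) \<ge> \<delta>) \<and>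
    (i \<ge> 2 \<longrightarrow> filterlim (\<lambda>k. \<sigma> * (v \<bullet> (scaled_inv A ev ^^ k) (e i))) at_top sequentially)"
  using i
proof (induction i rule: dec_induct)
  case base
  have "sgn (v \<bullet> e 1) \<in> {1, -1}" "\<bar>v \<bullet> e 1\<bar> > 0" using v by (auto simp: sgn_if)
  moreover have "\<forall>k\<ge>0. \<bar>v \<bullet> e 1\<bar> \<le> sgn (v \<bullet> e 1) * (v \<bullet> (scaled_inv A ev ^^ k) (e (Suc 0)))"
    using scaled_inv_power_chain_start[OF ch inv ev] by (simp add: sgn_if)
  ultimately show ?case
    by (intro exI[of _ "sgn (v \<bullet> e 1)"] exI[of _ "\<bar>v \<bullet> e 1\<bar>"] exI[of _ 0] conjI) simp_all
next
  case (step i)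
  from step.IH[OF Suc_leD[OF step.prems]]
  obtain \<sigma> \<delta> K where *: "\<sigma> \<in> {1, -1}" "\<delta> > 0" and K: "\<forall>k\<ge>K. \<sigma> * (v \<bullet> (scaled_inv A ev ^^ k) (e i)) \<ge> \<delta>"
    by (elim exE conjE)
  \<comment> \<open>the increments are the previous sequence times \<open>- 1 / ev\<close>, which determines the sign\<close>
  let ?\<sigma> = "- \<sigma> * sgn ev"
  have s: "?\<sigma> \<in> {1, -1}" using *(1) ev by (auto simp: sgn_if)
  have "filterlim (\<lambda>k. ?\<sigma> * (v \<bullet> (scaled_inv A ev ^^ k) (e (Suc i)))) at_top sequentially"
  proof (rule filterlim_at_top_if_increments)
    show "\<delta> / \<bar>ev\<bar> > 0" using * ev by simp
    fix k assume k: "k \<ge> K"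
    have "2 \<le> Suc i" "Suc i \<le> l" using step by auto
    from scaled_inv_chain(2)[OF ch inv ev this, of k]
    have "v \<bullet> (scaled_inv A ev ^^ Suc k) (e (Suc i)) = v \<bullet> (scaled_inv A ev ^^ k) (e (Suc i))
        - inverse ev * (v \<bullet> (scaled_inv A ev ^^ Suc k) (e i))"
      by (simp only: diff_Suc_1 inner_diff_right inner_scaleR_right)
    then have "?\<sigma> * (v \<bullet> (scaled_inv A ev ^^ Suc k) (e (Suc i))) - ?\<sigma> * (v \<bullet> (scaled_inv A ev ^^ k) (e (Suc i)))
       = (sgn ev * inverse ev) * (\<sigma> * (v \<bullet> (scaled_inv A ev ^^ Suc k) (e i)))"
      by (simp only:) (simp add: algebra_simps del: funpow.simps)
    also have "sgn ev * inverse ev = 1 / \<bar>ev\<bar>" using ev by (simp add: sgn_if field_simps)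
    also have "\<delta> / \<bar>ev\<bar> \<le> 1 / \<bar>ev\<bar> * (\<sigma> * (v \<bullet> (scaled_inv A ev ^^ Suc k) (e i)))"
      using K[rule_format, of "Suc k"] k by (simp add: divide_right_mono del: funpow.simps)
    finally show "\<delta> / \<bar>ev\<bar> \<le> ?\<sigma> * (v \<bullet> (scaled_inv A ev ^^ Suc k) (e (Suc i))) - ?\<sigma> * (v \<bullet> (scaled_inv A ev ^^ k) (e (Suc i)))" .
  qed
  note lim = this
  then have "eventually (\<lambda>k. 1 \<le> ?\<sigma> * (v \<bullet> (scaled_inv A ev ^^ k) (e (Suc i)))) sequentially"
    unfolding filterlim_at_top by (rule spec)
  then have ex: "\<exists>K. \<forall>k\<ge>K. 1 \<le> ?\<sigma> * (v \<bullet> (scaled_inv A ev ^^ k) (e (Suc i)))"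
    by (simp only: eventually_sequentially)
  show ?case
    by (rule exI[of _ ?\<sigma>], rule exI[of _ 1], intro conjI impI s ex lim zero_less_one)
qed

text \<open>A vector that is orthogonal to the other members of the chain and has inner product 1 with \<open>e i\<close>
does not see the change that \<open>ev A\<^sup>-\<^sup>1\<close> makes to \<open>e i\<close>.\<close>
lemma jordan_chain_dual_vector:
  assumes ch: "jordan_chain A ev l e" and inv: "invertible A" and ev: "ev \<noteq> 0" and i: "1 \<le> i" "i \<le> l"
  obtains w where "\<And>k. w \<bullet> (scaled_inv A ev ^^ k) (e i) = 1"
proof -
  have inj: "inj_on e {1..l}" and ind: "independent (e ` {1..l})" using ch by (auto simp: jordan_chain_def)
  obtain g :: "real^'a \<Rightarrow> real" where g: "linear g" "\<And>x. x \<in> e ` {1..l} \<Longrightarrow> g x = (if x = e i then 1 else 0)"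
    using linear_independent_extend[OF ind, of "\<lambda>x. if x = e i then 1 else 0"] by blast
  define w where "w = adjoint g 1"
  have w: "w \<bullet> e j = (if j = i then 1 else 0)" if "j \<in> {1..l}" for j
  proof -
    have "w \<bullet> e j = g (e j)" using adjoint_works[OF g(1), of "e j" 1] by (simp add: w_def inner_commute)
    also have "\<dots> = (if j = i then 1 else 0)" using g(2)[of "e j"] that i inj by (auto simp: inj_on_eq_iff)
    finally show ?thesis .
  qed
  have low: "w \<bullet> (scaled_inv A ev ^^ k) (e j) = 0" if "Suc 0 \<le> j" "j < i" for j k
    using that
  proof (induction j arbitrary: k rule: dec_induct)
    case base
    show ?case
      using w[of 1] base i scaled_inv_power_chain_start[OF ch inv ev, of k] by simp
  next
    case (step j)
    then have IH: "w \<bullet> (scaled_inv A ev ^^ k) (e j) = 0" for k by simp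
    show ?case
    proof (induction k)
      case 0
      then show ?case using w[of "Suc j"] step i by simp
    next
      case (Suc k)
      then show ?case
        using scaled_inv_chain(2)[OF ch inv ev, of "Suc j" k] step i IH[of "Suc k"]
        by (simp only: diff_Suc_1 inner_diff_right inner_scaleR_right)
    qed
  qed
  have "w \<bullet> (scaled_inv A ev ^^ k) (e i) = 1" for k
  proof (induction k)
    case 0
    then show ?case using w[of i] i by simp
  next
    case (Suc k)
    show ?case
    proof (cases "i = 1")
      case True
      then show ?thesis
        using w[of i] i scaled_inv_power_chain_start[OF ch inv ev, of "Suc k"] by (simp del: funpow.simps)
    next
      case False
      then show ?thesis
        using scaled_inv_chain(2)[OF ch inv ev, of i k] low[of "i - 1" "Suc k"] Suc i
        by (simp only: inner_diff_right inner_scaleR_right)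
    qed
  qed
  then show ?thesis using that by blast
qed

section \<open>The system of a Jordan block\<close>

text \<open>This recursion of first order characterises the sums in the system of a block, which makes it
possible to compare them with the values of the transition operator.\<close>
lemma alternating_sum_Suc:
  fixes p :: "nat \<Rightarrow> real"
  assumes "ev \<noteq> 0" "i \<ge> 1"
  shows "(\<Sum>j=1..Suc i - 1. (-1)^(j-1) * ev powi (- int j) * p (Suc i - j))
    = inverse ev * (p i - (\<Sum>j=1..i-1. (-1)^(j-1) * ev powi (- int j) * p (i - j)))"
proof -
  let ?f = "\<lambda>j. (-1)^(j-1) * ev powi (- int j) * p (Suc i - j)"
  have pw: "ev powi (- int k) = inverse ev ^ k" for k
    by (simp add: power_int_minus power_inverse)
  have "(\<Sum>j=1..Suc i - 1. ?f j) = (\<Sum>j=1..i. ?f j)" by simp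
  also have "\<dots> = ?f 1 + (\<Sum>j=Suc 1..i. ?f j)" by (rule sum.atLeast_Suc_atMost) (use assms in simp)
  also have "(\<Sum>j=Suc 1..i. ?f j) = (\<Sum>j=Suc 1..Suc (i - 1). ?f j)" using assms(2) by simp
  also have "\<dots> = (\<Sum>j=1..i-1. ?f (Suc j))" by (rule sum.shift_bounds_cl_Suc_ivl)
  also have "\<dots> = (\<Sum>j=1..i-1. - inverse ev * ((-1)^(j-1) * ev powi (- int j) * p (i - j)))"
  proof (rule sum.cong)
    fix j assume "j \<in> {1..i-1}"
    then obtain j' where j: "j = Suc j'" by (cases j) auto
    show "?f (Suc j) = - inverse ev * ((-1)^(j-1) * ev powi (- int j) * p (i - j))"
      unfolding pw by (simp add: j)
  qed simp
  also have "\<dots> = - inverse ev * (\<Sum>j=1..i-1. (-1)^(j-1) * ev powi (- int j) * p (i - j))"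
    by (rule sum_distrib_left[symmetric])
  finally show ?thesis using assms by (simp add: power_int_minus algebra_simps)
qed

text \<open>Here \<open>p i\<close> and \<open>t i\<close> are the values of \<open>\<psi>\<^sub>i\<close> and \<open>T \<psi>\<^sub>i\<close> at a point. In either form of the
system the sum in the \<open>i\<close>-th equation equals \<open>t (i - 1)\<close>, since both satisfy the same recursion.\<close>
lemma block_system_iff:
  fixes p t :: "nat \<Rightarrow> real"
  assumes ev: "ev \<noteq> 0" and 1: "p 1 = ev * t 1"
  shows "(\<forall>i\<in>{2..l}. p i = ev * t i + (\<Sum>j=1..i-1. (-1)^(j-1) * ev powi (- int j) * p (i - j)))
    \<longleftrightarrow> (\<forall>i\<in>{2..l}. p i = ev * t i + t (i - 1))" (is "?L \<longleftrightarrow> ?R")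
proof -
  let ?S = "\<lambda>i. (\<Sum>j=1..i-1. (-1)^(j-1) * ev powi (- int j) * p (i - j))"
  have S2: "?S 2 = t 1"
    using alternating_sum_Suc[OF ev, of 1 p] 1 ev by (simp add: numeral_2_eq_2)
  have "?S i = t (i - 1)" if "?L \<or> ?R" "i \<in> {2..l}" for i
  proof -
    have "2 \<le> i" "i \<le> l" using that(2) by auto
    then show ?thesis
    proof (induction i rule: dec_induct)
      case base
      then show ?case using S2 by simp
    next
      case (step i)
      then have IH: "?S i = t (i - 1)" by simp
      have "p i = ev * t i + t (i - 1)" using that(1) step IH by auto
      then show ?case using alternating_sum_Suc[OF ev, of i p] step IH ev by simp
    qed
  qed
  then show ?thesis by (metis (no_types, lifting))
qed

section \<open>Rigidity along a Jordan chain\<close>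

lemma gradient_inner_eqI:
  assumes "(f has_derivative D) (at x)"
  shows "gradient f x \<bullet> h = D h"
proof -
  have "f differentiable (at x)" using assms by (auto simp: differentiable_def)
  then show ?thesis
    using frechet_derivative_eq_gradient[of f x h] frechet_derivative_at[OF assms] by simp
qed

lemma has_dd_smooth:
  assumes "smooth g"
  shows "has_dd g a (\<lambda>x. gradient g x \<bullet> a)"
  unfolding has_dd_def using DERIV_along_axis[OF assms, of _ a 0] by simp

lemma continuous_on_gradient_inner:
  assumes "smooth g"
  shows "continuous_on A (\<lambda>x. gradient g x \<bullet> a)"
  unfolding inner_vec_def inner_real_def
  by (intro continuous_on_sum continuous_on_mult continuous_on_const smooth_continuous_on smooth_partial assms)

lemma gradient_affine_inner:
  fixes B :: "real^'n^'n"
  assumes "smooth g"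
  shows "gradient (\<lambda>y. g (B *v y + t)) y \<bullet> a = gradient g (B *v y + t) \<bullet> (B *v a)"
proof (rule gradient_inner_eqI)
  have "((\<lambda>x. B *v x + t) has_derivative (\<lambda>h. B *v h)) (at y)"
    by (auto intro!: derivative_eq_intros bounded_linear.has_derivative[of "(*v) B"])
  from diff_chain_at[OF this has_derivative_gradient[OF smooth_differentiable[OF assms]]]
  show "((\<lambda>y. g (B *v y + t)) has_derivative (\<lambda>a. gradient g (B *v y + t) \<bullet> (B *v a))) (at y)"
    by (simp add: o_def)
qed

lemma smooth_ridge: "smooth (\<lambda>x. (v \<bullet> x) ^ n)"
  by (intro smooth_real_polynomial_function real_polynomial_function_power
      real_polynomial_function.intros(1) bounded_linear_inner_right)

lemma gradient_ridge: "gradient (\<lambda>x. (v \<bullet> x) ^ Suc r) x \<bullet> a = real (Suc r) * (v \<bullet> x) ^ r * (v \<bullet> a)"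
proof -
  have "((\<lambda>x. (v \<bullet> x) ^ Suc r) has_derivative (\<lambda>y. of_nat (Suc r) * (v \<bullet> y) * (v \<bullet> x) ^ (Suc r - 1))) (at x)"
    by (intro has_derivative_power bounded_linear_imp_has_derivative bounded_linear_inner_right)
  from gradient_inner_eqI[OF this] show ?thesis by (simp del: power_Suc add: mult_ac)
qed

text \<open>For the function \<open>u = h - f\<close>: the derivative of \<open>h\<close> along \<open>e'\<close> is \<open>\<psi>\<close>, the derivative of \<open>T h\<close>
along \<open>M\<^sup>-\<^sup>1 e'\<close> is \<open>T \<psi>\<close>, and the derivative of \<open>f = T f\<close> along
\<open>M\<^sup>-\<^sup>1 e0 = e' - ev M\<^sup>-\<^sup>1 e'\<close> is \<open>T \<psi>0\<close>. Inserting this into the equation for \<open>\<psi>\<close> leaves the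
claim. It is stated weakly because \<open>f\<close> need not be differentiable along \<open>e'\<close>.\<close>
lemma transition_weak_derivative:
  fixes M :: "int^'n^'n"
  assumes inv: "invertible (rmat M)" and Ae: "rmat M *v e' = ev *\<^sub>R e' + e0"
    and f: "Cc f" and Tf: "transition M c f = f" and h: "Cc h" and \<psi>: "Cc \<psi>" and \<psi>0: "Cc \<psi>0"
    and hdd: "has_dd h e' \<psi>" and fdd: "has_dd f e0 \<psi>0"
    and sys: "\<And>x. \<psi> x = ev * transition M c \<psi> x + transition M c \<psi>0 x" and g: "smooth g"
  shows "(LBINT x. (h x - f x) * (gradient g x \<bullet> e'))
    = ev * (LBINT x. transition M c (\<lambda>x. h x - f x) x * (gradient g x \<bullet> (matrix_inv (rmat M) *v e')))"
proof -
  let ?T = "transition M c" and ?b = "matrix_inv (rmat M) *v e'" and ?w = "matrix_inv (rmat M) *v e0"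
  have Ab: "rmat M *v ?b = e'" "rmat M *v ?w = e0" and iA: "matrix_inv (rmat M) *v (rmat M *v e') = e'"
    by (simp_all add: matrix_vector_mul_assoc matrix_inv_mult[OF inv])
  have b0: "?w = e' - ev *\<^sub>R ?b"
  proof -
    have "e' = ev *\<^sub>R ?b + ?w"
      using iA unfolding Ae matrix_vector_right_distrib matrix_vector_mult_scaleR by (rule sym)
    then show ?thesis by (metis add_diff_cancel_left')
  qed
  have cg: "continuous_on UNIV g" by (rule smooth_continuous_on[OF g])
  note cG = continuous_on_gradient_inner[OF g, of UNIV]
  note ibp = integration_by_parts_directional[OF _ _ _ cg cG has_dd_smooth[OF g]]
  have ci: "integrable lborel (\<lambda>x. F x * (gradient g x \<bullet> a))" if "Cc F" for F a
    by (intro Cc_integrable Cc_mult_right cG that)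
  have cg': "integrable lborel (\<lambda>x. F x * g x)" if "Cc F" for F
    by (intro Cc_integrable Cc_mult_right cg that)
  note CT = Cc_transition[OF inv]
  have i1: "(LBINT x. \<psi> x * g x) = - (LBINT x. h x * (gradient g x \<bullet> e'))"
    by (rule ibp[OF h \<psi> hdd])
  have i2: "(LBINT x. ?T \<psi> x * g x) = - (LBINT x. ?T h x * (gradient g x \<bullet> ?b))"
    by (rule ibp[OF CT[OF h] CT[OF \<psi>] has_dd_transition]) (simp add: Ab hdd)
  have "(LBINT x. ?T \<psi>0 x * g x) = - (LBINT x. ?T f x * (gradient g x \<bullet> ?w))"
    by (rule ibp[OF CT[OF f] CT[OF \<psi>0] has_dd_transition]) (simp add: Ab fdd)
  also have "(LBINT x. ?T f x * (gradient g x \<bullet> ?w))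
      = (LBINT x. f x * (gradient g x \<bullet> e') - ev * (f x * (gradient g x \<bullet> ?b)))"
    unfolding Tf b0 by (rule Bochner_Integration.integral_cong) (auto simp: inner_diff_right algebra_simps)
  also have "\<dots> = (LBINT x. f x * (gradient g x \<bullet> e')) - ev * (LBINT x. f x * (gradient g x \<bullet> ?b))"
    by (subst Bochner_Integration.integral_diff) (auto intro!: ci f integrable_mult_right)
  finally have i3: "(LBINT x. ?T \<psi>0 x * g x)
      = - ((LBINT x. f x * (gradient g x \<bullet> e')) - ev * (LBINT x. f x * (gradient g x \<bullet> ?b)))" .
  have "(LBINT x. \<psi> x * g x) = (LBINT x. ev * (?T \<psi> x * g x) + ?T \<psi>0 x * g x)"
    by (subst sys) (simp add: algebra_simps)
  also have "\<dots> = ev * (LBINT x. ?T \<psi> x * g x) + (LBINT x. ?T \<psi>0 x * g x)"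
    by (subst Bochner_Integration.integral_add) (auto intro!: cg' CT \<psi> \<psi>0 integrable_mult_right)
  finally have i4: "(LBINT x. \<psi> x * g x) = ev * (LBINT x. ?T \<psi> x * g x) + (LBINT x. ?T \<psi>0 x * g x)" .
  have l: "(LBINT x. (h x - f x) * (gradient g x \<bullet> e'))
      = (LBINT x. h x * (gradient g x \<bullet> e')) - (LBINT x. f x * (gradient g x \<bullet> e'))"
    unfolding left_diff_distrib by (rule Bochner_Integration.integral_diff[OF ci[OF h] ci[OF f]])
  have "transition M c (\<lambda>x. h x - f x) = (\<lambda>x. ?T h x - f x)"
    by (simp add: transition_diff Tf)
  then have r: "(LBINT x. transition M c (\<lambda>x. h x - f x) x * (gradient g x \<bullet> ?b))
      = (LBINT x. ?T h x * (gradient g x \<bullet> ?b)) - (LBINT x. f x * (gradient g x \<bullet> ?b))"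
    unfolding left_diff_distrib
    by (simp add: left_diff_distrib Bochner_Integration.integral_diff[OF ci[OF CT[OF h]] ci[OF f]])
  show ?thesis unfolding l r using i1 i2 i3 i4 by (simp add: algebra_simps)
qed

text \<open>In the relation \<open>step\<close> the operator on the right can be moved to the test function, which is
thereby composed with \<open>y \<mapsto> M\<^sup>-\<^sup>1 (y + \<kappa>)\<close>. If \<open>g\<close> is constant along \<open>M\<^sup>-\<^sup>k\<^sup>-\<^sup>1 e'\<close>, the composed
function is constant along \<open>M\<^sup>-\<^sup>k e'\<close>, which allows induction on \<open>k\<close>. For \<open>k = 0\<close> the integrand
vanishes.\<close>
lemma weak_derivative_vanishes:
  fixes M :: "int^'n^'n"
  assumes inv: "invertible (rmat M)" and ev: "ev \<noteq> 0" and u: "Cc u"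
    and step: "\<And>g. smooth g \<Longrightarrow> (LBINT x. u x * (gradient g x \<bullet> e'))
      = ev * (LBINT x. transition M c u x * (gradient g x \<bullet> (matrix_inv (rmat M) *v e')))"
    and "smooth g" and "\<And>x. gradient g x \<bullet> (scaled_inv (rmat M) ev ^^ k) e' = 0"
  shows "(LBINT x. u x * (gradient g x \<bullet> e')) = 0"
  using assms(5,6)
proof (induction k arbitrary: g)
  case 0
  then show ?case by simp
next
  case (Suc k)
  let ?B = "matrix_inv (rmat M)"
  have "(LBINT x. transition M c u x * (gradient g x \<bullet> (?B *v e')))
    = (\<Sum>k | c k \<noteq> 0. c k * (LBINT y. u y * (gradient g (?B *v (y + rvec k)) \<bullet> (?B *v e'))) / \<bar>det (rmat M)\<bar>)"
    by (rule integral_transition[OF inv u continuous_on_gradient_inner[OF Suc.prems(1)]])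
  also have "\<dots> = (\<Sum>k | c k \<noteq> 0. 0)"
  proof (rule sum.cong)
    fix \<kappa> assume "\<kappa> \<in> {k. c k \<noteq> 0}"
    let ?g = "\<lambda>y. g (?B *v y + ?B *v rvec \<kappa>)"
    have "(LBINT y. u y * (gradient ?g y \<bullet> e')) = 0"
    proof (rule Suc.IH[OF smooth_affine[OF Suc.prems(1)]])
      fix x
      have "ev * (gradient g (?B *v x + ?B *v rvec \<kappa>) \<bullet> (?B *v (scaled_inv (rmat M) ev ^^ k) e')) = 0"
        using Suc.prems(2)[of "?B *v x + ?B *v rvec \<kappa>"]
        by (simp add: scaled_inv_def[of _ _ "(scaled_inv (rmat M) ev ^^ k) e'"])
      then show "gradient ?g x \<bullet> (scaled_inv (rmat M) ev ^^ k) e' = 0"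
        unfolding gradient_affine_inner[OF Suc.prems(1)] using ev by simp
    qed
    then show "c \<kappa> * (LBINT y. u y * (gradient g (?B *v (y + rvec \<kappa>)) \<bullet> (?B *v e'))) / \<bar>det (rmat M)\<bar> = 0"
      unfolding gradient_affine_inner[OF Suc.prems(1)] by (simp add: matrix_vector_right_distrib)
  qed simp
  finally show ?case using step[OF Suc.prems(1)] by simp
qed

lemma cont_mean_zero_Cc: "f \<in> cont_mean_zero a \<Longrightarrow> Cc f"
  by (simp add: cont_mean_zero_def Cc_iff)

lemma jordan_chain_nonzero: "jordan_chain A ev l e \<Longrightarrow> i \<in> {1..l} \<Longrightarrow> e i \<noteq> 0"
  unfolding jordan_chain_def using dependent_zero by (metis imageI)

text \<open>Induction along the chain. Ridge functions \<open>(v \<bullet> x)\<^sup>r\<^sup>+\<^sup>1\<close> with \<open>v\<close> orthogonal to \<open>N\<^sup>k e\<^sub>i\<close> are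
constant along that direction, so the weak relation for \<open>u\<close> shows that the ridge moments of \<open>u\<close>
vanish for such \<open>v\<close>, and the injectivity of the ray transform gives \<open>u = 0\<close>.\<close>
lemma chain_derivatives:
  fixes M :: "int^'n^'n"
  assumes ch: "jordan_chain (rmat M) ev l e" and inv: "invertible (rmat M)" and ev: "ev \<noteq> 0"
    and f: "Cc f" and Tf: "transition M c f = f"
    and mz: "\<And>i. i \<in> {1..l} \<Longrightarrow> \<psi> i \<in> cont_mean_zero (e i)"
    and sys: "\<And>i x. i \<in> {2..l} \<Longrightarrow> \<psi> i x = ev * transition M c (\<psi> i) x + transition M c (\<psi> (i - 1)) x"
    and base: "has_dd f (e 1) (\<psi> 1)" and i: "1 \<le> i" "i \<le> l"
  shows "has_dd f (e i) (\<psi> i)"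
  using i
proof (induction i rule: dec_induct)
  case base
  show ?case by (rule assms)
next
  case (step j)
  let ?i = "Suc j"
  have i: "?i \<in> {2..l}" "?i \<in> {1..l}" "j \<in> {1..l}" using step by auto
  have IH: "has_dd f (e j) (\<psi> j)" using step by simp
  have "Cc (\<psi> ?i)" "Cc (\<psi> j)" using mz i cont_mean_zero_Cc by blast+
  moreover have "\<And>b. (LBINT t. \<psi> ?i (t *\<^sub>R e ?i + b)) = 0"
    using mz[OF i(2)] by (simp add: cont_mean_zero_def)
  ultimately obtain h where h: "Cc h" "has_dd h (e ?i) (\<psi> ?i)"
    using antiderivative_along jordan_chain_nonzero[OF ch i(2)] by blast
  define u where "u x = h x - f x" for x
  have u: "Cc u" unfolding u_def[abs_def] by (intro Cc_diff h f)
  have Ae: "rmat M *v e ?i = ev *\<^sub>R e ?i + e j" using ch i(1) by (simp add: jordan_chain_def)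
  have sys': "\<psi> ?i x = ev * transition M c (\<psi> ?i) x + transition M c (\<psi> j) x" for x
    using sys[OF i(1)] by simp
  have wk: "(LBINT x. u x * (gradient g x \<bullet> e ?i))
      = ev * (LBINT x. transition M c u x * (gradient g x \<bullet> (matrix_inv (rmat M) *v e ?i)))"
    if "smooth g" for g
    using transition_weak_derivative[OF inv Ae f Tf h(1) \<open>Cc (\<psi> ?i)\<close> \<open>Cc (\<psi> j)\<close> h(2) IH sys' that]
    by (simp add: u_def[abs_def])
  let ?a = "\<lambda>k. (scaled_inv (rmat M) ev ^^ k) (e ?i)"
  have i': "1 \<le> ?i" "?i \<le> l" using i by auto
  obtain w where w: "\<And>k. w \<bullet> ?a k = 1" using jordan_chain_dual_vector[OF ch inv ev i'] by blast
  have "u x = 0" for x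
  proof (rule ray_transform_injective[OF u, where a = ?a and w = w and b = "e 1"])
    fix k v r assume v: "v \<bullet> ?a k = 0" "v \<bullet> ?a 0 \<noteq> 0"
    have "(LBINT x. u x * (gradient (\<lambda>x. (v \<bullet> x) ^ Suc r) x \<bullet> e ?i)) = 0"
      by (rule weak_derivative_vanishes[OF inv ev u wk smooth_ridge, where k = k]) (simp_all add: gradient_ridge v del: funpow.simps power_Suc)
    then have "(LBINT x. (real (Suc r) * (v \<bullet> e ?i)) * (u x * (v \<bullet> x) ^ r)) = 0"
      unfolding gradient_ridge by (simp only: mult_ac)
    then show "(LBINT x. u x * (v \<bullet> x) ^ r) = 0"
      using v(2) by simp
  next
    show "e 1 \<noteq> 0" using jordan_chain_nonzero[OF ch, of 1] i by simp
    fix v assume "v \<bullet> e 1 \<noteq> 0"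
    from scaled_inv_chain_eventually[OF ch inv ev this, of ?i] i' i(1)
    obtain \<sigma> where "filterlim (\<lambda>k. \<sigma> * (v \<bullet> ?a k)) at_top sequentially" by auto
    then show "infinite (range (\<lambda>k. v \<bullet> ?a k))" by (rule infinite_range_if_at_top)
  qed (rule w)
  then have "h = f" by (auto simp: u_def fun_eq_iff)
  then show ?case using h(2) by simp
qed

section \<open>Fixed points of the transition operator\<close>

text \<open>The uniqueness theorem in the notation of the transition operator on distributions.\<close>
lemma dist_refinement_unique:
  fixes M :: "int^'n^'n"
  assumes inv: "invertible (rmat M)" and fin: "finite {k. c k \<noteq> 0}"
    and cs: "(\<Sum>k | c k \<noteq> 0. c k) = \<bar>det (rmat M)\<bar>"
    and tends: "\<And>x. (\<lambda>n. ((*v) (matrix_inv (rmat M)) ^^ n) x) \<longlonglongrightarrow> 0"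
    and d: "compact_distribution d" and ref: "\<And>g. smooth g \<Longrightarrow> d g = dist_transition M c d g"
    and d1: "d (\<lambda>_. 1) = 0" and g: "smooth g"
  shows "d g = 0"
proof -
  let ?B = "matrix_inv (rmat M)" and ?D = "\<bar>det (rmat M)\<bar>"
  have det: "?D \<noteq> 0" using inv invertible_det_nz[of "rmat M"] by simp
  obtain ks where ks: "set ks = {k. c k \<noteq> 0}" "distinct ks" using finite_distinct_list[OF fin] by blast
  let ?ps = "map (\<lambda>k. (c k / ?D, ?B *v rvec k)) ks"
  have sum: "(\<Sum>(a, t)\<leftarrow>?ps. F a t) = (\<Sum>k | c k \<noteq> 0. F (c k / ?D) (?B *v rvec k))" for F :: "real \<Rightarrow> real^'n \<Rightarrow> real"
    using sum_list_distinct_conv_sum_set[OF ks(2), of "\<lambda>k. F (c k / ?D) (?B *v rvec k)"] by (simp add: ks(1) o_def)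
  show ?thesis
  proof (rule compact_distribution_refinement_eq_0[OF d _ _ tends d1 g, where ps = ?ps])
    show "(\<Sum>(a, t)\<leftarrow>?ps. a) = 1"
      unfolding sum using det cs by (simp add: sum_divide_distrib[symmetric])
    show "d g = (\<Sum>(a, t)\<leftarrow>?ps. a * d (\<lambda>y. g (?B *v y + t)))" if "smooth g" for g
      unfolding sum ref[OF that] dist_transition_def by (simp add: matrix_vector_right_distrib)
  qed
qed

lemma integral_fixed_dist_transition:
  fixes M :: "int^'n^'n"
  assumes inv: "invertible (rmat M)" and f: "Cc f" and Tf: "transition M c f = f" and g: "smooth g"
  shows "(LBINT x. f x * g x) = dist_transition M c (\<lambda>g. LBINT x. f x * g x) g"
  using integral_transition[OF inv f smooth_continuous_on[OF g], of c]
  by (simp add: Tf dist_transition_def)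

lemma transition_fixed_eq_0:
  fixes M :: "int^'n^'n"
  assumes inv: "invertible (rmat M)" and fin: "finite {k. c k \<noteq> 0}"
    and cs: "(\<Sum>k | c k \<noteq> 0. c k) = \<bar>det (rmat M)\<bar>"
    and tends: "\<And>x. (\<lambda>n. ((*v) (matrix_inv (rmat M)) ^^ n) x) \<longlonglongrightarrow> 0"
    and f: "Cc f" and Tf: "transition M c f = f" and 0: "(LBINT x. f x) = 0"
  shows "f x = 0"
proof (rule Cc_eq_0_if_orthogonal_to_polynomials[OF f])
  fix p :: "real^'n \<Rightarrow> real" assume "real_polynomial_function p"
  then have "smooth p" by (rule smooth_real_polynomial_function)
  show "(LBINT x. f x * p x) = 0"
    by (rule dist_refinement_unique[OF inv fin cs tends compact_distribution_integral[OF f]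
        integral_fixed_dist_transition[OF inv f Tf] _ \<open>smooth p\<close>]) (use 0 in simp_all)
qed

lemma represents_Cc: "represents f \<phi> \<Longrightarrow> Cc f"
  by (simp add: represents_def Cc_iff)

text \<open>The two continuous functions \<open>T f\<close> and \<open>f\<close> represent the same distribution, and test functions
include all polynomials.\<close>
lemma represents_refinable_fixed:
  fixes M :: "int^'n^'n"
  assumes inv: "invertible (rmat M)" and ref: "refinable M c \<phi>" and rep: "represents f \<phi>"
  shows "transition M c f = f"
proof -
  have f: "Cc f" by (rule represents_Cc[OF rep])
  have r: "\<phi> g = (LBINT x. f x * g x)" if "smooth g" for g
    using rep that by (simp add: represents_def)
  have "transition M c f x - f x = 0" for x
  proof (rule Cc_eq_0_if_orthogonal_to_polynomials[where u = "\<lambda>x. transition M c f x - f x"])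
    show "Cc (\<lambda>x. transition M c f x - f x)" by (intro Cc_diff Cc_transition inv f)
    fix p :: "real^'n \<Rightarrow> real" assume "real_polynomial_function p"
    then have p: "smooth p" by (rule smooth_real_polynomial_function)
    have sp: "smooth (\<lambda>y. p (matrix_inv (rmat M) *v (y + rvec k)))" for k
      using smooth_affine[OF p, of "matrix_inv (rmat M)" "matrix_inv (rmat M) *v rvec k"]
      by (simp add: matrix_vector_right_distrib)
    have "(LBINT x. transition M c f x * p x) = dist_transition M c \<phi> p"
      unfolding integral_transition[OF inv f smooth_continuous_on[OF p]] dist_transition_def
      by (simp add: r[OF sp])
    also have "\<dots> = (LBINT x. f x * p x)"
      using ref p r[OF p] by (simp add: refinable_def)
    finally show "(LBINT x. (transition M c f x - f x) * p x) = 0"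
      unfolding left_diff_distrib
      by (subst Bochner_Integration.integral_diff)
         (auto intro!: Cc_integrable Cc_mult_right Cc_transition inv f smooth_continuous_on p)
  qed
  then show ?thesis by (auto simp: fun_eq_iff)
qed

section \<open>Jordan bases of expansive matrices\<close>

lemma affine_recursion_tendsto_0:
  fixes y z :: "nat \<Rightarrow> 'a::real_normed_vector"
  assumes \<rho>: "0 \<le> \<rho>" "\<rho> < 1" and rec: "\<And>n. norm (y (Suc n)) \<le> \<rho> * norm (y n) + norm (z n)"
    and z: "z \<longlonglongrightarrow> 0"
  shows "y \<longlonglongrightarrow> 0"
proof (rule LIMSEQ_I)
  fix r :: real assume r: "r > 0"
  \<comment> \<open>with this bound for the inhomogeneous part, \<open>r / 2\<close> is a fixed point of the recursion\<close>
  have "(1 - \<rho>) * (r / 2) > 0" using r \<rho> by simp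
  then obtain N where N: "\<And>n. n \<ge> N \<Longrightarrow> norm (z n) < (1 - \<rho>) * (r / 2)"
    using LIMSEQ_D[OF z, of "(1 - \<rho>) * (r / 2)"] by auto
  have b: "norm (y (N + k)) \<le> \<rho> ^ k * norm (y N) + r / 2" for k
  proof (induction k)
    case 0
    then show ?case using r by simp
  next
    case (Suc k)
    have "norm (y (N + Suc k)) \<le> \<rho> * norm (y (N + k)) + norm (z (N + k))" using rec[of "N + k"] by simp
    also have "\<dots> \<le> \<rho> * (\<rho> ^ k * norm (y N) + r / 2) + (1 - \<rho>) * (r / 2)"
      using N[of "N + k"] by (intro add_mono mult_left_mono Suc \<rho>) auto
    also have "\<dots> = \<rho> ^ Suc k * norm (y N) + r / 2" by (simp add: field_simps)
    finally show ?case .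
  qed
  have "(\<lambda>k. \<rho> ^ k * norm (y N)) \<longlonglongrightarrow> 0 * norm (y N)"
    using \<rho> by (intro tendsto_mult tendsto_const LIMSEQ_power_zero) simp
  then have "eventually (\<lambda>k. \<rho> ^ k * norm (y N) < r / 2) sequentially"
    using r by (intro order_tendstoD(2)) auto
  then obtain K where K: "\<And>k. k \<ge> K \<Longrightarrow> \<rho> ^ k * norm (y N) < r / 2" by (auto simp: eventually_sequentially)
  have "norm (y n - 0) < r" if "n \<ge> N + K" for n
  proof -
    have "K \<le> n - N" "N + (n - N) = n" using that by auto
    then show ?thesis using b[of "n - N"] K[of "n - N"] by simp
  qed
  then show "\<exists>no. \<forall>n\<ge>no. norm (y n - 0) < r" by blast
qed

lemma expansive_eigenvalue:
  fixes M :: "int^'n^'n"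
  assumes ex: "expansive M" and v: "v \<noteq> 0" "rmat M *v v = ev *\<^sub>R v"
  shows "\<bar>ev\<bar> > 1"
proof -
  let ?v = "(\<chi> i. complex_of_real (v $ i)) :: complex^'n"
  have "map_matrix of_int M *v ?v = complex_of_real ev *s ?v"
  proof -
    have "(map_matrix of_int M *v ?v) $ i = (complex_of_real ev *s ?v) $ i" for i
    proof -
      have "(map_matrix of_int M *v ?v) $ i = complex_of_real ((rmat M *v v) $ i)"
        by (simp add: matrix_vector_mult_def rmat_def map_matrix_def)
      also have "\<dots> = (complex_of_real ev *s ?v) $ i" by (simp add: v(2))
      finally show ?thesis .
    qed
    then show ?thesis by (simp add: vec_eq_iff)
  qed
  moreover have "?v \<noteq> 0" using v(1) by (auto simp: vec_eq_iff)
  ultimately have "norm (complex_of_real ev) > 1"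
    using ex[unfolded expansive_def, rule_format, of ?v "complex_of_real ev"] by simp
  then show ?thesis by simp
qed

lemma jordan_basis_chain:
  assumes jb: "jordan_basis A n ev len e" and b: "b < n"
  shows "jordan_chain A (ev b) (len b) (e b)"
proof -
  let ?I = "SIGMA b:{..<n}. {1..len b}"
  have inj: "inj_on (\<lambda>(b, i). e b i) ?I" and ind: "independent ((\<lambda>(b, i). e b i) ` ?I)"
    using jb by (auto simp: jordan_basis_def)
  have "inj_on (e b) {1..len b}"
  proof (rule inj_onI)
    fix i j assume "i \<in> {1..len b}" "j \<in> {1..len b}" "e b i = e b j"
    then have "(b, i) = (b, j)" using b by (intro inj_onD[OF inj]) auto
    then show "i = j" by simp
  qed
  moreover have "e b ` {1..len b} \<subseteq> (\<lambda>(b, i). e b i) ` ?I"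
  proof
    fix x assume "x \<in> e b ` {1..len b}"
    then obtain i where "i \<in> {1..len b}" "x = e b i" by blast
    then show "x \<in> (\<lambda>(b, i). e b i) ` ?I" using b by (intro image_eqI[of _ _ "(b, i)"]) auto
  qed
  then have "independent (e b ` {1..len b})" using ind independent_mono by blast
  ultimately show ?thesis using jb b by (auto simp: jordan_basis_def jordan_chain_def)
qed

text \<open>The chains span the space, so a property that is preserved by linear combinations can be proved
for all vectors by induction along each chain.\<close>
lemma jordan_basis_induct_subspace:
  assumes jb: "jordan_basis A n ev len e" and S: "subspace S"
    and 1: "\<And>b. b < n \<Longrightarrow> e b 1 \<in> S"
    and step: "\<And>b i. b < n \<Longrightarrow> 1 \<le> i \<Longrightarrow> Suc i \<le> len b \<Longrightarrow> e b i \<in> S \<Longrightarrow> e b (Suc i) \<in> S"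
  shows "x \<in> S"
proof -
  have "e b i \<in> S" if "1 \<le> i" "i \<le> len b" "b < n" for b i
    using that(1,2)
  proof (induction i rule: dec_induct)
    case base
    show ?case by (rule 1[OF that(3)])
  next
    case (step i)
    then show ?case by (intro assms(4)[OF that(3)]) auto
  qed
  then have "(\<lambda>(b, i). e b i) ` (SIGMA b:{..<n}. {1..len b}) \<subseteq> S" by auto
  then have "span ((\<lambda>(b, i). e b i) ` (SIGMA b:{..<n}. {1..len b})) \<subseteq> S"
    using S by (rule span_minimal)
  then show ?thesis using jb by (auto simp: jordan_basis_def)
qed

lemma jordan_basis_eigenvalue:
  fixes M :: "int^'n^'n"
  assumes "expansive M" and jb: "jordan_basis (rmat M) n ev len e" and b: "b < n"
  shows "\<bar>ev b\<bar> > 1"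
proof (rule expansive_eigenvalue[OF assms(1)])
  have l: "len b \<ge> 1" using jb b by (simp add: jordan_basis_def)
  then show "e b 1 \<noteq> 0" using jordan_chain_nonzero[OF jordan_basis_chain[OF jb b], of 1] by simp
  show "rmat M *v e b 1 = ev b *\<^sub>R e b 1" using jb b by (simp add: jordan_basis_def)
qed

lemma jordan_basis_invertible:
  fixes M :: "int^'n^'n"
  assumes ex: "expansive M" and jb: "jordan_basis (rmat M) n ev len e"
  shows "invertible (rmat M)"
proof -
  let ?S = "range ((*v) (rmat M))"
  have S: "subspace ?S" by (rule linear_subspace_image) (auto simp: subspace_UNIV)
  have "x \<in> ?S" for x
  proof (rule jordan_basis_induct_subspace[OF jb S])
    fix b assume b: "b < n"
    have ev: "ev b \<noteq> 0" using jordan_basis_eigenvalue[OF ex jb b] by auto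
    have "rmat M *v (inverse (ev b) *\<^sub>R e b 1) = e b 1"
      using jb b ev by (simp add: jordan_basis_def matrix_vector_mult_scaleR)
    then show "e b 1 \<in> ?S" by (metis rangeI)
    fix i assume i: "1 \<le> i" "Suc i \<le> len b" "e b i \<in> ?S"
    have "rmat M *v e b (Suc i) = ev b *\<^sub>R e b (Suc i) + e b i"
      using jb b i by (auto simp: jordan_basis_def)
    then have "e b (Suc i) = inverse (ev b) *\<^sub>R (rmat M *v e b (Suc i) - e b i)" using ev by simp
    also have "\<dots> \<in> ?S" by (intro subspace_scale subspace_diff S i rangeI)
    finally show "e b (Suc i) \<in> ?S" .
  qed
  then have "surj ((*v) (rmat M))" by blast
  then show ?thesis
    using matrix_right_invertible_surjective[of "rmat M"] invertible_right_inverse by blast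
qed

text \<open>Along a chain the orbit of \<open>e (Suc i)\<close> under the inverse satisfies an affine recursion with
factor \<open>1 / ev\<close> of absolute value below 1, whose inhomogeneous part is the orbit of \<open>e i\<close>.\<close>
lemma jordan_basis_inverse_powers_tendsto_0:
  fixes M :: "int^'n^'n"
  assumes ex: "expansive M" and jb: "jordan_basis (rmat M) n ev len e"
  shows "(\<lambda>k. ((*v) (matrix_inv (rmat M)) ^^ k) x) \<longlonglongrightarrow> 0"
proof -
  let ?B = "matrix_inv (rmat M)"
  have inv: "invertible (rmat M)" by (rule jordan_basis_invertible[OF assms])
  have lin: "linear ((*v) ?B ^^ k)" for k
  proof (induction k)
    case (Suc k)
    from linear_compose[OF Suc matrix_vector_mul_linear[of ?B]] show ?case by (simp add: o_def)
  qed (simp add: linear_iff)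
  have mi: "?B *v (rmat M *v y) = y" for y
    by (simp add: matrix_vector_mul_assoc matrix_inv_mult[OF inv])
  let ?S = "{x. (\<lambda>k. ((*v) ?B ^^ k) x) \<longlonglongrightarrow> 0}"
  have S: "subspace ?S"
  proof (rule subspaceI)
    show "0 \<in> ?S" by (simp add: linear_0[OF lin])
    fix x y assume x: "x \<in> ?S" and y: "y \<in> ?S"
    show "x + y \<in> ?S" using tendsto_add[of _ 0 _ _ 0] x y by (simp add: linear_add[OF lin])
    show "a *\<^sub>R x \<in> ?S" for a
      using tendsto_scaleR[OF tendsto_const, of _ 0 _ a] x by (simp add: linear_cmul[OF lin])
  qed
  have "x \<in> ?S" for x
  proof (rule jordan_basis_induct_subspace[OF jb S])
    fix b assume b: "b < n"
    have ev: "\<bar>ev b\<bar> > 1" "ev b \<noteq> 0" using jordan_basis_eigenvalue[OF ex jb b] by auto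
    have \<rho>: "0 \<le> inverse \<bar>ev b\<bar>" "inverse \<bar>ev b\<bar> < 1" using ev by (auto simp: inverse_less_1_iff)
    have "?B *v e b 1 = inverse (ev b) *\<^sub>R e b 1"
    proof -
      have "e b 1 = ev b *\<^sub>R (?B *v e b 1)"
        using mi[of "e b 1"] jb b by (simp add: jordan_basis_def matrix_vector_mult_scaleR)
      then have "inverse (ev b) *\<^sub>R e b 1 = inverse (ev b) *\<^sub>R (ev b *\<^sub>R (?B *v e b 1))" by (rule arg_cong)
      then show ?thesis using ev by simp
    qed
    then have "((*v) ?B ^^ Suc k) (e b 1) = inverse (ev b) *\<^sub>R ((*v) ?B ^^ k) (e b 1)" for k
      by (simp add: funpow_swap1 linear_cmul[OF lin])
    then have "norm (((*v) ?B ^^ Suc k) (e b 1)) \<le> inverse \<bar>ev b\<bar> * norm (((*v) ?B ^^ k) (e b 1)) + norm (0::real^'n)" for k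
      by (simp only: norm_scaleR abs_inverse norm_zero add_0_right order_refl)
    then have "(\<lambda>k. ((*v) ?B ^^ k) (e b 1)) \<longlonglongrightarrow> 0"
      by (rule affine_recursion_tendsto_0[OF \<rho>]) simp
    then show "e b 1 \<in> ?S" by simp
    fix i assume i: "1 \<le> i" "Suc i \<le> len b" "e b i \<in> ?S"
    have Be: "?B *v e b (Suc i) = inverse (ev b) *\<^sub>R (e b (Suc i) - ?B *v e b i)"
    proof -
      have "rmat M *v e b (Suc i) = ev b *\<^sub>R e b (Suc i) + e b i"
        using jb b i by (auto simp: jordan_basis_def)
      then have "e b (Suc i) = ev b *\<^sub>R (?B *v e b (Suc i)) + ?B *v e b i"
        using mi[of "e b (Suc i)"] by (simp add: matrix_vector_right_distrib matrix_vector_mult_scaleR)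
      then have "e b (Suc i) - ?B *v e b i = ev b *\<^sub>R (?B *v e b (Suc i))" by (metis add_diff_cancel_right')
      then show ?thesis using ev by simp
    qed
    have rec: "((*v) ?B ^^ Suc k) (e b (Suc i))
        = inverse (ev b) *\<^sub>R (((*v) ?B ^^ k) (e b (Suc i)) - ((*v) ?B ^^ Suc k) (e b i))" for k
      by (simp add: funpow_swap1 Be linear_cmul[OF lin] linear_diff[OF lin])
    have "(\<lambda>k. ((*v) ?B ^^ k) (e b (Suc i))) \<longlonglongrightarrow> 0"
    proof (rule affine_recursion_tendsto_0[OF \<rho>])
      show "norm (((*v) ?B ^^ Suc k) (e b (Suc i)))
         \<le> inverse \<bar>ev b\<bar> * norm (((*v) ?B ^^ k) (e b (Suc i))) + norm (inverse (ev b) *\<^sub>R ((*v) ?B ^^ Suc k) (e b i))" for k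
        unfolding rec scaleR_diff_right
        by (rule order_trans[OF norm_triangle_ineq4]) (simp del: funpow.simps)
      have "(\<lambda>k. ((*v) ?B ^^ Suc k) (e b i)) \<longlonglongrightarrow> 0"
        using i(3) by (intro LIMSEQ_Suc) simp
      then show "(\<lambda>k. inverse (ev b) *\<^sub>R ((*v) ?B ^^ Suc k) (e b i)) \<longlonglongrightarrow> 0"
        by (rule tendsto_scaleR[OF tendsto_const, of _ 0, simplified])
    qed
    then show "e b (Suc i) \<in> ?S" by simp
  qed
  then show ?thesis by simp
qed

section \<open>Continuous differentiability from directional derivatives\<close>

lemma has_dd_mean_value:
  assumes dd: "has_dd F a G"
  shows "\<exists>s. \<bar>s\<bar> \<le> \<bar>h\<bar> \<and> F (x + h *\<^sub>R a) - F x = h * G (x + s *\<^sub>R a)"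
proof (cases h "0::real" rule: linorder_cases)
  case less
  then obtain s where s: "0 < s" "s < - h"
    "F ((x + h *\<^sub>R a) + (- h) *\<^sub>R a) - F (x + h *\<^sub>R a) = - h * G ((x + h *\<^sub>R a) + s *\<^sub>R a)"
    using has_dd_MVT[OF dd, of "- h" "x + h *\<^sub>R a"] by auto
  then have "F (x + h *\<^sub>R a) - F x = h * G (x + (h + s) *\<^sub>R a)" by (simp add: algebra_simps)
  then show ?thesis using s(1,2) by (intro exI[of _ "h + s"]) auto
next
  case equal
  then show ?thesis by (intro exI[of _ 0]) simp
next
  case greater
  from has_dd_MVT[OF dd greater, of x] obtain s where
    "0 < s" "s < h" "F (x + h *\<^sub>R a) - F x = h * G (x + s *\<^sub>R a)" by blast
  then show ?thesis by (intro exI[of _ s]) auto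
qed

text \<open>The increment is built up one basis direction after the other. Each partial increment is a
derivative at an intermediate point close to \<open>x\<close>, where continuity compares it with the
derivative at \<open>x\<close>.\<close>
lemma increment_expansion:
  fixes f :: "'a::real_normed_vector \<Rightarrow> real"
  assumes "finite B" and "\<And>b. b \<in> B \<Longrightarrow> has_dd f b (G b)" and "\<And>b. b \<in> B \<Longrightarrow> continuous_on UNIV (G b)"
    and "\<epsilon> > 0"
  shows "\<exists>\<delta>>0. \<forall>h. (\<forall>b\<in>B. \<bar>h b\<bar> < \<delta>) \<longrightarrow>
    \<bar>f (x + (\<Sum>b\<in>B. h b *\<^sub>R b)) - f x - (\<Sum>b\<in>B. h b * G b x)\<bar> \<le> \<epsilon> * (\<Sum>b\<in>B. \<bar>h b\<bar>)"
  using assms(1-3)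
proof (induction B rule: finite_induct)
  case empty
  show ?case by (intro exI[of _ 1]) simp
next
  case (insert a B)
  then obtain \<delta> where \<delta>: "\<delta> > 0" "\<And>h. (\<forall>b\<in>B. \<bar>h b\<bar> < \<delta>) \<Longrightarrow>
    \<bar>f (x + (\<Sum>b\<in>B. h b *\<^sub>R b)) - f x - (\<Sum>b\<in>B. h b * G b x)\<bar> \<le> \<epsilon> * (\<Sum>b\<in>B. \<bar>h b\<bar>)"
    by auto
  have "isCont (G a) x" using insert.prems(2) by (simp add: continuous_on_eq_continuous_at)
  then obtain \<eta> where \<eta>: "\<eta> > 0" "\<And>y. dist y x < \<eta> \<Longrightarrow> dist (G a y) (G a x) < \<epsilon>"
    using \<open>\<epsilon> > 0\<close> unfolding continuous_at_eps_delta by blast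
  \<comment> \<open>coefficients below \<open>\<eta> / C\<close> keep all intermediate points within distance \<open>\<eta>\<close> of \<open>x\<close>\<close>
  define C where "C = 1 + norm a + (\<Sum>b\<in>B. norm b)"
  have C: "C > 0" unfolding C_def by (smt (verit) norm_ge_zero sum_nonneg)
  define \<delta>' where "\<delta>' = min \<delta> (\<eta> / C)"
  have "\<delta>' > 0" using \<delta> \<eta> C by (simp add: \<delta>'_def)
  moreover have "\<bar>f (x + (\<Sum>b\<in>insert a B. h b *\<^sub>R b)) - f x - (\<Sum>b\<in>insert a B. h b * G b x)\<bar>
      \<le> \<epsilon> * (\<Sum>b\<in>insert a B. \<bar>h b\<bar>)" if h: "\<forall>b\<in>insert a B. \<bar>h b\<bar> < \<delta>'" for h
  proof -
    let ?y = "x + (\<Sum>b\<in>B. h b *\<^sub>R b)"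
    obtain s where s: "\<bar>s\<bar> \<le> \<bar>h a\<bar>" "f (?y + h a *\<^sub>R a) - f ?y = h a * G a (?y + s *\<^sub>R a)"
      using has_dd_mean_value[OF insert.prems(1)[of a], of "h a" ?y] by auto
    have "norm ((\<Sum>b\<in>B. h b *\<^sub>R b) + s *\<^sub>R a) \<le> (\<Sum>b\<in>B. \<delta>' * norm b) + \<delta>' * norm a"
      using h s(1) by (intro order_trans[OF norm_triangle_ineq] add_mono order_trans[OF norm_sum] sum_mono)
        (auto intro!: mult_right_mono intro: less_imp_le)
    also have "\<dots> = \<delta>' * (C - 1)" by (simp add: C_def algebra_simps sum_distrib_left)
    also have "\<dots> < \<delta>' * C" using \<open>\<delta>' > 0\<close> by simp
    also have "\<dots> \<le> \<eta>"
    proof -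
      have "\<delta>' \<le> \<eta> / C" by (simp add: \<delta>'_def)
      then show ?thesis using C by (simp add: pos_le_divide_eq)
    qed
    finally have "dist (?y + s *\<^sub>R a) x < \<eta>" by (simp add: dist_norm add.assoc)
    then have G: "\<bar>G a (?y + s *\<^sub>R a) - G a x\<bar> \<le> \<epsilon>" using \<eta>(2) by (force simp: dist_real_def)
    have "f (x + (\<Sum>b\<in>insert a B. h b *\<^sub>R b)) - f x - (\<Sum>b\<in>insert a B. h b * G b x)
        = h a * (G a (?y + s *\<^sub>R a) - G a x) + (f ?y - f x - (\<Sum>b\<in>B. h b * G b x))"
      using s(2) insert.hyps by (simp add: algebra_simps)
    also have "\<bar>\<dots>\<bar> \<le> \<bar>h a\<bar> * \<epsilon> + \<epsilon> * (\<Sum>b\<in>B. \<bar>h b\<bar>)"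
      using G h by (intro order_trans[OF abs_triangle_ineq] add_mono \<delta>(2))
        (auto simp: abs_mult \<delta>'_def intro: mult_left_mono)
    finally show ?thesis using insert.hyps by (simp add: algebra_simps)
  qed
  ultimately show ?case by blast
qed

lemma C1_if_directional:
  fixes f :: "real^'n \<Rightarrow> real"
  assumes ind: "independent B" and span: "span B = UNIV"
    and dd: "\<And>b. b \<in> B \<Longrightarrow> has_dd f b (G b)" and cont: "\<And>b. b \<in> B \<Longrightarrow> continuous_on UNIV (G b)"
  shows "C1 f"
proof -
  have fin: "finite B" using ind by (rule finiteI_independent)
  let ?r = "\<lambda>v b. representation B v b"
  have bl: "bounded_linear (\<lambda>v. ?r v b)" for b
    using bounded_linear_representation[OF ind span] .
  have eq: "(\<Sum>b\<in>B. ?r v b *\<^sub>R b) = v" for v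
    using real_vector.sum_representation_eq[OF ind _ fin, of v] span by simp
  let ?D = "\<lambda>x v. \<Sum>b\<in>B. ?r v b * G b x"
  have "(f has_derivative ?D x) (at x)" for x
    unfolding has_derivative_at_alt
  proof (intro conjI allI impI)
    show "bounded_linear (?D x)"
      by (intro bounded_linear_sum bounded_linear_mult_const bl)
    fix e :: real assume e: "e > 0"
    have "\<exists>K. \<forall>v. norm (?r v b) \<le> norm v * K" for b using bounded_linear.bounded[OF bl] .
    then obtain K where K: "\<And>v b. \<bar>?r v b\<bar> \<le> norm v * K b" by (metis real_norm_def)
    define C where "C = 1 + (\<Sum>b\<in>B. \<bar>K b\<bar>)"
    have C: "C \<ge> 1" by (simp add: C_def sum_nonneg)
    have KC: "\<bar>?r v b\<bar> \<le> norm v * C" if "b \<in> B" for v b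
    proof -
      have "K b \<le> C" using member_le_sum[OF that, of "\<lambda>b. \<bar>K b\<bar>"] fin by (simp add: C_def)
      then show ?thesis using K[of v b] by (meson mult_left_mono norm_ge_zero order_trans)
    qed
    have SC: "(\<Sum>b\<in>B. \<bar>?r v b\<bar>) \<le> norm v * C" for v
    proof -
      have "(\<Sum>b\<in>B. \<bar>?r v b\<bar>) \<le> (\<Sum>b\<in>B. norm v * \<bar>K b\<bar>)"
        using K by (intro sum_mono) (meson abs_ge_self mult_left_mono norm_ge_zero order_trans)
      also have "\<dots> \<le> norm v * C" by (simp add: C_def sum_distrib_left[symmetric] distrib_left)
      finally show ?thesis .
    qed
    obtain \<delta> where \<delta>: "\<delta> > 0" "\<And>h. (\<forall>b\<in>B. \<bar>h b\<bar> < \<delta>) \<Longrightarrow>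
      \<bar>f (x + (\<Sum>b\<in>B. h b *\<^sub>R b)) - f x - (\<Sum>b\<in>B. h b * G b x)\<bar> \<le> (e / C) * (\<Sum>b\<in>B. \<bar>h b\<bar>)"
      using increment_expansion[OF fin dd cont, of "e / C" x] e C by auto
    have "norm (f y - f x - ?D x (y - x)) \<le> e * norm (y - x)" if y: "norm (y - x) < \<delta> / C" for y
    proof -
      have "norm (y - x) * C < \<delta>" using y C by (simp add: pos_less_divide_eq)
      then have "\<forall>b\<in>B. \<bar>?r (y - x) b\<bar> < \<delta>" using KC[of _ "y - x"] by (meson order_le_less_trans)
      from \<delta>(2)[OF this]
      have "norm (f y - f x - ?D x (y - x)) \<le> (e / C) * (\<Sum>b\<in>B. \<bar>?r (y - x) b\<bar>)" by (simp add: eq)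
      also have "\<dots> \<le> (e / C) * (norm (y - x) * C)" using e C by (intro mult_left_mono SC) auto
      also have "\<dots> = e * norm (y - x)" using C by simp
      finally show ?thesis .
    qed
    then show "\<exists>d>0. \<forall>y. norm (y - x) < d \<longrightarrow> norm (f y - f x - ?D x (y - x)) \<le> e * norm (y - x)"
      using \<delta>(1) C by (intro exI[of _ "\<delta> / C"]) auto
  qed
  note D = this
  have "continuous_on UNIV (gradient f)"
  proof -
    have "gradient f = (\<lambda>x. \<chi> i. ?D x (axis i 1))"
      using gradient_nth_eqI[OF D] by (auto simp: vec_eq_iff fun_eq_iff)
    moreover have "continuous_on UNIV (\<lambda>x. \<chi> i. ?D x (axis i 1))"
      by (intro continuous_on_vec_lambda continuous_on_sum continuous_on_mult continuous_on_const cont)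
    ultimately show ?thesis by simp
  qed
  then show ?thesis using D by (auto simp: C1_def differentiable_def)
qed

section \<open>Derivatives of the refinable function and solutions of the systems\<close>
lemma has_dd_scale:
  assumes "has_dd F a G"
  shows "has_dd F (k *\<^sub>R a) (\<lambda>x. k * G x)"
  unfolding has_dd_def
proof
  fix x
  have 1: "((\<lambda>t. k * t) has_real_derivative k) (at 0)"
    using DERIV_cmult_Id[of k] .
  have 2: "((\<lambda>t. F (x + t *\<^sub>R a)) has_real_derivative G x) (at (k * 0))"
    using assms by (simp add: has_dd_def)
  have "((\<lambda>t. F (x + (k * t) *\<^sub>R a)) has_real_derivative G x * k) (at 0)"
    by (rule DERIV_chain2[where f = "\<lambda>t. F (x + t *\<^sub>R a)" and g = "\<lambda>t. k * t", OF 2 1])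
  then show "((\<lambda>t. F (x + t *\<^sub>R k *\<^sub>R a)) has_real_derivative k * G x) (at 0)"
    by (simp add: mult.commute)
qed

lemma C1_has_dd:
  assumes "C1 f"
  shows "has_dd f a (directional_deriv a f)"
  unfolding has_dd_def
proof
  fix x
  have 1: "((\<lambda>s. x + s *\<^sub>R a) has_derivative (\<lambda>h. h *\<^sub>R a)) (at 0)"
    by (auto intro!: derivative_eq_intros)
  have "f differentiable (at (x + 0 *\<^sub>R a))" using assms by (simp add: C1_def)
  from diff_chain_at[OF 1 has_derivative_gradient[OF this]]
  have "((\<lambda>t. f (x + t *\<^sub>R a)) has_derivative (\<lambda>h. gradient f x \<bullet> (h *\<^sub>R a))) (at 0)"
    by (simp add: o_def)
  then show "((\<lambda>t. f (x + t *\<^sub>R a)) has_real_derivative directional_deriv a f x) (at 0)"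
    unfolding has_field_derivative_def
    by (rule has_derivative_eq_rhs) (simp add: fun_eq_iff directional_deriv_def inner_commute)
qed

lemma C1_continuous_directional: "C1 f \<Longrightarrow> continuous_on UNIV (directional_deriv a f)"
  unfolding directional_deriv_def[abs_def] C1_def by (intro continuous_on_inner continuous_on_const) auto

lemma has_dd_support:
  assumes f: "Cc f" and dd: "has_dd f a G" and G: "continuous_on UNIV G"
  shows "Cc G"
proof -
  obtain R where R: "R > 0" "\<And>x. norm x > R \<Longrightarrow> f x = 0" using Cc_support[OF f] by metis
  show ?thesis
  proof (rule CcI[OF G])
    fix x :: 'a assume x: "norm x > R"
    let ?U = "{t. norm (x + t *\<^sub>R a) > R}"
    have U: "open ?U" by (intro open_Collect_less continuous_intros)
    have "((\<lambda>t. f (x + t *\<^sub>R a)) has_real_derivative G x) (at 0)" using dd by (simp add: has_dd_def)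
    then have "((\<lambda>t::real. 0) has_real_derivative G x) (at 0)"
      by (rule has_field_derivative_transform_within_open[OF _ U]) (use x R(2) in simp_all)
    then show "G x = 0" by (rule DERIV_unique[OF _ DERIV_const])
  qed
qed

text \<open>On each line this is the one-dimensional case of \<open>integral_directional_derivative\<close>.\<close>
lemma directional_derivative_mean_zero:
  assumes f: "Cc f" and dd: "has_dd f a G" and G: "Cc G" and a: "a \<noteq> 0"
  shows "(LBINT t. G (t *\<^sub>R a + b)) = 0"
proof -
  have "has_dd (\<lambda>t. f (b + t *\<^sub>R a)) (1::real) (\<lambda>t. G (b + t *\<^sub>R a))"
    unfolding has_dd_def
  proof
    fix t
    have "((\<lambda>s. f ((b + t *\<^sub>R a) + s *\<^sub>R a)) has_real_derivative G (b + t *\<^sub>R a)) (at 0)"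
      using dd by (simp add: has_dd_def)
    then show "((\<lambda>s. f (b + (t + s *\<^sub>R 1) *\<^sub>R a)) has_real_derivative G (b + t *\<^sub>R a)) (at 0)"
      by (simp add: algebra_simps)
  qed
  from integral_directional_derivative[OF Cc_line[OF f a] Cc_line[OF G a] this]
  show ?thesis by (simp add: add.commute)
qed

text \<open>The chain rule for \<open>f = T f\<close> gives the system in the form with \<open>T \<psi>\<^sub>i\<^sub>-\<^sub>1\<close>. The solution is
nontrivial because a function of compact support that is constant along \<open>e\<^sub>1\<close> vanishes.\<close>
lemma C1_directional_deriv_block_solution:
  fixes M :: "int^'n^'n"
  assumes ch: "jordan_chain (rmat M) ev l e" and l: "l \<ge> 1" and inv: "invertible (rmat M)" and ev: "ev \<noteq> 0"
    and f: "Cc f" "C1 f" and Tf: "transition M c f = f" and nz: "f x0 \<noteq> 0"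
  shows "block_solution M c ev l e (\<lambda>i. directional_deriv (e i) f)"
proof -
  let ?\<psi> = "\<lambda>i. directional_deriv (e i) f"
  have dd: "has_dd f a (directional_deriv a f)" for a by (rule C1_has_dd[OF f(2)])
  have c: "Cc (directional_deriv a f)" for a
    by (rule has_dd_support[OF f(1) dd C1_continuous_directional[OF f(2)]])
  have mz: "?\<psi> i \<in> cont_mean_zero (e i)" if "i \<in> {1..l}" for i
    using c[of "e i"] directional_derivative_mean_zero[OF f(1) dd c jordan_chain_nonzero[OF ch that]]
    by (simp add: cont_mean_zero_def Cc_iff)
  have T: "directional_deriv a f = transition M c (directional_deriv (rmat M *v a) f)" for a
    using has_dd_transition[where M = M and a = a and c = c, OF dd] dd[of a] unfolding Tf by (rule has_dd_unique[rotated])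
  have 1: "?\<psi> 1 x = ev * transition M c (?\<psi> 1) x" for x
  proof -
    have "directional_deriv (rmat M *v e 1) f = (\<lambda>x. ev * ?\<psi> 1 x)"
      using ch by (auto simp: jordan_chain_def directional_deriv_def fun_eq_iff)
    then show ?thesis using T[of "e 1"] by (metis transition_cmult)
  qed
  have i: "?\<psi> i x = ev * transition M c (?\<psi> i) x + transition M c (?\<psi> (i - 1)) x" if "i \<in> {2..l}" for i x
  proof -
    have "directional_deriv (rmat M *v e i) f = (\<lambda>x. ev * ?\<psi> i x + ?\<psi> (i - 1) x)"
      using ch that by (auto simp: jordan_chain_def directional_deriv_def fun_eq_iff inner_add_left)
    then have "?\<psi> i = transition M c (\<lambda>x. ev * ?\<psi> i x + ?\<psi> (i - 1) x)" using T[of "e i"] by simp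
    also have "\<dots> = (\<lambda>x. ev * transition M c (?\<psi> i) x + transition M c (?\<psi> (i - 1)) x)"
      unfolding transition_add transition_cmult ..
    finally show ?thesis by (rule fun_cong)
  qed
  have "\<exists>x. ?\<psi> 1 x \<noteq> 0"
  proof (rule ccontr)
    assume "\<not> ?thesis"
    then have "?\<psi> 1 = (\<lambda>_. 0)" by (simp add: fun_eq_iff)
    then have "has_dd f (e 1) (\<lambda>_. 0)" using dd[of "e 1"] by simp
    from Cc_eq_0_if_constant_along[OF f(1) this jordan_chain_nonzero[OF ch]] l nz show False by auto
  qed
  then have ex: "\<exists>i\<in>{1..l}. \<exists>x. ?\<psi> i x \<noteq> 0" using l by (intro bexI[of _ 1]) auto
  have sys: "\<forall>i\<in>{2..l}. ?\<psi> i x = ev * transition M c (?\<psi> i) x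
        + (\<Sum>j=1..i-1. (-1)^(j-1) * ev powi (- int j) * ?\<psi> (i-j) x)" for x
    using block_system_iff[where l = l and t = "\<lambda>i. transition M c (?\<psi> i) x" and p = "\<lambda>i. ?\<psi> i x", OF ev 1[of x]] i by blast
  show ?thesis
    unfolding block_solution_def using mz ex 1 sys by blast
qed

text \<open>The antiderivative \<open>h\<close> of \<open>\<psi>\<^sub>1\<close> along \<open>e\<^sub>1\<close> is a fixed point, since \<open>T h - h\<close> is constant along
\<open>e\<^sub>1\<close>. By rigidity all \<open>\<psi>\<^sub>i\<close> are derivatives of this single function, which therefore cannot
vanish, and by uniqueness its integral cannot vanish either.\<close>
lemma block_solution_fixed_point:
  fixes M :: "int^'n^'n"
  assumes ch: "jordan_chain (rmat M) ev l e" and inv: "invertible (rmat M)" and ev: "ev \<noteq> 0"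
    and fin: "finite {k. c k \<noteq> 0}" and cs: "(\<Sum>k | c k \<noteq> 0. c k) = \<bar>det (rmat M)\<bar>"
    and tends: "\<And>x. (\<lambda>n. ((*v) (matrix_inv (rmat M)) ^^ n) x) \<longlonglongrightarrow> 0"
    and bs: "block_solution M c ev l e \<psi>"
  obtains h where "Cc h" "transition M c h = h" "(LBINT x. h x) \<noteq> 0"
    "\<And>i. i \<in> {1..l} \<Longrightarrow> has_dd h (e i) (\<psi> i)"
proof -
  have mz: "\<psi> i \<in> cont_mean_zero (e i)" if "i \<in> {1..l}" for i
    using bs that unfolding block_solution_def by blast
  have 1: "\<psi> 1 x = ev * transition M c (\<psi> 1) x" for x
    using bs unfolding block_solution_def by blast
  obtain i0 x0 where nz: "i0 \<in> {1..l}" "\<psi> i0 x0 \<noteq> 0"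
    using bs unfolding block_solution_def by blast
  have l: "1 \<in> {1..l}" using nz by auto
  have sysx: "\<forall>i\<in>{2..l}. \<psi> i x = ev * transition M c (\<psi> i) x
        + (\<Sum>j=1..i-1. (-1)^(j-1) * ev powi (- int j) * \<psi> (i-j) x)" for x
    using bs unfolding block_solution_def by blast
  have sys: "\<psi> i x = ev * transition M c (\<psi> i) x + transition M c (\<psi> (i - 1)) x" if "i \<in> {2..l}" for i x
    using block_system_iff[where l = l and t = "\<lambda>i. transition M c (\<psi> i) x" and p = "\<lambda>i. \<psi> i x", OF ev 1[of x]] sysx that by blast
  have mz1: "\<And>b. (LBINT t. \<psi> 1 (t *\<^sub>R e 1 + b)) = 0"
    using mz[OF l] by (simp add: cont_mean_zero_def)
  obtain h where h: "Cc h" "has_dd h (e 1) (\<psi> 1)"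
    using antiderivative_along[OF cont_mean_zero_Cc[OF mz[OF l]] jordan_chain_nonzero[OF ch l] mz1] by blast
  have "has_dd h (rmat M *v e 1) (\<lambda>x. ev * \<psi> 1 x)"
    using has_dd_scale[OF h(2), of ev] ch by (simp add: jordan_chain_def)
  then have "has_dd (transition M c h) (e 1) (transition M c (\<lambda>x. ev * \<psi> 1 x))" by (rule has_dd_transition)
  moreover have "transition M c (\<lambda>x. ev * \<psi> 1 x) = \<psi> 1" unfolding transition_cmult by (rule ext) (rule 1[symmetric])
  ultimately have "has_dd (\<lambda>x. transition M c h x - h x) (e 1) (\<lambda>x. \<psi> 1 x - \<psi> 1 x)"
    using has_dd_diff h(2) by fastforce
  then have "transition M c h x - h x = 0" for x
    using Cc_eq_0_if_constant_along[OF Cc_diff[OF Cc_transition[OF inv h(1)] h(1)] _ jordan_chain_nonzero[OF ch l]] by simp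
  then have Th: "transition M c h = h" by (auto simp: fun_eq_iff)
  have dd: "has_dd h (e i) (\<psi> i)" if "i \<in> {1..l}" for i
    using chain_derivatives[OF ch inv ev h(1) Th mz sys h(2)] that by auto
  have "(LBINT x. h x) \<noteq> 0"
  proof
    assume "(LBINT x. h x) = 0"
    from transition_fixed_eq_0[OF inv fin cs tends h(1) Th this]
    have "h = (\<lambda>_. 0)" by (simp add: fun_eq_iff)
    then have "((\<lambda>t. 0) has_real_derivative \<psi> i0 x0) (at 0)" using dd[OF nz(1)] by (simp add: has_dd_def)
    then show False using DERIV_unique[OF _ DERIV_const] nz(2) by blast
  qed
  then show ?thesis using that h(1) Th dd by blast
qed

lemma refinable_mask_sum:
  assumes inv: "invertible (rmat M)" and ref: "refinable M c \<phi>"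
  shows "(\<Sum>k | c k \<noteq> 0. c k) = \<bar>det (rmat M)\<bar>"
proof -
  have one: "\<phi> (\<lambda>_. 1) = 1" using ref by (simp add: refinable_def dist_integral_def)
  have "\<phi> (\<lambda>_. 1) = dist_transition M c \<phi> (\<lambda>_. 1)" using ref smooth_const[of 1] unfolding refinable_def by blast
  then have "1 = (\<Sum>k | c k \<noteq> 0. c k) / \<bar>det (rmat M)\<bar>"
    by (simp add: dist_transition_def one sum_divide_distrib)
  then show ?thesis using inv invertible_det_nz[of "rmat M"] by (simp add: field_simps)
qed

theorem theorem3:
  fixes M :: "int^'n^'n" and D :: "(int^'n) set" and c :: "int^'n \<Rightarrow> real"
    and n :: nat and ev :: "nat \<Rightarrow> real" and len :: "nat \<Rightarrow> nat"
    and e :: "nat \<Rightarrow> nat \<Rightarrow> real^'n"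
    and \<phi> :: "(real^'n \<Rightarrow> real) \<Rightarrow> real"
  assumes "expansive M"
    and "finite {k. c k \<noteq> 0}"
    and "complete_representatives M D"
    and "sum_rules M D c"
    and "jordan_basis (rmat M) n ev len e"
    and "refinable M c \<phi>"
  shows "(dist_C1 \<phi> \<longleftrightarrow> (\<forall>b<n. \<exists>\<psi>. block_solution M c (ev b) (len b) (e b) \<psi>)) \<and>
    (\<forall>f b \<psi>. C1 f \<and> represents f \<phi> \<and> b < n \<and> block_solution M c (ev b) (len b) (e b) \<psi> \<longrightarrow>
       (\<exists>\<kappa>. \<kappa> \<noteq> 0 \<and> (\<forall>i\<in>{1..len b}. \<forall>x. directional_deriv (e b i) f x = \<kappa> * \<psi> i x)))"
proof -
  note ex = assms(1) and fin = assms(2) and jb = assms(5) and ref = assms(6)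
  have inv: "invertible (rmat M)" by (rule jordan_basis_invertible[OF ex jb])
  have tends: "(\<lambda>k. ((*v) (matrix_inv (rmat M)) ^^ k) x) \<longlonglongrightarrow> 0" for x
    by (rule jordan_basis_inverse_powers_tendsto_0[OF ex jb])
  have cs: "(\<Sum>k | c k \<noteq> 0. c k) = \<bar>det (rmat M)\<bar>" by (rule refinable_mask_sum[OF inv ref])
  have ev: "ev b \<noteq> 0" if "b < n" for b using jordan_basis_eigenvalue[OF ex jb that] by auto
  have ch: "jordan_chain (rmat M) (ev b) (len b) (e b)" if "b < n" for b by (rule jordan_basis_chain[OF jb that])
  have len: "1 \<le> len b" if "b < n" for b using jb that by (simp add: jordan_basis_def)
  have cd: "compact_distribution \<phi>" and int1: "\<phi> (\<lambda>_. 1) = 1"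
    and \<phi>T: "\<And>g. smooth g \<Longrightarrow> \<phi> g = dist_transition M c \<phi> g"
    using ref by (auto simp: refinable_def dist_integral_def)
  \<comment> \<open>the fixed points of the transition operator form a space of dimension at most one\<close>
  have multiple: "h x = (LBINT x. h x) * f x"
    if h: "Cc h" "transition M c h = h" and f: "Cc f" "transition M c f = f" "(LBINT x. f x) = 1" for h f x
  proof -
    let ?I = "LBINT x. h x"
    have "h x - ?I * f x = 0"
    proof (rule transition_fixed_eq_0[OF inv fin cs tends])
      show "Cc (\<lambda>x. h x - ?I * f x)" by (intro Cc_diff Cc_cmult h f)
      show "transition M c (\<lambda>x. h x - ?I * f x) = (\<lambda>x. h x - ?I * f x)"
        unfolding transition_diff transition_cmult h f ..
      show "(LBINT x. h x - ?I * f x) = 0"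
        by (subst Bochner_Integration.integral_diff) (auto simp: f intro!: Cc_integrable h f integrable_mult_right)
    qed
    then show ?thesis by simp
  qed
  have repr: "Cc f \<and> transition M c f = f \<and> (LBINT x. f x) = 1" if "represents f \<phi>" for f
  proof -
    have "\<phi> (\<lambda>_. 1) = (LBINT x. f x * 1)"
      using that smooth_const[of 1] unfolding represents_def by blast
    then show ?thesis
      using represents_Cc[OF that] represents_refinable_fixed[OF inv ref that] int1 by simp
  qed
  have fwd: "\<exists>\<psi>. block_solution M c (ev b) (len b) (e b) \<psi>" if C: "dist_C1 \<phi>" and b: "b < n" for b
  proof -
    obtain f where f: "C1 f" "represents f \<phi>" using C by (auto simp: dist_C1_def)
    note r = repr[OF f(2)]
    obtain x0 where "f x0 \<noteq> 0"
    proof (rule ccontr)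
      assume "\<not> thesis"
      then have "f = (\<lambda>_. 0)" using \<open>\<And>x0. f x0 \<noteq> 0 \<Longrightarrow> thesis\<close> by (auto simp: fun_eq_iff)
      then show False using r by simp
    qed
    then show ?thesis
      using C1_directional_deriv_block_solution[OF ch[OF b] len[OF b] inv ev[OF b]] r f(1) by blast
  qed
  have bwd: "dist_C1 \<phi>" if sol: "\<forall>b<n. \<exists>\<psi>. block_solution M c (ev b) (len b) (e b) \<psi>"
  proof -
    obtain \<psi> where \<psi>: "\<And>b. b < n \<Longrightarrow> block_solution M c (ev b) (len b) (e b) (\<psi> b)" using sol by metis
    let ?Q = "\<lambda>b h. Cc h \<and> transition M c h = h \<and> (LBINT x. h x) \<noteq> 0 \<and>
        (\<forall>i\<in>{1..len b}. has_dd h (e b i) (\<psi> b i))"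
    have "\<exists>h. b < n \<longrightarrow> ?Q b h" for b
    proof (cases "b < n")
      case True
      show ?thesis
        by (rule block_solution_fixed_point[OF ch[OF True] inv ev[OF True] fin cs tends \<psi>[OF True]]) blast
    qed simp
    then have "\<exists>h. \<forall>b. b < n \<longrightarrow> ?Q b (h b)" by (intro choice allI)
    then obtain h where "\<forall>b. b < n \<longrightarrow> ?Q b (h b)" by (rule exE)
    then have h: "\<And>b. b < n \<Longrightarrow> Cc (h b)" "\<And>b. b < n \<Longrightarrow> transition M c (h b) = h b"
      "\<And>b. b < n \<Longrightarrow> (LBINT x. h b x) \<noteq> 0"
      "\<And>b i. b < n \<Longrightarrow> i \<in> {1..len b} \<Longrightarrow> has_dd (h b) (e b i) (\<psi> b i)"
      by simp_all
    let ?P = "SIGMA b:{..<n}. {1..len b}" and ?e = "\<lambda>(b, i). e b i"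
    have ind: "independent (?e ` ?P)" and span: "span (?e ` ?P) = UNIV"
      using jb by (auto simp: jordan_basis_def)
    have n0: "0 < n"
    proof (rule ccontr)
      assume "\<not> 0 < n"
      then have "span (?e ` ?P) = {0}" by simp
      then have "axis undefined 1 = (0 :: real^'n)" using span by blast
      then show False by simp
    qed
    define f where "f x = inverse (LBINT x. h 0 x) * h 0 x" for x
    have f_eq: "f = (\<lambda>x. inverse (LBINT x. h 0 x) * h 0 x)" by (simp add: f_def fun_eq_iff)
    have f: "Cc f" "transition M c f = f" "(LBINT x. f x) = 1"
      unfolding f_eq using h(1-3)[OF n0] by (auto simp: transition_cmult Cc_cmult)
    have dd: "\<exists>G. has_dd f v G \<and> continuous_on UNIV G" if v: "v \<in> ?e ` ?P" for v
    proof -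
      obtain b i where b: "b < n" "i \<in> {1..len b}" "v = e b i" using v by auto
      let ?I = "LBINT x. h b x"
      have "f x = inverse ?I * h b x" for x
      proof -
        have "inverse ?I * h b x = inverse ?I * (?I * f x)"
          by (rule arg_cong[OF multiple[OF h(1,2)[OF b(1)] f]])
        also have "\<dots> = (inverse ?I * ?I) * f x" by (rule mult.assoc[symmetric])
        finally show ?thesis using h(3)[OF b(1)] by simp
      qed
      then have "f = (\<lambda>x. inverse ?I * h b x)" by (rule ext)
      then have "has_dd f v (\<lambda>x. inverse (LBINT x. h b x) * \<psi> b i x)"
        using has_dd_cmult[OF h(4)[OF b(1,2)]] b(3) by simp
      moreover have "Cc (\<psi> b i)"
        using \<psi>[OF b(1)] b(2) cont_mean_zero_Cc unfolding block_solution_def by blast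
      ultimately show ?thesis
        by (intro exI[of _ "\<lambda>x. inverse (LBINT x. h b x) * \<psi> b i x"] conjI Cc_continuous Cc_cmult)
    qed
    then obtain G where G: "\<And>v. v \<in> ?e ` ?P \<Longrightarrow> has_dd f v (G v)" "\<And>v. v \<in> ?e ` ?P \<Longrightarrow> continuous_on UNIV (G v)"
      by metis
    have "C1 f" by (rule C1_if_directional[OF ind span G])
    moreover have "represents f \<phi>"
      unfolding represents_def
    proof (intro conjI allI impI)
      show "continuous_on UNIV f" "compactly_supported f" using f(1) by (auto simp: Cc_iff)
      fix g :: "real^'n \<Rightarrow> real" assume g: "smooth g"
      have "\<phi> g - (LBINT x. f x * g x) = 0"
      proof (rule dist_refinement_unique[OF inv fin cs tends _ _ _ g])
        show "compact_distribution (\<lambda>g. \<phi> g - (LBINT x. f x * g x))"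
          by (intro compact_distribution_diff cd compact_distribution_integral f)
        show "\<phi> (\<lambda>_. 1) - (LBINT x. f x * 1) = 0" using f(3) int1 by simp
        fix g :: "real^'n \<Rightarrow> real" assume g: "smooth g"
        show "\<phi> g - (LBINT x. f x * g x) = dist_transition M c (\<lambda>g. \<phi> g - (LBINT x. f x * g x)) g"
          unfolding \<phi>T[OF g] integral_fixed_dist_transition[OF inv f(1,2) g]
          by (simp add: dist_transition_def sum_subtractf diff_divide_distrib right_diff_distrib)
      qed
      then show "\<phi> g = (LBINT x. f x * g x)" by simp
    qed
    ultimately show ?thesis unfolding dist_C1_def by blast
  qed
  have "\<exists>\<kappa>. \<kappa> \<noteq> 0 \<and> (\<forall>i\<in>{1..len b}. \<forall>x. directional_deriv (e b i) f x = \<kappa> * \<psi> i x)"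
    if f: "C1 f" "represents f \<phi>" and b: "b < n" and sol: "block_solution M c (ev b) (len b) (e b) \<psi>" for f b \<psi>
  proof -
    obtain h where h: "Cc h" "transition M c h = h" "(LBINT x. h x) \<noteq> 0"
      "\<And>i. i \<in> {1..len b} \<Longrightarrow> has_dd h (e b i) (\<psi> i)"
      using block_solution_fixed_point[OF ch[OF b] inv ev[OF b] fin cs tends sol] by blast
    let ?I = "LBINT x. h x"
    have "h = (\<lambda>x. ?I * f x)" using multiple[OF h(1,2)] repr[OF f(2)] by blast
    then have "has_dd (\<lambda>x. ?I * f x) (e b i) (\<psi> i)" if "i \<in> {1..len b}" for i using h(4)[OF that] by simp
    moreover have "has_dd (\<lambda>x. ?I * f x) (e b i) (\<lambda>x. ?I * directional_deriv (e b i) f x)" for i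
      by (intro has_dd_cmult C1_has_dd f)
    ultimately have "\<psi> i = (\<lambda>x. ?I * directional_deriv (e b i) f x)" if "i \<in> {1..len b}" for i
      using has_dd_unique that by blast
    then show ?thesis using h(3) by (intro exI[of _ "inverse ?I"]) simp
  qed
  then show ?thesis using fwd bwd by blast
qed

end
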